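(* Let $X$ be a finite birack of birack rank $N$ and let $R$ be a birack module over $X$ (an $X$-module, i.e. a $\mathbb{Z}_B[X]$-module). If $L$ and $L'$ are ambient isotopic oriented classical or virtual links, then $$\Phi_{X,R}^{B}(L)=\Phi_{X,R}^{B}(L')\qquad\text{and}\qquad \Phi_{X,R}^{B,M}(L)=\Phi_{X,R}^{B,M}(L'),$$ where $\Phi_{X,R}^{B}$ is the birack module enhanced polynomial and $\Phi_{X,R}^{B,M}$ is the birack module enhanced multiset.
   Context: **Biracks.** A birack structure on a set $X$ is an invertible map $B=(B_1,B_2):X\times X\to X\times X$, written $B_1(x,y)=y^x$, $B_2(x,y)=x_y$, such that: (i) there is a unique invertible map $S:X\times X\to X\times X$ with $S(B_1(x,y),x)=(B_2(x,y),y)$ for all $x,y\in X$; (ii) with $\Delta(x)=(x,x)$, the compositions $S_1^{\pm1}\circ\Delta$ and $S_2^{\pm1}\circ\Delta$ of $\Delta$ with the components of $S$ and of $S^{-1}$ are bijections $X\to X$; (iii) $(B\times I)(I\times B)(B\times I)=(I\times B)(B\times I)(I\times B)$. Define bijections of $X$ by $\alpha=(S_2^{-1}\circ\Delta)^{-1}$ and $\pi=S_1^{-1}\circ\Delta\circ\alpha$, where $S^{-1}_i$ denotes the $i$-th component of $S^{-1}$. The birack rank $N$ of $X$ is the smallest positive integer with $\pi^N(x)=x$ for all $x\in X$; it exists when $X$ is finite. **Birack algebra and modules.** For a finite birack $X$ of rank $N$, the birack algebra $\mathbb{Z}_B[X]$ is the quotient of the polynomial algebra $\mathbb{Z}[t^{\pm1}_{x,y},s_{x,y},r^{\pm1}_{x,y}]$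 generated by invertible elements $t_{x,y},r_{x,y}$ and general elements $s_{x,y}$ for all $x,y\in X$, modulo the ideal defined by the following elements (for all $x,y,z\in X$): - $r_{x_y,z}r_{x,y}-r_{x_{z^y},y_z}r_{x,z^y}$, - $t_{x_{z^y},y_z}r_{y,z}-r_{y^x,z^{x_y}}t_{x,y}$, - $s_{x_{z^y},y_z}r_{x,z^y}-r_{y^x,z^{x_y}}s_{x,y}$, - $t_{x,z^y}t_{y,z}-t_{y^x,z^{x_y}}t_{x_y,z}$, - $t_{x,z^y}s_{y,z}-s_{y^x,z^{x_y}}t_{x,y}$, - $s_{x,z^y}-t_{y^x,z^{x_y}}s_{x_y,z}r_{x,y}-s_{y^x,z^{x_y}}s_{x,y}$, - $1-\prod_{k=0}^{N-1}\big(t_{\pi^k(x),\alpha(\pi^k(x))}r_{\pi^k(x),\alpha(\pi^k(x))}+s_{\pi^k(x),\alpha(\pi^k(x))}\big)$. A birack module over $X$ (or $X$-module) is a representation of $\mathbb{Z}_B[X]$, i.e. an abelian group with automorphisms $t_{x,y},r_{x,y}$ and endomorphisms $s_{x,y}$ such that the maps listed above are zero. For example, a ring $R$ becomes one by choosing invertible elements $t_{x,y},r_{x,y}\in R$ and elements $s_{x,y}\in R$ satisfying the relations. **Labelings.** An oriented link diagram (classical, or virtual with virtual crossings ignored) is divided into semiarcs at its classical crossings, over and under. An $X$-labeling assigns an element of $X$ to each semiarc so that the following holds at each classical crossing. - At a positive crossing: if the incoming over-semiarc has label $x$ and the incoming under-semiarc has label $y$, then the outgoing under-semiarc has label $y^x$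 and the outgoing over-semiarc has label $x_y$. - At a negative crossing: if the outgoing over-semiarc has label $x$ and the outgoing under-semiarc has label $y$, then the incoming under-semiarc has label $y^x$ and the incoming over-semiarc has label $x_y$. For a diagram $D$, the fundamental birack $FB(D)$ is the set of equivalence classes of birack words in the semiarcs of $D$ modulo the birack axioms and the crossing relations; $\mathrm{Hom}(FB(D),X)$, the set of birack homomorphisms $FB(D)\to X$, is identified with the set of $X$-labelings of $D$. **Fundamental module of a labeling.** Given an $X$-labeling $f$ of $D$, $\mathbb{Z}_f[X]$ is the $\mathbb{Z}_B[X]$-module with one generator ("bead") per semiarc and two relations per classical crossing. With $x,y$ the labels of the over- and under-semiarcs, respectively, that are incoming at a positive crossing or outgoing at a negative crossing, let $a,b,c,d$ be the beads on the semiarcs labeled $x,\ y,\ y^x,\ x_y$ there, respectively; the relations are $$c=s_{x,y}a+t_{x,y}b,\qquad d=r_{x,y}a.$$ Thus elements of $\mathrm{Hom}_{\mathbb{Z}_B[X]}(\mathbb{Z}_f[X],R)$ are the labelings of the beads by elements of $R$ satisfying these equations at all classical crossings. **Invariants.** Let $L$ be an oriented (classical or virtual) link of $c$ components, let $W=(\mathbb{Z}_N)^c$, and for each $\mathbf{w}=(w_1,\dots,w_c)\in W$ let $(L,\mathbf{w})$ be a (blackboard framed) diagram of $L$ with writhe $w_k$ (mod $N$) on component $k$. The birack module enhanced multiset is the multiset of $R$-modules (compared up to isomorphism) $$\Phi_{X,R}^{B,M}(L)=\{\mathrm{Hom}_{\mathbb{Z}_B[X]}(\mathbb{Z}_f[X],R)\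 |\ f\in\mathrm{Hom}(FB((L,\mathbf{w})),X),\ \mathbf{w}\in W\},$$ and the birack module enhanced polynomial is $$\Phi_{X,R}^{B}(L)=\sum_{\mathbf{w}\in W}\left(\sum_{f\in\mathrm{Hom}(FB((L,\mathbf{w})),X)}u^{|\mathrm{Hom}_{\mathbb{Z}_B[X]}(\mathbb{Z}_f[X],R)|}\right),$$ where $u$ is a formal variable. If $R$ is not a finite set, the cardinality $|\mathrm{Hom}_{\mathbb{Z}_B[X]}(\mathbb{Z}_f[X],R)|$ is replaced by the rank of the $R$-module $\mathrm{Hom}_{\mathbb{Z}_B[X]}(\mathbb{Z}_f[X],R)$. *)

theory Defs
  imports
    "HOL-Algebra.Module"
    "HOL-Combinatorics.Transposition"
    "HOL-Library.Extended_Nat"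
    "HOL-Library.FuncSet"
    "HOL-Library.Multiset"
    "HOL-Library.Poly_Mapping"
    "HOL-Library.Sublist"
    "HOL-Number_Theory.Cong"
begin

section \<open>Biracks\<close>

definition birack_up :: "('x \<times> 'x \<Rightarrow> 'x \<times> 'x) \<Rightarrow> 'x \<Rightarrow> 'x \<Rightarrow> 'x"  \<comment> \<open>\<open>birack_up B x y\<close> is \<open>y\<close> to the superscript \<open>x\<close>\<close>
  where "birack_up B x y = fst (B (x, y))"

definition birack_down :: "('x \<times> 'x \<Rightarrow> 'x \<times> 'x) \<Rightarrow> 'x \<Rightarrow> 'x \<Rightarrow> 'x"  \<comment> \<open>\<open>birack_down B x y\<close> is \<open>x\<close> with subscript \<open>y\<close>\<close>
  where "birack_down B x y = snd (B (x, y))"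

definition is_sideways :: "('x \<times> 'x \<Rightarrow> 'x \<times> 'x) \<Rightarrow> ('x \<times> 'x \<Rightarrow> 'x \<times> 'x) \<Rightarrow> bool"
  where "is_sideways B S \<longleftrightarrow>
    bij S \<and> (\<forall>x y. S (birack_up B x y, x) = (birack_down B x y, y))"

definition sideways :: "('x \<times> 'x \<Rightarrow> 'x \<times> 'x) \<Rightarrow> 'x \<times> 'x \<Rightarrow> 'x \<times> 'x"
  where "sideways B = (THE S. is_sideways B S)"

definition diag :: "'x \<Rightarrow> 'x \<times> 'x"
  where "diag x = (x, x)"

definition act_left :: "('x \<times> 'x \<Rightarrow> 'x \<times> 'x) \<Rightarrow> 'x \<times> 'x \<times> 'x \<Rightarrow> 'x \<times> 'x \<times> 'x"  \<comment> \<open>\<open>B \<times> I\<close>\<close>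
  where "act_left B = (\<lambda>(x, y, z). (birack_up B x y, birack_down B x y, z))"

definition act_right :: "('x \<times> 'x \<Rightarrow> 'x \<times> 'x) \<Rightarrow> 'x \<times> 'x \<times> 'x \<Rightarrow> 'x \<times> 'x \<times> 'x"  \<comment> \<open>\<open>I \<times> B\<close>\<close>
  where "act_right B = map_prod id B"

definition birack :: "('x \<times> 'x \<Rightarrow> 'x \<times> 'x) \<Rightarrow> bool"
  where "birack B \<longleftrightarrow>
    bij B \<and>
    (\<exists>!S. is_sideways B S) \<and>
    bij (fst \<circ> sideways B \<circ> diag) \<and> bij (snd \<circ> sideways B \<circ> diag) \<and>
    bij (fst \<circ> inv_into UNIV (sideways B) \<circ> diag) \<and> bij (snd \<circ> inv_into UNIV (sideways B) \<circ> diag) \<and>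
    act_left B \<circ> act_right B \<circ> act_left B = act_right B \<circ> act_left B \<circ> act_right B"

definition kink_alpha :: "('x \<times> 'x \<Rightarrow> 'x \<times> 'x) \<Rightarrow> 'x \<Rightarrow> 'x"
  where "kink_alpha B = inv_into UNIV (snd \<circ> inv_into UNIV (sideways B) \<circ> diag)"

definition kink_pi :: "('x \<times> 'x \<Rightarrow> 'x \<times> 'x) \<Rightarrow> 'x \<Rightarrow> 'x"
  where "kink_pi B = fst \<circ> inv_into UNIV (sideways B) \<circ> diag \<circ> kink_alpha B"

definition birack_rank :: "('x \<times> 'x \<Rightarrow> 'x \<times> 'x) \<Rightarrow> nat"
  where "birack_rank B = (LEAST N. 0 < N \<and> (\<forall>x. (kink_pi B ^^ N) x = x))"


section \<open>Modules, rank and isomorphism\<close>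

definition module_endo :: "('k, 'a) ring_scheme \<Rightarrow> ('k, 'm, 'b) module_scheme \<Rightarrow> ('m \<Rightarrow> 'm) \<Rightarrow> bool"
  where "module_endo K M h \<longleftrightarrow>
    h \<in> carrier M \<rightarrow> carrier M \<and>
    (\<forall>a\<in>carrier M. \<forall>b\<in>carrier M. h (a \<oplus>\<^bsub>M\<^esub> b) = h a \<oplus>\<^bsub>M\<^esub> h b) \<and>
    (\<forall>k\<in>carrier K. \<forall>a\<in>carrier M. h (k \<odot>\<^bsub>M\<^esub> a) = k \<odot>\<^bsub>M\<^esub> h a)"

definition module_auto :: "('k, 'a) ring_scheme \<Rightarrow> ('k, 'm, 'b) module_scheme \<Rightarrow> ('m \<Rightarrow> 'm) \<Rightarrow> bool"
  where "module_auto K M h \<longleftrightarrow> module_endo K M h \<and> bij_betw h (carrier M) (carrier M)"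

definition module_isomorphic ::
    "('k, 'a) ring_scheme \<Rightarrow> ('k, 'm, 'b) module_scheme \<Rightarrow> ('k, 'n, 'c) module_scheme \<Rightarrow> bool"
  where "module_isomorphic K M M' \<longleftrightarrow> (\<exists>h.
    bij_betw h (carrier M) (carrier M') \<and>
    (\<forall>a\<in>carrier M. \<forall>b\<in>carrier M. h (a \<oplus>\<^bsub>M\<^esub> b) = h a \<oplus>\<^bsub>M'\<^esub> h b) \<and>
    (\<forall>k\<in>carrier K. \<forall>a\<in>carrier M. h (k \<odot>\<^bsub>M\<^esub> a) = k \<odot>\<^bsub>M'\<^esub> h a))"

definition iso_class :: "('k, 'a) ring_scheme \<Rightarrow> ('k, 'm) module \<Rightarrow> ('k, 'm) module set"
  where "iso_class K M = {M'. Module.module K M' \<and> module_isomorphic K M M'}"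

definition lin_independent :: "('k, 'a) ring_scheme \<Rightarrow> ('k, 'm, 'b) module_scheme \<Rightarrow> 'm set \<Rightarrow> bool"
  where "lin_independent K M A \<longleftrightarrow>
    finite A \<and> A \<subseteq> carrier M \<and>
    (\<forall>c \<in> A \<rightarrow> carrier K. (\<Oplus>\<^bsub>M\<^esub>a\<in>A. c a \<odot>\<^bsub>M\<^esub> a) = \<zero>\<^bsub>M\<^esub> \<longrightarrow> (\<forall>a\<in>A. c a = \<zero>\<^bsub>K\<^esub>))"

definition module_rank :: "('k, 'a) ring_scheme \<Rightarrow> ('k, 'm, 'b) module_scheme \<Rightarrow> enat"
  where "module_rank K M = (SUP A \<in> {A. lin_independent K M A}. enat (card A))"


section \<open>Birack modules\<close>

text \<open>
  The abelian group \<open>R\<close> carries a commutative ring \<open>K\<close> of scalars for which the structure maps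
  are linear. The choice of \<open>K\<close> says in which sense the bead modules below are modules:
  \<open>K = \<int>\<close> for an arbitrary abelian group with automorphisms \<open>t, r\<close> and endomorphisms \<open>s\<close>;
  \<open>K = R\<close>, acting by multiplication, when \<open>R\<close> is a commutative ring and \<open>t, s, r\<close> are
  multiplications by ring elements; \<open>K = \<int>\<^sub>B[X]\<close> (or its image in the endomorphisms
  of \<open>R\<close>) when the bead modules are regarded as modules over the commutative birack algebra.
  The structure maps are not required to commute, so the factors of the last relation are
  composed in the order in which they are met along a strand: \<open>fold\<close> applies \<open>k = 0\<close> first.
\<close>

definition birack_module ::
    "('x \<times> 'x \<Rightarrow> 'x \<times> 'x) \<Rightarrow> ('k, 'a) ring_scheme \<Rightarrow> ('k, 'm, 'b) module_scheme \<Rightarrow>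
     ('x \<Rightarrow> 'x \<Rightarrow> 'm \<Rightarrow> 'm) \<Rightarrow> ('x \<Rightarrow> 'x \<Rightarrow> 'm \<Rightarrow> 'm) \<Rightarrow> ('x \<Rightarrow> 'x \<Rightarrow> 'm \<Rightarrow> 'm) \<Rightarrow> bool"
  where "birack_module B K R t s r \<longleftrightarrow>
    Module.module K R \<and>
    (\<forall>x y. module_auto K R (t x y) \<and> module_endo K R (s x y) \<and> module_auto K R (r x y)) \<and>
    (let u = birack_up B; d = birack_down B in
      \<forall>a\<in>carrier R. \<forall>x y z.
        r (d x y) z (r x y a) = r (d x (u y z)) (d y z) (r x (u y z) a) \<and>
        t (d x (u y z)) (d y z) (r y z a) = r (u x y) (u (d x y) z) (t x y a) \<and>
        s (d x (u y z)) (d y z) (r x (u y z) a) = r (u x y) (u (d x y) z) (s x y a) \<and>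
        t x (u y z) (t y z a) = t (u x y) (u (d x y) z) (t (d x y) z a) \<and>
        t x (u y z) (s y z a) = s (u x y) (u (d x y) z) (t x y a) \<and>
        s x (u y z) a =
          t (u x y) (u (d x y) z) (s (d x y) z (r x y a)) \<oplus>\<^bsub>R\<^esub> s (u x y) (u (d x y) z) (s x y a)) \<and>
    (\<forall>a\<in>carrier R. \<forall>x.
      fold (\<lambda>k b. let p = (kink_pi B ^^ k) x; q = kink_alpha B p in t p q (r p q b) \<oplus>\<^bsub>R\<^esub> s p q b)
        [0..<birack_rank B] a = a)"


section \<open>Oriented link diagrams\<close>

text \<open>
  A diagram is given by its signed Gauss code: for each component (the components are ordered) the
  cyclic word, read along the orientation from an arbitrary base point, of its passages through
  classical crossings. A passage consists of its level, the name of the crossing and the sign of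
  the crossing. Virtual crossings are not recorded; arbitrary Gauss codes describe virtual
  diagrams, those of planar diagrams describe classical ones. The empty word is a component
  without classical crossings.
\<close>

datatype level = Over | Under

type_synonym passage = "level \<times> nat \<times> int"
type_synonym gauss_code = "passage list list"

definition gauss_diagram :: "gauss_code \<Rightarrow> bool"
  where "gauss_diagram D \<longleftrightarrow>
    distinct (map (\<lambda>(l, c, e). (l, c)) (concat D)) \<and>
    (\<forall>(l, c, e) \<in> set (concat D). e \<in> {1, -1}) \<and>
    (\<forall>c e. (Over, c, e) \<in> set (concat D) \<longleftrightarrow> (Under, c, e) \<in> set (concat D))"

definition delete_crossings :: "nat set \<Rightarrow> gauss_code \<Rightarrow> gauss_code"
  where "delete_crossings C = map (filter (\<lambda>(l, c, e). c \<notin> C))"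

definition has_block :: "gauss_code \<Rightarrow> passage list \<Rightarrow> bool"
  where "has_block D xs \<longleftrightarrow> (\<exists>w\<in>set D. sublist xs w)"

definition same_diagram :: "gauss_code \<Rightarrow> gauss_code \<Rightarrow> bool"  \<comment> \<open>change of a base point or of crossing names\<close>
  where "same_diagram D D' \<longleftrightarrow>
    (\<exists>k<length D. D' = D[k := rotate1 (D ! k)]) \<or>
    (\<exists>h. inj h \<and> D' = map (map (\<lambda>(l, c, e). (l, h c, e))) D)"

definition reidemeister1 :: "gauss_code \<Rightarrow> gauss_code \<Rightarrow> bool"
  where "reidemeister1 D D' \<longleftrightarrow> (\<exists>c e.
    D = delete_crossings {c} D' \<and>
    (has_block D' [(Over, c, e), (Under, c, e)] \<or> has_block D' [(Under, c, e), (Over, c, e)]))"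

definition reidemeister2 :: "gauss_code \<Rightarrow> gauss_code \<Rightarrow> bool"  \<comment> \<open>parallel and antiparallel strands\<close>
  where "reidemeister2 D D' \<longleftrightarrow> (\<exists>c d e. c \<noteq> d \<and>
    D = delete_crossings {c, d} D' \<and>
    has_block D' [(Over, c, e), (Over, d, -e)] \<and>
    (has_block D' [(Under, c, e), (Under, d, -e)] \<or> has_block D' [(Under, d, -e), (Under, c, e)]))"

text \<open>
  In the third move a top, a middle and a bottom strand cross pairwise, at \<open>p\<close> (top over
  middle), \<open>q\<close> (top over bottom) and \<open>v\<close> (middle over bottom) with signs \<open>e\<close>, \<open>f\<close>, \<open>g\<close>. Take the
  strands as straight lines with directions \<open>T\<close>, \<open>M\<close>, \<open>L\<close>, so that the signs are those of
  \<open>T \<times> M\<close>, \<open>T \<times> L\<close>, \<open>M \<times> L\<close>, and let \<open>\<delta>\<close> be \<open>1\<close> if the crossing \<open>v\<close> lies to the left of the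
  top strand and \<open>-1\<close> otherwise. Then the middle strand meets \<open>p\<close> before \<open>v\<close> iff \<open>\<delta> e = 1\<close>, the
  bottom strand meets \<open>q\<close> before \<open>v\<close> iff \<open>\<delta> f = 1\<close>, and the top strand meets \<open>p\<close> before \<open>q\<close> iff
  \<open>\<delta> e f g = 1\<close>. The move pushes \<open>v\<close> across the top strand, which reverses all three orders.
  The values of \<open>e\<close>, \<open>f\<close>, \<open>g\<close> are the eight oriented versions of the move.
\<close>

definition reidemeister3 :: "gauss_code \<Rightarrow> gauss_code \<Rightarrow> bool"
  where "reidemeister3 D D' \<longleftrightarrow> (\<exists>p q v e f g \<delta>.
    distinct [p, q, v] \<and> {e, f, g, \<delta>} \<subseteq> {1, -1} \<and>
    (let t1 = (Over, p, e); t2 = (Over, q, f);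
         m1 = (Under, p, e); m2 = (Over, v, g);
         b1 = (Under, q, f); b2 = (Under, v, g) in
      has_block D (if \<delta> * e * f * g = 1 then [t1, t2] else [t2, t1]) \<and>
      has_block D (if \<delta> * e = 1 then [m1, m2] else [m2, m1]) \<and>
      has_block D (if \<delta> * f = 1 then [b1, b2] else [b2, b1]) \<and>
      D' = map (map (transpose t1 t2 \<circ> transpose m1 m2 \<circ> transpose b1 b2)) D))"

definition diagram_move :: "gauss_code \<Rightarrow> gauss_code \<Rightarrow> bool"
  where "diagram_move D D' \<longleftrightarrow>
    gauss_diagram D \<and> gauss_diagram D' \<and>
    (same_diagram D D' \<or> reidemeister1 D D' \<or> reidemeister2 D D' \<or> reidemeister3 D D')"

text \<open>
  Isotopy respecting the numbering of the components, and isotopy of links with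
  unnumbered components.
\<close>

definition isotopic :: "gauss_code \<Rightarrow> gauss_code \<Rightarrow> bool"
  where "isotopic = equivclp diagram_move"

definition ambient_isotopic :: "gauss_code \<Rightarrow> gauss_code \<Rightarrow> bool"
  where "ambient_isotopic L L' \<longleftrightarrow> (\<exists>E. mset E = mset L \<and> isotopic E L')"

text \<open>The writhe of a component is its blackboard framing number: only self-crossings count.\<close>

definition writhe :: "gauss_code \<Rightarrow> nat \<Rightarrow> int"
  where "writhe D k =
    (\<Sum>(l, c, e)\<leftarrow>D ! k. if l = Over \<and> (Under, c, e) \<in> set (D ! k) then e else 0)"

definition framings :: "nat \<Rightarrow> gauss_code \<Rightarrow> (nat \<Rightarrow> nat) set"  \<comment> \<open>\<open>(\<int>\<^sub>N)\<close> to the power of the number of components\<close>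
  where "framings N L = {..<length L} \<rightarrow>\<^sub>E {..<N}"

definition framed_diagram :: "nat \<Rightarrow> gauss_code \<Rightarrow> (nat \<Rightarrow> nat) \<Rightarrow> gauss_code \<Rightarrow> bool"
  where "framed_diagram N L w D \<longleftrightarrow>
    isotopic L D \<and> (\<forall>k<length L. [writhe D k = int (w k)] (mod int N))"

text \<open>Every framing of a link is realised: kinks change the writhe of a single component by one.\<close>

definition add_kink :: "gauss_code \<Rightarrow> nat \<Rightarrow> nat \<Rightarrow> int \<Rightarrow> gauss_code"
  where "add_kink D k c e = D[k := (Over, c, e) # (Under, c, e) # D ! k]"

lemma mset_concat_upd:
  "k < length D \<Longrightarrow> mset (concat (D[k := xs @ D ! k])) = mset xs + mset (concat D)"
proof (induction D arbitrary: k)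
  case (Cons a D) then show ?case by (cases k) auto
qed simp

lemma framed_diagram_step:
  assumes "gauss_diagram D" "k < length D" "e \<in> {1, -1}"
  shows "\<exists>D'. isotopic D D' \<and> gauss_diagram D' \<and> length D' = length D \<and>
    (\<forall>j<length D. writhe D' j = writhe D j + (if j = k then e else 0))"
proof -
  have "finite ((\<lambda>(l, c, e). c) ` set (concat D))" by simp
  then obtain c where "c \<notin> (\<lambda>(l, c, e). c) ` set (concat D)"
    using ex_new_if_finite infinite_UNIV_nat by blast
  then have c: "(l, c, e') \<notin> set (concat D)" for l e' by (force simp: image_def)
  define D' where "D' = add_kink D k c e"
  have M: "mset (concat D') = mset [(Over, c, e), (Under, c, e)] + mset (concat D)"
    using mset_concat_upd[OF assms(2), of "[(Over, c, e), (Under, c, e)]"] by (simp add: D'_def add_kink_def)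
  have S: "set (concat D') = {(Over, c, e), (Under, c, e)} \<union> set (concat D)"
    unfolding set_mset_mset[symmetric] M by simp
  have M2: "mset (map (\<lambda>(l, c, e). (l, c)) (concat D')) = mset (map (\<lambda>(l, c, e). (l, c)) ([(Over, c, e), (Under, c, e)] @ concat D))"
    unfolding mset_map M by simp
  have "distinct (map (\<lambda>(l, c, e). (l, c)) ([(Over, c, e), (Under, c, e)] @ concat D))"
    using assms(1) c by (auto simp: gauss_diagram_def)
  then have "distinct (map (\<lambda>(l, c, e). (l, c)) (concat D'))"
    using M2 mset_eq_imp_distinct_iff by blast
  then have g: "gauss_diagram D'"
    using assms(1,3) unfolding gauss_diagram_def S by auto
  have sub: "set (D ! j) \<subseteq> set (concat D)" if "j < length D" for j using nth_mem[OF that] by auto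
  have f: "filter (\<lambda>(l, c', e). c' \<noteq> c) w = w" if "w \<in> set D" for w
    using that c by (intro filter_True) auto
  then have "map (filter (\<lambda>(l, c', e). c' \<noteq> c)) D = D" by (simp add: map_idI)
  then have "delete_crossings {c} D' = D"
    using f[of "D ! k"] assms(2) by (simp add: delete_crossings_def D'_def add_kink_def map_update)
  moreover have "has_block D' [(Over, c, e), (Under, c, e)]"
  proof -
    have "(Over, c, e) # (Under, c, e) # D ! k = [] @ [(Over, c, e), (Under, c, e)] @ D ! k"
      by simp
    then have "sublist [(Over, c, e), (Under, c, e)] ((Over, c, e) # (Under, c, e) # D ! k)"
      unfolding sublist_def by blast
    then show ?thesis
      using assms(2) unfolding has_block_def D'_def add_kink_def
      by (meson set_update_memI)
  qed
  ultimately have "reidemeister1 D D'" unfolding reidemeister1_def by metis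
  then have "diagram_move D D'" using assms(1) g by (simp add: diagram_move_def)
  then have "isotopic D D'" unfolding isotopic_def by (simp add: r_into_equivclp)
  moreover have "writhe D' j = writhe D j + (if j = k then e else 0)" if "j < length D" for j
  proof (cases "j = k")
    case True
    have "(\<Sum>(l, c', e')\<leftarrow>D ! k. if l = Over \<and> (Under, c', e') \<in> set ((Over, c, e) # (Under, c, e) # D ! k) then e' else 0)
       = (\<Sum>(l, c', e')\<leftarrow>D ! k. if l = Over \<and> (Under, c', e') \<in> set (D ! k) then e' else 0)"
      using c sub[OF assms(2)] by (intro arg_cong[of _ _ sum_list] map_cong) auto
    then show ?thesis using True assms(2) by (simp add: writhe_def D'_def add_kink_def)
  qed (simp add: writhe_def D'_def add_kink_def)
  ultimately show ?thesis using g by (auto simp: D'_def add_kink_def)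
qed

lemma framed_diagram_add:
  assumes "gauss_diagram L" "isotopic L D" "gauss_diagram D" "length D = length L" "k < length L"
  shows "\<exists>D'. isotopic L D' \<and> gauss_diagram D' \<and> length D' = length L \<and>
    (\<forall>j<length L. writhe D' j = writhe D j + (if j = k then int n else 0))"
proof (induction n)
  case 0 then show ?case using assms by auto
next
  case (Suc n)
  then obtain D' where D': "isotopic L D'" "gauss_diagram D'" "length D' = length L"
    "\<forall>j<length L. writhe D' j = writhe D j + (if j = k then int n else 0)" by blast
  obtain E where E: "isotopic D' E" "gauss_diagram E" "length E = length D'"
    "\<forall>j<length D'. writhe E j = writhe D' j + (if j = k then 1 else 0)"
    using framed_diagram_step[of D' k 1] D' assms by auto
  have "isotopic L E" using D'(1) E(1) unfolding isotopic_def by (rule equivclp_trans)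
  then show ?case using D' E by (intro exI[of _ E]) auto
qed

lemma framed_diagram_exists:
  assumes "gauss_diagram L" "0 < N"
  shows "\<exists>D. framed_diagram N L w D"
proof -
  have "\<exists>D. isotopic L D \<and> gauss_diagram D \<and> length D = length L \<and>
    (\<forall>k<m. [writhe D k = int (w k)] (mod int N))" if "m \<le> length L" for m
    using that
  proof (induction m)
    case 0
    then show ?case using assms by (intro exI[of _ L]) (simp add: isotopic_def)
  next
    case (Suc m)
    then obtain D where D: "isotopic L D" "gauss_diagram D" "length D = length L"
      "\<forall>k<m. [writhe D k = int (w k)] (mod int N)" by auto
    define n where "n = nat ((int (w m) - writhe D m) mod int N)"
    obtain E where E: "isotopic L E" "gauss_diagram E" "length E = length L"
      "\<forall>j<length L. writhe E j = writhe D j + (if j = m then int n else 0)"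
      using framed_diagram_add[of L D m n] D Suc.prems assms by auto
    have "int n = (int (w m) - writhe D m) mod int N"
      using assms(2) by (simp add: n_def)
    then have "[writhe D m + int n = int (w m)] (mod int N)"
      by (simp add: cong_def mod_add_right_eq)
    then show ?case using D E Suc.prems by (intro exI[of _ E]) (auto simp: less_Suc_eq)
  qed
  then show ?thesis unfolding framed_diagram_def by blast
qed


section \<open>Labelings and bead modules\<close>

text \<open>
  The semiarc \<open>(k, i)\<close> of component \<open>k\<close> is the one leading to its \<open>i\<close>-th passage; it leaves
  the preceding passage. A component without crossings is a single semiarc \<open>(k, 0)\<close>.
\<close>

type_synonym semiarc = "nat \<times> nat"

definition semiarcs :: "gauss_code \<Rightarrow> semiarc set"
  where "semiarcs D = {(k, i). k < length D \<and> i < max 1 (length (D ! k))}"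

definition next_semiarc :: "gauss_code \<Rightarrow> semiarc \<Rightarrow> semiarc"
  where "next_semiarc D = (\<lambda>(k, i). (k, Suc i mod length (D ! k)))"

definition leads_to :: "gauss_code \<Rightarrow> semiarc \<Rightarrow> passage \<Rightarrow> bool"
  where "leads_to D = (\<lambda>(k, i) m. k < length D \<and> i < length (D ! k) \<and> D ! k ! i = m)"

text \<open>
  The semiarcs at a crossing, listed in the order of the labels \<open>x\<close>, \<open>y\<close>,
  \<open>birack_up B x y\<close>, \<open>birack_down B x y\<close>.
\<close>

definition crossings :: "gauss_code \<Rightarrow> (semiarc \<times> semiarc \<times> semiarc \<times> semiarc) set"
  where "crossings D =
    {(p, q, next_semiarc D q, next_semiarc D p) | p q c.
      leads_to D p (Over, c, 1) \<and> leads_to D q (Under, c, 1)} \<union>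
    {(next_semiarc D p, next_semiarc D q, q, p) | p q c.
      leads_to D p (Over, c, -1) \<and> leads_to D q (Under, c, -1)}"

definition labelings :: "('x \<times> 'x \<Rightarrow> 'x \<times> 'x) \<Rightarrow> gauss_code \<Rightarrow> (semiarc \<Rightarrow> 'x) set"
  where "labelings B D = {f \<in> semiarcs D \<rightarrow>\<^sub>E UNIV.
    \<forall>(p, q, p', q') \<in> crossings D. f p' = birack_up B (f p) (f q) \<and> f q' = birack_down B (f p) (f q)}"

definition bead_labelings ::
    "('k, 'm, 'b) module_scheme \<Rightarrow>
     ('x \<Rightarrow> 'x \<Rightarrow> 'm \<Rightarrow> 'm) \<Rightarrow> ('x \<Rightarrow> 'x \<Rightarrow> 'm \<Rightarrow> 'm) \<Rightarrow> ('x \<Rightarrow> 'x \<Rightarrow> 'm \<Rightarrow> 'm) \<Rightarrow>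
     gauss_code \<Rightarrow> (semiarc \<Rightarrow> 'x) \<Rightarrow> (semiarc \<Rightarrow> 'm) set"
  where "bead_labelings R t s r D f = {g \<in> semiarcs D \<rightarrow>\<^sub>E carrier R.
    \<forall>(p, q, p', q') \<in> crossings D.
      g p' = s (f p) (f q) (g p) \<oplus>\<^bsub>R\<^esub> t (f p) (f q) (g q) \<and>
      g q' = r (f p) (f q) (g p)}"

text \<open>
  The module of homomorphisms from the fundamental module of the labeling \<open>f\<close> to \<open>R\<close>, with
  pointwise operations. The fields \<open>mult\<close> and \<open>one\<close> of the record have no meaning for modules.
\<close>

definition bead_module ::
    "('k, 'm, 'b) module_scheme \<Rightarrow>
     ('x \<Rightarrow> 'x \<Rightarrow> 'm \<Rightarrow> 'm) \<Rightarrow> ('x \<Rightarrow> 'x \<Rightarrow> 'm \<Rightarrow> 'm) \<Rightarrow> ('x \<Rightarrow> 'x \<Rightarrow> 'm \<Rightarrow> 'm) \<Rightarrow>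
     gauss_code \<Rightarrow> (semiarc \<Rightarrow> 'x) \<Rightarrow> ('k, semiarc \<Rightarrow> 'm) module"
  where "bead_module R t s r D f =
    \<lparr>carrier = bead_labelings R t s r D f,
     monoid.mult = undefined,
     monoid.one = undefined,
     zero = (\<lambda>p\<in>semiarcs D. \<zero>\<^bsub>R\<^esub>),
     add = (\<lambda>g h. \<lambda>p\<in>semiarcs D. g p \<oplus>\<^bsub>R\<^esub> h p),
     smult = (\<lambda>k g. \<lambda>p\<in>semiarcs D. k \<odot>\<^bsub>R\<^esub> g p)\<rparr>"


section \<open>The enhanced invariants\<close>

definition bead_exponent ::
    "('k, 'a) ring_scheme \<Rightarrow> ('k, 'm, 'b) module_scheme \<Rightarrow>
     ('x \<Rightarrow> 'x \<Rightarrow> 'm \<Rightarrow> 'm) \<Rightarrow> ('x \<Rightarrow> 'x \<Rightarrow> 'm \<Rightarrow> 'm) \<Rightarrow> ('x \<Rightarrow> 'x \<Rightarrow> 'm \<Rightarrow> 'm) \<Rightarrow>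
     gauss_code \<Rightarrow> (semiarc \<Rightarrow> 'x) \<Rightarrow> enat"
  where "bead_exponent K R t s r D f =
    (if finite (carrier R) then enat (card (bead_labelings R t s r D f))
     else module_rank K (bead_module R t s r D f))"

text \<open>
  In the following two definitions \<open>F w\<close> is the chosen diagram of the link \<open>L\<close> with writhe
  vector \<open>w\<close>, see \<open>framed_diagram\<close>. The polynomial is the finitely supported function from
  exponents to coefficients; the exponent \<open>\<infinity>\<close> arises only from modules of infinite rank.
\<close>

definition enhanced_polynomial ::
    "('x \<times> 'x \<Rightarrow> 'x \<times> 'x) \<Rightarrow> ('k, 'a) ring_scheme \<Rightarrow> ('k, 'm, 'b) module_scheme \<Rightarrow>
     ('x \<Rightarrow> 'x \<Rightarrow> 'm \<Rightarrow> 'm) \<Rightarrow> ('x \<Rightarrow> 'x \<Rightarrow> 'm \<Rightarrow> 'm) \<Rightarrow> ('x \<Rightarrow> 'x \<Rightarrow> 'm \<Rightarrow> 'm) \<Rightarrow>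
     gauss_code \<Rightarrow> ((nat \<Rightarrow> nat) \<Rightarrow> gauss_code) \<Rightarrow> (enat \<Rightarrow>\<^sub>0 nat)"
  where "enhanced_polynomial B K R t s r L F =
    (\<Sum>w\<in>framings (birack_rank B) L. \<Sum>f\<in>labelings B (F w).
      Poly_Mapping.single (bead_exponent K R t s r (F w) f) 1)"

definition enhanced_multiset ::
    "('x \<times> 'x \<Rightarrow> 'x \<times> 'x) \<Rightarrow> ('k, 'a) ring_scheme \<Rightarrow> ('k, 'm, 'b) module_scheme \<Rightarrow>
     ('x \<Rightarrow> 'x \<Rightarrow> 'm \<Rightarrow> 'm) \<Rightarrow> ('x \<Rightarrow> 'x \<Rightarrow> 'm \<Rightarrow> 'm) \<Rightarrow> ('x \<Rightarrow> 'x \<Rightarrow> 'm \<Rightarrow> 'm) \<Rightarrow>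
     gauss_code \<Rightarrow> ((nat \<Rightarrow> nat) \<Rightarrow> gauss_code) \<Rightarrow> ('k, semiarc \<Rightarrow> 'm) module set multiset"
  where "enhanced_multiset B K R t s r L F =
    (\<Sum>w\<in>framings (birack_rank B) L. \<Sum>f\<in>labelings B (F w).
      {#iso_class K (bead_module R t s r (F w) f)#})"

end

theory Submission
  imports Defs "HOL-Combinatorics.Cycles"
begin

text \<open>
  Labels and beads together are colorings by \<open>X \<times> R\<close>, which is again a birack, fibred in \<open>K\<close>-modules
  over \<open>X\<close>. It suffices to compare colorings by a bijection that commutes with the fibrewise
  operations. To get rid of the framings, allow a coloring to be twisted by \<open>\<pi>\<close> to the power \<open>n k\<close> at the base
  point of component \<open>k\<close>. A twist passes over and under any crossing, a kink of sign \<open>e\<close> acts as a twist by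
  \<open>e\<close>, and the second and third moves do not change the twisted colorings. Hence the colorings of \<open>D\<close>
  with twists \<open>writhe D k - w k\<close> depend only on the link and \<open>w\<close>, and for a diagram with writhe vector
  \<open>w\<close> modulo \<open>N\<close> the twists are trivial because \<open>\<pi>\<close> to the power \<open>N\<close> is the identity.
\<close>

section \<open>Birack relations\<close>

text \<open>The obstacle is that two diagrams with equal writhes modulo \<open>N\<close> are joined
  by moves passing through diagrams with other writhes. Rearranging such a path into framed moves
  and insertions of \<open>N\<close> kinks would call for the Whitney trick. Recording the framing
  defect as an algebraic twist lets each move be treated where it occurs, without any planar
  argument, so virtual diagrams are included. \<open>X\<close> is a relation and not a map because
  the orientations of a move require solving a crossing for every choice of one known end on each
  strand; the four existence and four uniqueness axioms put these choices on an equal footing. The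
  kink axioms are listed separately because \<open>X \<times> R\<close> may be infinite, so
  bijectivity of the kink map cannot be had by counting. For beads it comes from the last relation
  of the birack algebra, which gives the kink map period \<open>N\<close>. The projection to the
  zero section is one of the fibrewise operations because a bijection of colorings that commutes
  with it induces a bijection of the underlying labelings; the other operations then make it linear
  on each fibre.\<close>

text \<open>\<open>X x y z w\<close> stands for \<open>B (x, y) = (z, w)\<close>, that is \<open>z = y\<^sup>x\<close> and \<open>w = x\<^sub>y\<close>.\<close>

locale birack_rel =
  fixes A :: "'q set" and X :: "'q \<Rightarrow> 'q \<Rightarrow> 'q \<Rightarrow> 'q \<Rightarrow> bool"
  assumes X_in: "X x y z w \<Longrightarrow> x \<in> A \<and> y \<in> A \<and> z \<in> A \<and> w \<in> A"
    and ex_out: "x \<in> A \<Longrightarrow> y \<in> A \<Longrightarrow> \<exists>z w. X x y z w"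
    and ex_in: "z \<in> A \<Longrightarrow> w \<in> A \<Longrightarrow> \<exists>x y. X x y z w"
    and ex_side: "x \<in> A \<Longrightarrow> z \<in> A \<Longrightarrow> \<exists>y w. X x y z w"
    and ex_side': "y \<in> A \<Longrightarrow> w \<in> A \<Longrightarrow> \<exists>x z. X x y z w"
    and un_out: "X x y z w \<Longrightarrow> X x y z' w' \<Longrightarrow> z = z' \<and> w = w'"
    and un_in: "X x y z w \<Longrightarrow> X x' y' z w \<Longrightarrow> x = x' \<and> y = y'"
    and un_side: "X x y z w \<Longrightarrow> X x y' z w' \<Longrightarrow> y = y' \<and> w = w'"
    and un_side': "X x y z w \<Longrightarrow> X x' y z' w \<Longrightarrow> x = x' \<and> z = z'"
    and yang_baxter: "X x y y1 x1 \<Longrightarrow> X x1 z z1 x2 \<Longrightarrow> X y1 z1 z2 y2 \<Longrightarrow>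
      X y z c d \<Longrightarrow> X x c c' x' \<Longrightarrow> X x' d d' x'' \<Longrightarrow> c' = z2 \<and> d' = y2 \<and> x'' = x2"
    and kink_ex: "x \<in> A \<Longrightarrow> \<exists>y z. X x y z y"
    and kink_ex': "z \<in> A \<Longrightarrow> \<exists>x y. X x y z y"
    and kink_un: "X x y z y \<Longrightarrow> X x y' z' y' \<Longrightarrow> z = z'"
    and kink_un': "X x y z y \<Longrightarrow> X x' y' z y' \<Longrightarrow> x = x'"
begin

lemma yang_baxter_fw:
  assumes X: "X x y y1 x1" "X x1 z z1 x2" "X y1 z1 z2 y2"
  shows "\<exists>c d x'. X y z c d \<and> X x c z2 x' \<and> X x' d y2 x2"
proof -
  obtain c d where 1: "X y z c d" using ex_out X(1,2)[THEN X_in] by blast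
  then obtain c' x' where 2: "X x c c' x'" using ex_out X_in X(1)[THEN X_in] by blast
  then obtain d' x'' where 3: "X x' d d' x''" using ex_out X_in 1[THEN X_in] by blast
  show ?thesis using yang_baxter[OF X 1 2 3] 1 2 3 by blast
qed

text \<open>The inputs \<open>x\<close>, \<open>y\<close>, \<open>z\<close> alone determine both
  sides of the Yang-Baxter equation, so the converse direction rebuilds the left side with
  \<open>ex_out\<close> and compares; nothing has to be solved backwards.\<close>

lemma yang_baxter_bw:
  assumes X: "X y z c d" "X x c z2 x'" "X x' d y2 x2"
  shows "\<exists>x1 y1 z1. X x y y1 x1 \<and> X x1 z z1 x2 \<and> X y1 z1 z2 y2"
proof -
  obtain x1 y1 where 1: "X x y y1 x1" using ex_out X(1,2)[THEN X_in] by blast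
  then obtain z1 x2' where 2: "X x1 z z1 x2'" using ex_out X_in X(1)[THEN X_in] by blast
  then obtain z2' y2' where 3: "X y1 z1 z2' y2'" using ex_out X_in 1[THEN X_in] by blast
  show ?thesis using yang_baxter[OF 1 2 3 X] 1 2 3 by blast
qed

section \<open>Kinks and their passage through crossings\<close>

definition kink :: "'q \<Rightarrow> 'q"
  where "kink x = (THE z. \<exists>y. X x y z y)"

lemma kink_eqI: "X x y z y \<Longrightarrow> kink x = z"
  unfolding kink_def using kink_un by blast

lemma kink_loop: "x \<in> A \<Longrightarrow> \<exists>y. X x y (kink x) y"
  using kink_ex kink_eqI by metis

lemma kink_in: "x \<in> A \<Longrightarrow> kink x \<in> A"
  using kink_loop X_in by blast

lemma kink_inj: "x \<in> A \<Longrightarrow> x' \<in> A \<Longrightarrow> kink x = kink x' \<Longrightarrow> x = x'"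
  using kink_loop kink_un' by metis

text \<open>Yang-Baxter for \<open>x\<close>, \<open>y\<close> and the loop of the kink on \<open>y\<close>: the strand \<open>x\<close> passes over the whole kink.\<close>

lemma kink_under:
  assumes "X x y z w"
  shows "X x (kink y) (kink z) w"
proof -
  obtain b where b: "X y b (kink y) b" using kink_loop assms X_in by blast
  obtain c' x' where c: "X x (kink y) c' x'" using ex_out assms X_in kink_in by metis
  obtain d' x'' where d: "X x' b d' x''" using ex_out b c X_in by metis
  obtain z1 x2 where z1: "X w b z1 x2" using ex_out assms b X_in by metis
  obtain z2 y2 where z2: "X z z1 z2 y2" using ex_out assms z1 X_in by metis
  have e: "c' = z2 \<and> d' = y2 \<and> x'' = x2" by (rule yang_baxter[OF assms z1 z2 b c d])
  \<comment> \<open>Both crossings have under-input \<open>b\<close> and over-output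
    \<open>x2\<close>, so they coincide. This closes the loop on \<open>z\<close>: its crossing
    becomes \<open>X z z1 z2 z1\<close>.\<close>
  then have "w = x'" "z1 = y2" using un_side'[OF z1, of x' y2] d by auto
  then show ?thesis using z2 kink_eqI c e by metis
qed

text \<open>The kink on \<open>x\<close> is pulled over a third strand. The input \<open>y0\<close>
  of that strand is chosen by solving sideways so that it carries \<open>y\<close> after passing
  under the loop \<open>b\<close>; Yang-Baxter for \<open>x\<close>, \<open>b\<close>,
  \<open>y0\<close> then produces a loop labeled \<open>b'\<close> on \<open>w\<close>.\<close>

lemma kink_over:
  assumes "X x y z w"
  shows "X (kink x) y z (kink w)"
proof -
  obtain b where b: "X x b (kink x) b" using kink_loop assms X_in by blast
  obtain y0 b' where y0: "X b y0 y b'" using ex_side b assms X_in by metis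
  obtain z2 y2 where z2: "X (kink x) y z2 y2" using ex_out b assms X_in by metis
  obtain d' x'' where d: "X w b' d' x''" using ex_out assms y0 X_in by metis
  have "z = z2 \<and> d' = y2 \<and> x'' = b'" by (rule yang_baxter[OF b y0 z2 y0 assms d])
  then show ?thesis using z2 kink_eqI d by metis
qed

text \<open>Comparing the twisted crossing with the over-under kink on \<open>x\<close> avoids the Whitney trick.\<close>

lemma kink_under_over:
  assumes "X x y x w"
  shows "w = kink y"
proof -
  obtain b where "X x b (kink x) b" using kink_loop assms X_in by blast
  then show ?thesis using un_side kink_under[OF assms] by metis
qed

text \<open>The witness is forced: by \<open>kink_under\<close>, any \<open>x\<close> with
  \<open>X x y x w\<close> satisfies \<open>X x (kink y) (kink x) w\<close>, so
  \<open>kink y\<close> has to be the loop label of the over-under kink on \<open>x\<close>. Solving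
  this crossing sideways gives \<open>x\<close>, and injectivity of \<open>kink\<close> brings the
  under-output back to \<open>x\<close>.\<close>

lemma kink_under_over_ex:
  assumes "y \<in> A"
  shows "\<exists>x. X x y x (kink y)"
proof -
  obtain x z where x: "X x (kink y) z (kink y)" using ex_side' kink_in assms by metis
  obtain c d where c: "X x y c d" using ex_out assms x X_in by metis
  have "kink c = z \<and> d = kink y" using un_out[OF kink_under[OF c] x] .
  moreover have "kink x = z" using x by (rule kink_eqI)
  ultimately show ?thesis using c kink_inj X_in by metis
qed

section \<open>Signed crossings and the triangle of the third move\<close>

definition cross :: "int \<Rightarrow> 'q \<Rightarrow> 'q \<Rightarrow> 'q \<Rightarrow> 'q \<Rightarrow> bool"
  where "cross e io iu oo ou = (if e = 1 then X io iu ou oo else X oo ou iu io)"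

text \<open>The flags say whether the known end of the over-strand, respectively the under-strand,
  is the incoming one. The four choices are the four uniqueness axioms; a negative sign exchanges
  \<open>un_out\<close> with \<open>un_in\<close> and \<open>un_side\<close> with
  \<open>un_side'\<close>.\<close>

lemma cross_unique:
  assumes "cross e (if b then p0 else p1) (if c then q0 else q1) (if b then p1 else p2) (if c then q1 else q2)"
    and "cross e (if b then p0 else p1') (if c then q0 else q1') (if b then p1' else p2) (if c then q1' else q2)"
  shows "p1 = p1' \<and> q1 = q1'"
  using assms
  apply (cases "e = 1"; cases b; cases c; simp add: cross_def)
  subgoal using un_out by blast
  subgoal using un_side by blast
  subgoal using un_side' by blast
  subgoal using un_in by blast
  subgoal using un_in by blast
  subgoal using un_side' by blast
  subgoal using un_side by blast
  subgoal using un_out by blast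
  done

text \<open>
  The nine labels of a triangle formed by a top, a middle and a bottom strand: \<open>T0, T1, T2\<close>, \<open>M0, M1, M2\<close> and
  \<open>L0, L1, L2\<close> are met along the strands. The flags say whether top meets middle before bottom,
  middle meets top before bottom, and bottom meets top before middle.
\<close>

definition triangle ::
    "bool \<Rightarrow> bool \<Rightarrow> bool \<Rightarrow> int \<Rightarrow> int \<Rightarrow> int \<Rightarrow> 'q \<Rightarrow> 'q \<Rightarrow> 'q \<Rightarrow> 'q \<Rightarrow> 'q \<Rightarrow> 'q \<Rightarrow> 'q \<Rightarrow> 'q \<Rightarrow> 'q \<Rightarrow> bool"
  where "triangle bt bm bl e f g T0 T1 T2 M0 M1 M2 L0 L1 L2 \<longleftrightarrow>
    cross e (if bt then T0 else T1) (if bm then M0 else M1) (if bt then T1 else T2) (if bm then M1 else M2) \<and>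
    cross f (if \<not> bt then T0 else T1) (if bl then L0 else L1) (if \<not> bt then T1 else T2) (if bl then L1 else L2) \<and>
    cross g (if \<not> bm then M0 else M1) (if \<not> bl then L0 else L1) (if \<not> bm then M1 else M2) (if \<not> bl then L1 else L2)"

text \<open>At each crossing of the triangle each strand has one outer end and one inner end, so the
  outer labels fix the inner ones. The two crossings on the top strand already involve all three
  inner labels.\<close>

lemma triangle_unique:
  assumes "triangle bt bm bl e f g T0 T1 T2 M0 M1 M2 L0 L1 L2"
    and "triangle bt bm bl e f g T0 T1' T2 M0 M1' M2 L0 L1' L2"
  shows "T1 = T1' \<and> M1 = M1' \<and> L1 = L1'"
proof -
  note c = assms[unfolded triangle_def]
  show ?thesis
    using cross_unique[OF c(1)[THEN conjunct1] c(2)[THEN conjunct1]]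
      cross_unique[OF c(1)[THEN conjunct2, THEN conjunct1] c(2)[THEN conjunct2, THEN conjunct1]] by blast
qed

text \<open>
  The third move for the other orientations: solve for two crossings of the new triangle, then
  apply Yang-Baxter to these and one crossing of the old triangle.
\<close>

lemma yang_baxter_variant1:
  assumes X: "X T1 M0 M1 T2" "X T0 L0 L1 T1" "X M2 L2 L1 M1"
  shows "\<exists>T1' M1' L1'. X T0 M1' M2 T1' \<and> X T1' L1' L2 T2 \<and> X M1' L1' L0 M0"
proof -
  obtain M1' T1' where 1: "X T0 M1' M2 T1'" using ex_side X(2,3)[THEN X_in] by blast
  then obtain L1' T2' where 2: "X T1' L1' L2 T2'" using ex_side X(3)[THEN X_in] X_in by blast
  obtain c d x where *: "X M1' L1' c d" "X T0 c L1 x" "X x d M1 T2'"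
    using yang_baxter_fw[OF 1 2 X(3)] by blast
  have "c = L0" "x = T1" using un_side[OF *(2) X(2)] by auto
  moreover have "d = M0 \<and> T2' = T2" using un_side *(3) X(1) \<open>x = T1\<close> by blast
  ultimately show ?thesis using 1 2 * by blast
qed

text \<open>Here two crossings of the old triangle already fit together, so a single crossing of the
  new triangle completes the Yang-Baxter triple. The same happens in variants 4, 5 and 6, whereas 1
  and 3 solve for two new crossings.\<close>

lemma yang_baxter_variant2:
  assumes X: "X T0 M1 M2 T1" "X T1 L1 L2 T2" "X M1 L1 L0 M0"
  shows "\<exists>T1' M1' L1'. X T1' M0 M1' T2 \<and> X T0 L0 L1' T1' \<and> X M2 L2 L1' M1'"
proof -
  obtain L1' M1' where 1: "X M2 L2 L1' M1'" using ex_out X(1,2)[THEN X_in] by blast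
  obtain c d x where *: "X M1 L1 c d" "X T0 c L1' x" "X x d M1' T2"
    using yang_baxter_fw[OF X(1,2) 1] by blast
  have "c = L0" "d = M0" using un_out[OF *(1) X(3)] by auto
  then show ?thesis using 1 * by blast
qed

lemma yang_baxter_variant3:
  assumes X: "X T1 M0 M1 T2" "X T1 L2 L1 T0" "X M1 L0 L1 M2"
  shows "\<exists>T1' M1' L1'. X T0 M1' M2 T1' \<and> X T2 L1' L0 T1' \<and> X M0 L1' L2 M1'"
proof -
  obtain L1' M1' where 1: "X M0 L1' L2 M1'" using ex_side X(1,2)[THEN X_in] by blast
  then obtain M2' T1' where 2: "X T0 M1' M2' T1'" using ex_out X(2)[THEN X_in] X_in by blast
  obtain x y z where *: "X T1 M0 y x" "X x L1' z T1'" "X y z L1 M2'"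
    using yang_baxter_bw[OF 1 X(2) 2] by blast
  have "y = M1" "x = T2" using un_out[OF *(1) X(1)] by auto
  moreover have "z = L0 \<and> M2' = M2" using un_side *(3) X(3) \<open>y = M1\<close> by blast
  ultimately show ?thesis using 1 2 * by blast
qed

lemma yang_baxter_variant4:
  assumes X: "X T0 M1 M2 T1" "X T2 L1 L0 T1" "X M0 L1 L2 M1"
  shows "\<exists>T1' M1' L1'. X T1' M0 M1' T2 \<and> X T1' L2 L1' T0 \<and> X M1' L0 L1' M2"
proof -
  obtain T1' L1' where 1: "X T1' L2 L1' T0" using ex_side' X(1,3)[THEN X_in] by blast
  obtain x y z where *: "X T1' M0 y x" "X x L1 z T1" "X y z L1' M2"
    using yang_baxter_bw[OF X(3) 1 X(1)] by blast
  have "x = T2" "z = L0" using un_side'[OF *(2) X(2)] by auto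
  then show ?thesis using 1 * by blast
qed

lemma yang_baxter_variant5:
  assumes X: "X T0 M0 M1 T1" "X T2 L2 L1 T1" "X M2 L1 L0 M1"
  shows "\<exists>T1' M1' L1'. X T1' M1' M2 T2 \<and> X T1' L1' L0 T0 \<and> X M1' L2 L1' M0"
proof -
  obtain T1' M1' where 1: "X T1' M1' M2 T2" using ex_in X(2,3)[THEN X_in] by blast
  obtain c d x where *: "X M1' L2 c d" "X T1' c L0 x" "X x d M1 T1"
    using yang_baxter_fw[OF 1 X(2,3)] by blast
  have "x = T0" "d = M0" using un_in[OF *(3) X(1)] by auto
  then show ?thesis using 1 * by blast
qed

lemma yang_baxter_variant6:
  assumes X: "X T1 M1 M2 T2" "X T1 L1 L0 T0" "X M1 L2 L1 M0"
  shows "\<exists>T1' M1' L1'. X T0 M0 M1' T1' \<and> X T2 L2 L1' T1' \<and> X M2 L1' L0 M1'"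
proof -
  obtain M1' T1' where 1: "X T0 M0 M1' T1'" using ex_out X(2,3)[THEN X_in] by blast
  obtain x y z where *: "X T1 M1 y x" "X x L2 z T1'" "X y z L0 M1'"
    using yang_baxter_bw[OF X(3,2) 1] by blast
  have "y = M2" "x = T2" using un_out[OF *(1) X(1)] by auto
  then show ?thesis using 1 * by blast
qed

text \<open>Negating \<open>e\<close>, \<open>f\<close>, \<open>g\<close> and exchanging the two
  outer ends of every strand leaves the relations unchanged, so the sixteen sign patterns reduce to
  eight statements. Within these, the sign of \<open>\<delta>\<close> selects one direction of the
  move.\<close>

lemma triangle_move:
  assumes "e = 1 \<or> e = -1" "f = 1 \<or> f = -1" "g = 1 \<or> g = -1" "\<delta> = 1 \<or> \<delta> = -1"
    and "triangle (\<delta> * e * f * g = 1) (\<delta> * e = 1) (\<delta> * f = 1) e f g T0 T1 T2 M0 M1 M2 L0 L1 L2"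
  shows "\<exists>T1 M1 L1. triangle (- \<delta> * e * f * g = 1) (- \<delta> * e = 1) (- \<delta> * f = 1) e f g T0 T1 T2 M0 M1 M2 L0 L1 L2"
proof -
  note defs = triangle_def cross_def
  show ?thesis
    using assms
    apply (elim disjE; hypsubst)
    subgoal by (simp add: defs, elim conjE, drule (2) yang_baxter_fw, blast)
    subgoal by (simp add: defs, elim conjE, drule (2) yang_baxter_bw, blast)
    subgoal by (simp add: defs, elim conjE, drule (2) yang_baxter_variant1, blast)
    subgoal by (simp add: defs, elim conjE, drule (2) yang_baxter_variant2, blast)
    subgoal by (simp add: defs, elim conjE, drule (2) yang_baxter_variant3, blast)
    subgoal by (simp add: defs, elim conjE, drule (2) yang_baxter_variant4, blast)
    subgoal by (simp add: defs, elim conjE, drule (2) yang_baxter_variant5, blast)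
    subgoal by (simp add: defs, elim conjE, drule (2) yang_baxter_variant6, blast)
    subgoal by (simp add: defs, elim conjE, drule (2) yang_baxter_variant5, blast)
    subgoal by (simp add: defs, elim conjE, drule (2) yang_baxter_variant6, blast)
    subgoal by (simp add: defs, elim conjE, drule (2) yang_baxter_variant3, blast)
    subgoal by (simp add: defs, elim conjE, drule (2) yang_baxter_variant4, blast)
    subgoal by (simp add: defs, elim conjE, drule (2) yang_baxter_variant1, blast)
    subgoal by (simp add: defs, elim conjE, drule (2) yang_baxter_variant2, blast)
    subgoal by (simp add: defs, elim conjE, drule (2) yang_baxter_fw, blast)
    subgoal by (simp add: defs, elim conjE, drule (2) yang_baxter_bw, blast)
    done
qed

end

section \<open>Twisted labelings of Gauss codes\<close>

text \<open>Labels sit at the two ends of each passage and not at semiarcs numbered by position, so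
  a move leaves the names of all distant labels unchanged. \<open>Base k\<close> also carries the
  label of a component without crossings.\<close>

datatype point = Base nat | In passage | Out passage

definition passages :: "gauss_code \<Rightarrow> passage set"
  where "passages D = set (concat D)"

lemma nth_passages: "k < length D \<Longrightarrow> m \<in> set (D ! k) \<Longrightarrow> m \<in> passages D"
  using nth_mem[of k D] by (auto simp: passages_def)

definition points :: "gauss_code \<Rightarrow> point set"
  where "points D = Base ` {..<length D} \<union> In ` passages D \<union> Out ` passages D"

lemma restrict_eqD: "restrict f S = restrict g S \<Longrightarrow> x \<in> S \<Longrightarrow> f x = g x"
  by (metis restrict_apply')

lemma points_simps [simp]:
  "Base k \<in> points D \<longleftrightarrow> k < length D"
  "In m \<in> points D \<longleftrightarrow> m \<in> passages D"
  "Out m \<in> points D \<longleftrightarrow> m \<in> passages D"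
  by (auto simp: points_def)

text \<open>The labels before and after the word are separate arguments: on a whole component they
  differ by the twist, and a word can be cut at any place where a move happens.\<close>

primrec chain :: "(point \<Rightarrow> 'q) \<Rightarrow> 'q \<Rightarrow> passage list \<Rightarrow> 'q \<Rightarrow> bool"
  where "chain u a [] b \<longleftrightarrow> a = b"
  | "chain u a (m # ms) b \<longleftrightarrow> u (In m) = a \<and> chain u (u (Out m)) ms b"

lemma chain_append: "chain u a (v @ w) b \<longleftrightarrow> (\<exists>c. chain u a v c \<and> chain u c w b)"
  by (induction v arbitrary: a) auto

lemma chain_cong:
  "(\<And>m. m \<in> set w \<Longrightarrow> u (In m) = v (In m) \<and> u (Out m) = v (Out m)) \<Longrightarrow> chain u a w b = chain v a w b"
  by (induction w arbitrary: a) auto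

lemma chain_map2: "chain u a w b \<Longrightarrow> chain v a' w b' \<Longrightarrow> chain (\<lambda>x. h (u x) (v x)) (h a a') w (h b b')"
  by (induction w arbitrary: a a') auto

lemma chain_unique: "chain u a w b \<Longrightarrow> chain u a w b' \<Longrightarrow> b = b'"
  by (induction w arbitrary: a) auto

lemma gauss_diagram_partner:
  assumes "gauss_diagram D" "(l, c, e) \<in> passages D"
  shows "(l', c, e) \<in> passages D" "e = 1 \<or> e = -1"
proof -
  show "(l', c, e) \<in> passages D"
    using assms unfolding gauss_diagram_def passages_def by (cases l; cases l') blast+
  show "e = 1 \<or> e = -1" using assms unfolding gauss_diagram_def passages_def by auto
qed

text \<open>
  The family \<open>H\<close> consists of the fibrewise operations (addition, multiplication by scalars and
  the projection \<open>zz\<close> to the zero section); they are only applied to elements of the same fibre of \<open>zz\<close>.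
\<close>

locale fibred_birack = birack_rel A X for A :: "'q set" and X +
  fixes N :: nat and zz :: "'q \<Rightarrow> 'q" and H :: "('q \<Rightarrow> 'q \<Rightarrow> 'q) set"
  assumes N_pos: "0 < N"
    and kink_period: "x \<in> A \<Longrightarrow> (kink ^^ N) x = x"
    and zz_H: "(\<lambda>x y. zz x) \<in> H"
    and H_X: "h \<in> H \<Longrightarrow> X x y z w \<Longrightarrow> X x' y' z' w' \<Longrightarrow> zz x = zz x' \<Longrightarrow> zz y = zz y' \<Longrightarrow>
      zz z = zz z' \<Longrightarrow> zz w = zz w' \<Longrightarrow> X (h x x') (h y y') (h z z') (h w w')"
begin

text \<open>Reducing modulo \<open>N\<close> expresses negative twists as nonnegative powers, so
  statements about \<open>kink\<close> carry over by induction on the exponent.\<close>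

definition twist :: "int \<Rightarrow> 'q \<Rightarrow> 'q"
  where "twist n = kink ^^ nat (n mod int N)"

lemma funpow_kink_in: "x \<in> A \<Longrightarrow> (kink ^^ n) x \<in> A"
  by (induction n) (auto simp: kink_in)

lemma twist_in [simp]: "x \<in> A \<Longrightarrow> twist n x \<in> A"
  by (simp add: twist_def funpow_kink_in)

lemma twist_0 [simp]: "twist 0 x = x"
  by (simp add: twist_def)

lemma twist_cong: "[m = n] (mod int N) \<Longrightarrow> twist m = twist n"
  by (simp add: twist_def cong_def)

lemma twist_nat: "x \<in> A \<Longrightarrow> twist (int n) x = (kink ^^ n) x"
  using funpow_mod_eq[OF kink_period, of x n] by (simp add: twist_def flip: zmod_int)

lemma twist_add: "x \<in> A \<Longrightarrow> twist m (twist n x) = twist (m + n) x"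
proof -
  assume x: "x \<in> A"
  define a b where "a = nat (m mod int N)" and "b = nat (n mod int N)"
  have m: "twist m = twist (int a)" "twist n = twist (int b)"
    using N_pos by (auto intro!: twist_cong simp: cong_def a_def b_def)
  have "[m + n = int (a + b)] (mod int N)"
    using N_pos by (simp add: a_def b_def cong_def mod_simps)
  then have "twist (m + n) = twist (int (a + b))" by (rule twist_cong)
  then show ?thesis using x m by (simp only: twist_nat twist_in funpow_kink_in funpow_add o_def)
qed

lemma twist_cancel [simp]: "x \<in> A \<Longrightarrow> twist (- n) (twist n x) = x" "x \<in> A \<Longrightarrow> twist n (twist (- n) x) = x"
  by (simp_all add: twist_add)

lemma twist_inj: "x \<in> A \<Longrightarrow> y \<in> A \<Longrightarrow> twist n x = twist n y \<Longrightarrow> x = y"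
  using twist_cancel(1) by metis

lemma twist_1: "x \<in> A \<Longrightarrow> twist 1 x = kink x"
  using twist_nat[of x 1] by simp

lemma X_twist_over: "X x y z w \<Longrightarrow> X (twist n x) y z (twist n w)"
proof -
  have "X x y z w \<Longrightarrow> X ((kink ^^ k) x) y z ((kink ^^ k) w)" for k
    by (induction k) (auto intro: kink_over)
  then show "X x y z w \<Longrightarrow> X (twist n x) y z (twist n w)" by (simp add: twist_def)
qed

lemma X_twist_under: "X x y z w \<Longrightarrow> X x (twist n y) (twist n z) w"
proof -
  have "X x y z w \<Longrightarrow> X x ((kink ^^ k) y) ((kink ^^ k) z) w" for k
    by (induction k) (auto intro: kink_under)
  then show "X x y z w \<Longrightarrow> X x (twist n y) (twist n z) w" by (simp add: twist_def)
qed

lemma cross_in: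
  "cross e io iu oo ou \<Longrightarrow> io \<in> A \<and> iu \<in> A \<and> oo \<in> A \<and> ou \<in> A"
  by (auto simp: cross_def split: if_splits dest: X_in)

lemma cross_twist:
  assumes "cross e io iu oo ou"
  shows "cross e (twist n io) iu (twist n oo) ou" "cross e io (twist n iu) oo (twist n ou)"
  using assms X_twist_over X_twist_under unfolding cross_def by (simp_all split: if_splits)

lemma zz_X: "X x y z w \<Longrightarrow> X (zz x) (zz y) (zz z) (zz w)"
  using H_X[OF zz_H, of x y z w x y z w] by simp

text \<open>Closure under \<open>h\<close> is hidden in \<open>H_X\<close>: crossing
  \<open>x\<close> with itself and \<open>y\<close> with itself gives two crossings over the same
  base crossing, and \<open>h\<close> combines them into a crossing, whose ends lie in
  \<open>A\<close> by \<open>X_in\<close>.\<close>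

lemma H_in: "h \<in> H \<Longrightarrow> x \<in> A \<Longrightarrow> y \<in> A \<Longrightarrow> zz x = zz y \<Longrightarrow> h x y \<in> A"
proof -
  assume h: "h \<in> H" "x \<in> A" "y \<in> A" "zz x = zz y"
  obtain z w z' w' where X: "X x x z w" "X y y z' w'" using ex_out h by metis
  then have "zz z = zz z' \<and> zz w = zz w'" using zz_X[OF X(1)] zz_X[OF X(2)] un_out h(4) by metis
  then show ?thesis using H_X[OF h(1) X] h(4) X_in by blast
qed

lemma zz_kink: "x \<in> A \<Longrightarrow> kink (zz x) = zz (kink x)"
  using kink_loop zz_X kink_eqI by metis

lemma H_kink:
  assumes h: "h \<in> H" "x \<in> A" "y \<in> A" "zz x = zz y"
  shows "kink (h x y) = h (kink x) (kink y)"
proof -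
  obtain a b where X: "X x a (kink x) a" "X y b (kink y) b" using kink_loop h by metis
  have k: "zz (kink x) = zz (kink y)" using h by (metis zz_kink)
  \<comment> \<open>The loop label of a kink is determined by its entering and leaving labels, and
    these agree after projection.\<close>
  have "zz a = zz b" using un_side zz_X[OF X(1)] zz_X[OF X(2)] h k by metis
  then show ?thesis using H_X[OF h(1) X] h k by (intro kink_eqI) auto
qed

lemma H_twist:
  assumes h: "h \<in> H" "x \<in> A" "y \<in> A" "zz x = zz y"
  shows "twist n (h x y) = h (twist n x) (twist n y)"
proof -
  have "zz ((kink ^^ k) x) = zz ((kink ^^ k) y)" for k
    by (induction k) (simp_all add: zz_kink[symmetric] h funpow_kink_in)
  then have "(kink ^^ k) (h x y) = h ((kink ^^ k) x) ((kink ^^ k) y)" for k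
    by (induction k) (simp_all add: H_kink h funpow_kink_in)
  then show ?thesis by (simp add: twist_def)
qed

lemma cross_H:
  "h \<in> H \<Longrightarrow> cross e io iu oo ou \<Longrightarrow> cross e io' iu' oo' ou' \<Longrightarrow> zz io = zz io' \<Longrightarrow> zz iu = zz iu' \<Longrightarrow>
    zz oo = zz oo' \<Longrightarrow> zz ou = zz ou' \<Longrightarrow> cross e (h io io') (h iu iu') (h oo oo') (h ou ou')"
  using H_X unfolding cross_def by (simp split: if_splits)

section \<open>Twisted colorings of a Gauss code\<close>

abbreviation cross_at :: "(point \<Rightarrow> 'q) \<Rightarrow> nat \<Rightarrow> int \<Rightarrow> bool"
  where "cross_at u c e \<equiv>
    cross e (u (In (Over, c, e))) (u (In (Under, c, e))) (u (Out (Over, c, e))) (u (Out (Under, c, e)))"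

definition crossed :: "(point \<Rightarrow> 'q) \<Rightarrow> passage set \<Rightarrow> bool"
  where "crossed u S \<longleftrightarrow> (\<forall>c e. (Over, c, e) \<in> S \<longrightarrow>
    cross_at u c e)"

text \<open>
  A component \<open>k\<close> closes up only after \<open>n k\<close> further kinks, which are thought to sit at its base point.
\<close>

definition closed_up :: "(point \<Rightarrow> 'q) \<Rightarrow> gauss_code \<Rightarrow> (nat \<Rightarrow> int) \<Rightarrow> bool"
  where "closed_up u D n \<longleftrightarrow>
    (\<forall>k<length D. chain u (u (Base k)) (D ! k) (twist (n k) (u (Base k))))"

definition labels :: "gauss_code \<Rightarrow> (nat \<Rightarrow> int) \<Rightarrow> (point \<Rightarrow> 'q) set"
  where "labels D n = {u. (\<forall>x\<in>points D. u x \<in> A) \<and> crossed u (passages D) \<and> closed_up u D n}"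

lemma labels_in: "u \<in> labels D n \<Longrightarrow> x \<in> points D \<Longrightarrow> u x \<in> A"
  by (simp add: labels_def)

lemma labels_cong:
  assumes "gauss_diagram D" "\<And>x. x \<in> points D \<Longrightarrow> u x = v x"
  shows "u \<in> labels D n \<longleftrightarrow> v \<in> labels D n"
proof -
  have "u (In (l, c, e)) = v (In (l, c, e)) \<and> u (Out (l, c, e)) = v (Out (l, c, e))"
    if "(Over, c, e) \<in> passages D" for l c e
    using assms(2) gauss_diagram_partner(1)[OF assms(1) that, of l] by simp
  then have "crossed u (passages D) \<longleftrightarrow> crossed v (passages D)"
    unfolding crossed_def by (intro all_cong1 imp_cong refl) simp
  moreover have "closed_up u D n \<longleftrightarrow> closed_up v D n"
  proof -
    have "chain u a (D ! k) b = chain v a (D ! k) b" if "k < length D" for a k b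
      using assms(2) nth_passages[OF that] by (intro chain_cong) auto
    then show ?thesis using assms(2) unfolding closed_up_def by auto
  qed
  ultimately show ?thesis using assms(2) by (auto simp: labels_def)
qed

lemma labels_restrict:
  "gauss_diagram D \<Longrightarrow> restrict u (points D) \<in> labels D n \<longleftrightarrow> u \<in> labels D n"
  by (rule labels_cong) auto

lemma labels_H:
  assumes "gauss_diagram D" "u \<in> labels D n" "v \<in> labels D n" "h \<in> H"
    and zz: "\<And>x. x \<in> points D \<Longrightarrow> zz (u x) = zz (v x)"
  shows "(\<lambda>x. h (u x) (v x)) \<in> labels D n"
proof -
  have "closed_up (\<lambda>x. h (u x) (v x)) D n"
    unfolding closed_up_def
  proof (intro allI impI)
    fix k assume k: "k < length D"
    have "chain u (u (Base k)) (D ! k) (twist (n k) (u (Base k)))"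
      "chain v (v (Base k)) (D ! k) (twist (n k) (v (Base k)))"
      using assms(2,3) k by (simp_all add: labels_def closed_up_def)
    from chain_map2[OF this, of h]
    show "chain (\<lambda>x. h (u x) (v x)) (h (u (Base k)) (v (Base k))) (D ! k) (twist (n k) (h (u (Base k)) (v (Base k))))"
      using labels_in[OF assms(2)] labels_in[OF assms(3)] k zz[of "Base k"] \<open>h \<in> H\<close> by (simp add: H_twist)
  qed
  moreover have "crossed (\<lambda>x. h (u x) (v x)) (passages D)"
    unfolding crossed_def
  proof (intro allI impI)
    fix c e assume "(Over, c, e) \<in> passages D"
    then have p: "(l, c, e) \<in> passages D" for l using gauss_diagram_partner assms(1) by blast
    have "cross_at u c e"
      "cross_at v c e"
      using assms(2,3) p unfolding labels_def crossed_def by blast+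
    then show "cross e (h (u (In (Over, c, e))) (v (In (Over, c, e)))) (h (u (In (Under, c, e))) (v (In (Under, c, e))))
      (h (u (Out (Over, c, e))) (v (Out (Over, c, e)))) (h (u (Out (Under, c, e))) (v (Out (Under, c, e))))"
      by (rule cross_H[OF \<open>h \<in> H\<close>]) (simp_all add: zz p)
  qed
  ultimately show ?thesis using assms by (auto simp: labels_def H_in)
qed

lemma labels_zz: "gauss_diagram D \<Longrightarrow> u \<in> labels D n \<Longrightarrow> (\<lambda>x. zz (u x)) \<in> labels D n"
  using labels_H[OF _ _ _ zz_H] by blast

text \<open>\<open>labels\<close> leaves the values off the diagram free, which suits local updates
  across a move; bijections need the normalised functions, in which a coloring is represented
  once.\<close>

definition ext_labels :: "gauss_code \<Rightarrow> (nat \<Rightarrow> int) \<Rightarrow> (point \<Rightarrow> 'q) set"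
  where "ext_labels D n = labels D n \<inter> extensional (points D)"

lemma ext_labels_eqI:
  "u \<in> ext_labels D n \<Longrightarrow> v \<in> ext_labels D n \<Longrightarrow> (\<And>x. x \<in> points D \<Longrightarrow> u x = v x) \<Longrightarrow> u = v"
  unfolding ext_labels_def by (auto intro: extensionalityI)

section \<open>Sets of colorings with fibrewise operations, over points or over semiarcs\<close>

definition fibred_set :: "'i set \<Rightarrow> ('i \<Rightarrow> 'q) set \<Rightarrow> bool"
  where "fibred_set I S \<longleftrightarrow> S \<subseteq> extensional I \<and>
    (\<forall>h\<in>H. \<forall>u\<in>S. \<forall>v\<in>S. (\<forall>x\<in>I. zz (u x) = zz (v x)) \<longrightarrow> (\<lambda>x\<in>I. h (u x) (v x)) \<in> S)"

lemma fibred_set_eqI: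
  "fibred_set I S \<Longrightarrow> u \<in> S \<Longrightarrow> v \<in> S \<Longrightarrow> (\<And>x. x \<in> I \<Longrightarrow> u x = v x) \<Longrightarrow> u = v"
  unfolding fibred_set_def by (blast intro: extensionalityI)

lemma fibred_set_H:
  "fibred_set I S \<Longrightarrow> h \<in> H \<Longrightarrow> u \<in> S \<Longrightarrow> v \<in> S \<Longrightarrow> \<forall>x\<in>I. zz (u x) = zz (v x) \<Longrightarrow>
    (\<lambda>x\<in>I. h (u x) (v x)) \<in> S"
  unfolding fibred_set_def by blast

lemma fibred_set_zz: "fibred_set I S \<Longrightarrow> u \<in> S \<Longrightarrow> (\<lambda>x\<in>I. zz (u x)) \<in> S"
  using fibred_set_H[OF _ zz_H] by blast

lemma fibred_set_ext_labels: "gauss_diagram D \<Longrightarrow> fibred_set (points D) (ext_labels D n)"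
  by (simp add: fibred_set_def ext_labels_def labels_restrict labels_H)

text \<open>One equation, for all \<open>h\<close>, expresses at once additivity, linearity and,
  through the projection, that colorings with the same labels go to colorings with the same
  labels.\<close>

definition equivariant_bij :: "'i set \<Rightarrow> ('i \<Rightarrow> 'q) set \<Rightarrow> 'j set \<Rightarrow> ('j \<Rightarrow> 'q) set \<Rightarrow> (('i \<Rightarrow> 'q) \<Rightarrow> 'j \<Rightarrow> 'q) \<Rightarrow> bool"
  where "equivariant_bij I S J T \<Phi> \<longleftrightarrow> bij_betw \<Phi> S T \<and>
    (\<forall>h\<in>H. \<forall>u\<in>S. \<forall>v\<in>S. (\<forall>x\<in>I. zz (u x) = zz (v x)) \<longrightarrow>
      (\<forall>x\<in>J. \<Phi> (\<lambda>x\<in>I. h (u x) (v x)) x = h (\<Phi> u x) (\<Phi> v x)))"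

lemma equivariant_bijD:
  assumes S: "fibred_set I S" and T: "fibred_set J T" and \<Phi>: "equivariant_bij I S J T \<Phi>"
  shows "bij_betw \<Phi> S T"
    and "u \<in> S \<Longrightarrow> \<Phi> u \<in> T"
    and "u \<in> S \<Longrightarrow> \<Phi> (\<lambda>x\<in>I. zz (u x)) = (\<lambda>x\<in>J. zz (\<Phi> u x))"
    and "u \<in> S \<Longrightarrow> v \<in> S \<Longrightarrow> \<forall>x\<in>I. zz (u x) = zz (v x) \<Longrightarrow> \<forall>x\<in>J. zz (\<Phi> u x) = zz (\<Phi> v x)"
    and "h \<in> H \<Longrightarrow> u \<in> S \<Longrightarrow> v \<in> S \<Longrightarrow> \<forall>x\<in>I. zz (u x) = zz (v x) \<Longrightarrow>
      \<Phi> (\<lambda>x\<in>I. h (u x) (v x)) = (\<lambda>x\<in>J. h (\<Phi> u x) (\<Phi> v x))"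
proof -
  show b: "bij_betw \<Phi> S T" using \<Phi> by (simp add: equivariant_bij_def)
  show in_T: "\<Phi> u \<in> T" if "u \<in> S" for u using bij_betwE[OF b] that by blast
  show z: "\<Phi> (\<lambda>x\<in>I. zz (u x)) = (\<lambda>x\<in>J. zz (\<Phi> u x))" if "u \<in> S" for u
  proof (rule fibred_set_eqI[OF T])
    fix x assume "x \<in> J"
    then have "\<Phi> (\<lambda>x\<in>I. zz (u x)) x = zz (\<Phi> u x)"
      using \<Phi>[unfolded equivariant_bij_def, THEN conjunct2, rule_format, OF zz_H that that] by simp
    then show "\<Phi> (\<lambda>x\<in>I. zz (u x)) x = (\<lambda>x\<in>J. zz (\<Phi> u x)) x" using \<open>x \<in> J\<close> by simp
  qed (intro in_T fibred_set_zz[OF S] fibred_set_zz[OF T] that)+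
  show e: "\<forall>x\<in>J. zz (\<Phi> u x) = zz (\<Phi> v x)" if u: "u \<in> S" "v \<in> S" "\<forall>x\<in>I. zz (u x) = zz (v x)" for u v
  proof -
    have "(\<lambda>x\<in>I. zz (u x)) = (\<lambda>x\<in>I. zz (v x))" using u(3) by (intro restrict_ext) auto
    then have eq: "(\<lambda>x\<in>J. zz (\<Phi> u x)) = (\<lambda>x\<in>J. zz (\<Phi> v x))"
      using z[OF u(1)] z[OF u(2)] by simp
    show ?thesis by (intro ballI) (rule restrict_eqD[OF eq])
  qed
  show "\<Phi> (\<lambda>x\<in>I. h (u x) (v x)) = (\<lambda>x\<in>J. h (\<Phi> u x) (\<Phi> v x))"
    if u: "h \<in> H" "u \<in> S" "v \<in> S" "\<forall>x\<in>I. zz (u x) = zz (v x)"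
  proof (rule fibred_set_eqI[OF T])
    fix x assume "x \<in> J"
    then show "\<Phi> (\<lambda>x\<in>I. h (u x) (v x)) x = (\<lambda>x\<in>J. h (\<Phi> u x) (\<Phi> v x)) x"
      using \<Phi> u by (simp add: equivariant_bij_def)
  qed (intro in_T fibred_set_H[OF S] fibred_set_H[OF T] e u)+
qed

lemma equivariant_bijI:
  assumes "bij_betw \<Phi> S T"
    and "\<And>h u v x. h \<in> H \<Longrightarrow> u \<in> S \<Longrightarrow> v \<in> S \<Longrightarrow> \<forall>x\<in>I. zz (u x) = zz (v x) \<Longrightarrow> x \<in> J \<Longrightarrow>
      \<Phi> (\<lambda>x\<in>I. h (u x) (v x)) x = h (\<Phi> u x) (\<Phi> v x)"
  shows "equivariant_bij I S J T \<Phi>"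
  unfolding equivariant_bij_def using assms by blast

text \<open>The equation for a general \<open>h\<close> is available only for two colorings in the
  same fibre. Hence the projection is treated before the rest: it shows that the inverse map
  preserves fibres.\<close>

lemma equivariant_bij_inv:
  assumes S: "fibred_set I S" and T: "fibred_set J T" and \<Phi>: "equivariant_bij I S J T \<Phi>"
  shows "equivariant_bij J T I S (inv_into S \<Phi>)"
proof -
  note D = equivariant_bijD[OF S T \<Phi>]
  define \<Psi> where "\<Psi> = inv_into S \<Phi>"
  have b: "bij_betw \<Psi> T S" unfolding \<Psi>_def by (rule bij_betw_inv_into[OF D(1)])
  have \<Psi>: "\<Psi> u \<in> S" "\<Phi> (\<Psi> u) = u" if "u \<in> T" for u
    using bij_betwE[OF b] bij_betw_inv_into_right[OF D(1)] that unfolding \<Psi>_def by auto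
  have \<Psi>_eq: "\<Psi> v = u" if "u \<in> S" "\<Phi> u = v" for u v
    using bij_betw_inv_into_left[OF D(1)] that unfolding \<Psi>_def by auto
  have z: "\<Psi> (\<lambda>x\<in>J. zz (u x)) = (\<lambda>x\<in>I. zz (\<Psi> u x))" if "u \<in> T" for u
    by (rule \<Psi>_eq) (simp_all add: fibred_set_zz[OF S] D(3) \<Psi> that)
  have "\<Psi> (\<lambda>x\<in>J. h (u x) (v x)) = (\<lambda>x\<in>I. h (\<Psi> u x) (\<Psi> v x))"
    if "h \<in> H" and u: "u \<in> T" "v \<in> T" and e: "\<forall>x\<in>J. zz (u x) = zz (v x)" for h u v
  proof -
    have "(\<lambda>x\<in>J. zz (u x)) = (\<lambda>x\<in>J. zz (v x))" using e by (intro restrict_ext) auto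
    then have eq: "(\<lambda>x\<in>I. zz (\<Psi> u x)) = (\<lambda>x\<in>I. zz (\<Psi> v x))"
      using z[OF u(1)] z[OF u(2)] by simp
    have e': "\<forall>x\<in>I. zz (\<Psi> u x) = zz (\<Psi> v x)" by (intro ballI) (rule restrict_eqD[OF eq])
    show ?thesis
    proof (rule \<Psi>_eq)
      show "(\<lambda>x\<in>I. h (\<Psi> u x) (\<Psi> v x)) \<in> S" by (intro fibred_set_H[OF S] \<open>h \<in> H\<close> \<Psi> u e')
      show "\<Phi> (\<lambda>x\<in>I. h (\<Psi> u x) (\<Psi> v x)) = (\<lambda>x\<in>J. h (u x) (v x))"
        using D(5)[OF \<open>h \<in> H\<close> \<Psi>(1)[OF u(1)] \<Psi>(1)[OF u(2)] e'] \<Psi>(2) u by simp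
    qed
  qed
  then show ?thesis unfolding \<Psi>_def[symmetric] using b by (intro equivariant_bijI) simp_all
qed

lemma equivariant_bij_comp:
  assumes S: "fibred_set I S" and T: "fibred_set J T"
    and \<Phi>: "equivariant_bij I S J T \<Phi>" and \<Psi>: "equivariant_bij J T L U \<Psi>"
  shows "equivariant_bij I S L U (\<Psi> \<circ> \<Phi>)"
proof (rule equivariant_bijI)
  note D = equivariant_bijD[OF S T \<Phi>]
  have b: "bij_betw \<Psi> T U"
    and H: "\<And>h u v x. h \<in> H \<Longrightarrow> u \<in> T \<Longrightarrow> v \<in> T \<Longrightarrow> \<forall>x\<in>J. zz (u x) = zz (v x) \<Longrightarrow> x \<in> L \<Longrightarrow>
      \<Psi> (\<lambda>x\<in>J. h (u x) (v x)) x = h (\<Psi> u x) (\<Psi> v x)"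
    using \<Psi> unfolding equivariant_bij_def by blast+
  show "bij_betw (\<Psi> \<circ> \<Phi>) S U" using D(1) b by (rule bij_betw_trans)
  show "(\<Psi> \<circ> \<Phi>) (\<lambda>x\<in>I. h (u x) (v x)) x = h ((\<Psi> \<circ> \<Phi>) u x) ((\<Psi> \<circ> \<Phi>) v x)"
    if "h \<in> H" "u \<in> S" "v \<in> S" "\<forall>x\<in>I. zz (u x) = zz (v x)" "x \<in> L" for h u v x
    unfolding o_apply D(5)[OF that(1-4)]
    by (rule H[OF that(1) D(2)[OF that(2)] D(2)[OF that(3)] D(4)[OF that(2-4)] that(5)])
qed

definition similar :: "gauss_code \<Rightarrow> (nat \<Rightarrow> int) \<Rightarrow> gauss_code \<Rightarrow> (nat \<Rightarrow> int) \<Rightarrow> bool"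
  where "similar D n D' n' \<longleftrightarrow>
    (\<exists>\<Phi>. equivariant_bij (points D) (ext_labels D n) (points D') (ext_labels D' n') \<Phi>)"

lemma similar_refl: "similar D n D n"
  unfolding similar_def by (intro exI[of _ id] equivariant_bijI) auto

lemma similar_sym:
  "gauss_diagram D \<Longrightarrow> gauss_diagram D' \<Longrightarrow> similar D n D' n' \<Longrightarrow> similar D' n' D n"
  unfolding similar_def using equivariant_bij_inv fibred_set_ext_labels by metis

lemma similar_trans:
  "gauss_diagram D \<Longrightarrow> gauss_diagram D' \<Longrightarrow> gauss_diagram D'' \<Longrightarrow>
    similar D n D' n' \<Longrightarrow> similar D' n' D'' n'' \<Longrightarrow> similar D n D'' n''"
  unfolding similar_def using equivariant_bij_comp fibred_set_ext_labels by metis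

text \<open>
  Equating labels up to twists is compatible with all fibrewise operations, so a correspondence
  between labelings that is given in this way is equivariant as soon as it is bijective.
\<close>

definition matched :: "(point \<times> point \<times> int) set \<Rightarrow> (point \<Rightarrow> 'q) \<Rightarrow> (point \<Rightarrow> 'q) \<Rightarrow> bool"
  where "matched Z u u' \<longleftrightarrow> (\<forall>(x, y, m) \<in> Z. u' y = twist m (u x))"

text \<open>\<open>fw\<close> and \<open>bw\<close> make \<open>matched Z\<close> total on both
  sides, \<open>un\<close> and \<open>un'\<close> make it single-valued on the points, so it is the
  graph of a bijection. \<open>Z\<close> need not mention every point: omitted labels only have to
  be recoverable from the coloring conditions.\<close>

lemma similarI:
  assumes D: "gauss_diagram D" "gauss_diagram D'"
    and Z: "Z \<subseteq> points D \<times> points D' \<times> UNIV"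
    and fw: "\<And>u. u \<in> labels D n \<Longrightarrow> \<exists>u'\<in>labels D' n'. matched Z u u'"
    and bw: "\<And>u'. u' \<in> labels D' n' \<Longrightarrow> \<exists>u\<in>labels D n. matched Z u u'"
    and un: "\<And>u u' v' x. u \<in> labels D n \<Longrightarrow> u' \<in> labels D' n' \<Longrightarrow> v' \<in> labels D' n' \<Longrightarrow>
      matched Z u u' \<Longrightarrow> matched Z u v' \<Longrightarrow> x \<in> points D' \<Longrightarrow> u' x = v' x"
    and un': "\<And>u v u' x. u \<in> labels D n \<Longrightarrow> v \<in> labels D n \<Longrightarrow> u' \<in> labels D' n' \<Longrightarrow>
      matched Z u u' \<Longrightarrow> matched Z v u' \<Longrightarrow> x \<in> points D \<Longrightarrow> u x = v x"
  shows "similar D n D' n'"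
proof -
  have cong: "matched Z u u' \<longleftrightarrow> matched Z v v'"
    if "\<And>x. x \<in> points D \<Longrightarrow> u x = v x" "\<And>x. x \<in> points D' \<Longrightarrow> u' x = v' x" for u v u' v'
    using Z that unfolding matched_def by fastforce
  have ex: "\<exists>u'\<in>ext_labels D' n'. matched Z u u'" if "u \<in> labels D n" for u
  proof -
    obtain u' where u': "u' \<in> labels D' n'" "matched Z u u'" using fw \<open>u \<in> labels D n\<close> by blast
    then have "restrict u' (points D') \<in> ext_labels D' n'"
      using D by (simp add: ext_labels_def labels_restrict)
    moreover have "matched Z u (restrict u' (points D'))"
      using u'(2) cong[of u u "restrict u' (points D')" u'] by simp
    ultimately show ?thesis by blast
  qed
  define \<Phi> where "\<Phi> u = (SOME u'. u' \<in> ext_labels D' n' \<and> matched Z u u')" for u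
  have \<Phi>: "\<Phi> u \<in> ext_labels D' n'" "matched Z u (\<Phi> u)" if "u \<in> labels D n" for u
    using someI_ex[of "\<lambda>u'. u' \<in> ext_labels D' n' \<and> matched Z u u'"] ex[OF that] unfolding \<Phi>_def by auto
  have \<Phi>_eq: "\<Phi> u x = v x" if "u \<in> labels D n" "v \<in> labels D' n'" "matched Z u v" "x \<in> points D'" for u v x
    using un that \<Phi>[OF that(1)] unfolding ext_labels_def by blast
  have el: "u \<in> labels D n" if "u \<in> ext_labels D n" for u D n using that by (simp add: ext_labels_def)
  have 1: "bij_betw \<Phi> (ext_labels D n) (ext_labels D' n')"
  proof (rule bij_betw_imageI)
    show "inj_on \<Phi> (ext_labels D n)"
    proof (rule inj_onI)
      fix u v assume "u \<in> ext_labels D n" "v \<in> ext_labels D n" "\<Phi> u = \<Phi> v"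
      then show "u = v" using un'[of u v "\<Phi> u"] \<Phi>[of u] \<Phi>[of v] el by (auto intro!: ext_labels_eqI)
    qed
    show "\<Phi> ` ext_labels D n = ext_labels D' n'"
    proof safe
      fix u' assume u': "u' \<in> ext_labels D' n'"
      then obtain u where u: "u \<in> labels D n" "matched Z u u'" using bw el by blast
      let ?v = "restrict u (points D)"
      have v: "?v \<in> ext_labels D n" "matched Z ?v u'"
        using u D cong[of ?v u u' u'] by (simp_all add: ext_labels_def labels_restrict)
      then have "\<Phi> ?v = u'"
        using u' \<Phi>_eq[of ?v u'] \<Phi>[of ?v] el by (intro ext_labels_eqI) auto
      then show "u' \<in> \<Phi> ` ext_labels D n" using v by blast
    qed (use \<Phi> el in blast)
  qed
  have mH: "matched Z (\<lambda>x. h (u x) (v x)) (\<lambda>x. h (u' x) (v' x))"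
    if "h \<in> H" and u: "u \<in> labels D n" "v \<in> labels D n" and m: "matched Z u u'" "matched Z v v'"
      and e: "\<forall>x\<in>points D. zz (u x) = zz (v x)" for h u v u' v'
    unfolding matched_def
  proof clarify
    fix x y k assume xy: "(x, y, k) \<in> Z"
    then have "u' y = twist k (u x)" "v' y = twist k (v x)" using m unfolding matched_def by blast+
    moreover have "u x \<in> A" "v x \<in> A" "zz (u x) = zz (v x)" using xy Z e labels_in[OF u(1), of x] labels_in[OF u(2), of x] by blast+
    ultimately show "h (u' y) (v' y) = twist k (h (u x) (v x))" using \<open>h \<in> H\<close> by (simp add: H_twist)
  qed
  have mz: "matched Z (\<lambda>x. zz (u x)) (\<lambda>x. zz (u' x))" if "u \<in> labels D n" "matched Z u u'" for u u'
    using mH[OF zz_H that(1) that(1) that(2) that(2)] by simp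
  have 3: "\<Phi> (\<lambda>x\<in>points D. h (u x) (v x)) x = h (\<Phi> u x) (\<Phi> v x)"
    if "h \<in> H" "u \<in> ext_labels D n" "v \<in> ext_labels D n" and e: "\<forall>x\<in>points D. zz (u x) = zz (v x)" and "x \<in> points D'" for h u v x
  proof (rule \<Phi>_eq)
    have u: "u \<in> labels D n" "v \<in> labels D n" using that el by auto
    then have "(\<lambda>x. h (u x) (v x)) \<in> labels D n" using e by (intro labels_H[OF D(1) _ _ \<open>h \<in> H\<close>]) auto
    then show "(\<lambda>x\<in>points D. h (u x) (v x)) \<in> labels D n" using D by (simp add: labels_restrict)
    have \<Phi>': "\<Phi> u \<in> labels D' n'" "\<Phi> v \<in> labels D' n'" using u \<Phi>(1) el by auto
    \<comment> \<open>\<open>u\<close> and \<open>v\<close> have the same projection, so the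
      projections of \<open>\<Phi> u\<close> and \<open>\<Phi> v\<close> are matched with one and
      the same coloring. By \<open>un\<close> they agree, which puts \<open>\<Phi> u\<close> and
      \<open>\<Phi> v\<close> into a common fibre.\<close>
    have "matched Z (\<lambda>x. zz (u x)) (\<lambda>x. zz (\<Phi> v x))"
      using mz[OF u(2) \<Phi>(2)[OF u(2)]] cong[of "\<lambda>x. zz (v x)" "\<lambda>x. zz (u x)"] e by simp
    then have "zz (\<Phi> u x) = zz (\<Phi> v x)" if "x \<in> points D'" for x
      by (rule un[OF labels_zz[OF D(1) u(1)] labels_zz[OF D(2) \<Phi>'(1)] labels_zz[OF D(2) \<Phi>'(2)]
          mz[OF u(1) \<Phi>(2)[OF u(1)]] _ that])
    then show "(\<lambda>x. h (\<Phi> u x) (\<Phi> v x)) \<in> labels D' n'"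
      by (rule labels_H[OF D(2) \<Phi>' \<open>h \<in> H\<close>])
    have "matched Z (\<lambda>x. h (u x) (v x)) (\<lambda>x. h (\<Phi> u x) (\<Phi> v x))"
      by (rule mH[OF \<open>h \<in> H\<close> u \<Phi>(2)[OF u(1)] \<Phi>(2)[OF u(2)] e])
    then show "matched Z (\<lambda>x\<in>points D. h (u x) (v x)) (\<lambda>x. h (\<Phi> u x) (\<Phi> v x))"
      by (subst cong[of _ "\<lambda>x. h (u x) (v x)" _ "\<lambda>x. h (\<Phi> u x) (\<Phi> v x)"]) auto
  qed fact
  show ?thesis unfolding similar_def using 1 3 by (intro exI[of _ \<Phi>] equivariant_bijI)
qed

end

section \<open>Renaming and base points\<close>

lemma distinct_concat_nth:
  assumes "distinct (concat D)" "k < length D"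
  shows "distinct (D ! k)" "j < length D \<Longrightarrow> j \<noteq> k \<Longrightarrow> set (D ! j) \<inter> set (D ! k) = {}"
proof -
  show "distinct (D ! k)" using assms
    by (induction D arbitrary: k) (auto simp: nth_Cons split: nat.split)
  show "set (D ! j) \<inter> set (D ! k) = {}" if "j < length D" "j \<noteq> k"
    using assms that
  proof (induction D arbitrary: j k)
    case (Cons w D)
    have "set (D ! i) \<subseteq> \<Union> (set ` set D)" if "i < length D" for i using that nth_mem by blast
    then show ?case using Cons by (cases j; cases k) (auto, blast+)
  qed simp
qed

lemma gauss_diagram_distinct: "gauss_diagram D \<Longrightarrow> distinct (concat D)"
  unfolding gauss_diagram_def distinct_map by blast

lemma gauss_diagram_cong: "mset (concat D) = mset (concat D') \<Longrightarrow> gauss_diagram D \<longleftrightarrow> gauss_diagram D'"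
proof -
  assume m: "mset (concat D) = mset (concat D')"
  then have "distinct (map f (concat D)) = distinct (map f (concat D'))" for f :: "passage \<Rightarrow> level \<times> nat"
    by (metis mset_eq_imp_distinct_iff mset_map)
  then show ?thesis unfolding gauss_diagram_def using mset_eq_setD[OF m] by simp
qed

lemma mset_concat_update:
  assumes "k < length D" "mset w = mset (D ! k)"
  shows "mset (concat (D[k := w])) = mset (concat D)"
proof -
  have "map mset (D[k := w]) = map mset D" using assms by (simp add: map_update list_update_same_conv)
  then show ?thesis unfolding mset_concat by simp
qed

lemma passages_mset: "mset (concat D) = mset (concat D') \<Longrightarrow> passages D = passages D'"
  unfolding passages_def by (rule mset_eq_setD)

primrec map_point :: "(passage \<Rightarrow> passage) \<Rightarrow> point \<Rightarrow> point"
  where "map_point f (Base k) = Base k"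
  | "map_point f (In m) = In (f m)"
  | "map_point f (Out m) = Out (f m)"

lemma chain_map_passage: "chain u a (map f w) b \<longleftrightarrow> chain (u \<circ> map_point f) a w b"
  by (induction w arbitrary: a) auto

lemma passages_map: "passages (map (map f) D) = f ` passages D"
  unfolding passages_def by (simp flip: map_concat)

lemma points_map: "points (map (map f) D) = map_point f ` points D"
  unfolding points_def passages_map image_Un image_image by simp

context fibred_birack
begin

lemma closed_up_nth:
  "closed_up u D n \<Longrightarrow> k < length D \<Longrightarrow> chain u (u (Base k)) (D ! k) (twist (n k) (u (Base k)))"
  by (simp add: closed_up_def)

lemma labels_twist_cong:
  "(\<And>k. k < length D \<Longrightarrow> [n k = n' k] (mod int N)) \<Longrightarrow> labels D n = labels D n'"
  using twist_cong unfolding labels_def closed_up_def by (metis (no_types, lifting))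

lemma similar_twist_cong:
  "(\<And>k. k < length D \<Longrightarrow> [n k = n' k] (mod int N)) \<Longrightarrow> similar D n D n'"
  using similar_refl[of D n] labels_twist_cong[of D n n'] unfolding similar_def ext_labels_def by simp

lemma similar_rename:
  assumes D: "gauss_diagram D" "gauss_diagram D'" and h: "inj h"
    and D': "D' = map (map (\<lambda>(l, c, e). (l, h c, e))) D"
  shows "similar D n D' n"
proof -
  define f g :: "passage \<Rightarrow> passage"
    where "f = (\<lambda>(l, c, e). (l, h c, e))" and "g = (\<lambda>(l, c, e). (l, inv_into UNIV h c, e))"
  have gf: "g (f m) = m" for m using h by (cases m) (simp add: f_def g_def)
  then have gf': "map_point g (map_point f x) = x" for x by (cases x) auto
  have D': "D' = map (map f) D" using D' by (simp add: f_def)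
  have cl: "closed_up u D' n \<longleftrightarrow> closed_up (u \<circ> map_point f) D n" for u
    by (simp add: closed_up_def D' chain_map_passage)
  have cr: "crossed u (passages D') \<longleftrightarrow> crossed (u \<circ> map_point f) (passages D)" for u
  proof -
    have "(Over, c, e) \<in> passages D' \<longleftrightarrow> (\<exists>c'. c = h c' \<and> (Over, c', e) \<in> passages D)" for c e
      by (force simp: D' passages_map f_def)
    then show ?thesis unfolding crossed_def by (simp add: f_def) blast
  qed
  have lab: "u \<in> labels D' n \<longleftrightarrow> u \<circ> map_point f \<in> labels D n" for u
    by (simp add: labels_def cl cr) (simp add: D' points_map)
  show ?thesis
  proof (rule similarI[OF D, where Z = "(\<lambda>x. (x, map_point f x, 0)) ` points D"], goal_cases)
    case (2 u)
    have "u \<circ> map_point g \<in> labels D' n" using 2 by (simp add: lab comp_def gf')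
    then show ?case by (rule bexI[rotated]) (simp add: matched_def gf')
  next
    case (3 u')
    then show ?case by (intro bexI[of _ "u' \<circ> map_point f"]) (simp_all add: lab matched_def)
  qed (auto simp: D' points_map matched_def)
qed

text \<open>Only base points are indexed by components, so a permutation of the components moves
  their labels and twists and leaves the labels at all passages in place.\<close>

lemma similar_permute:
  assumes D: "gauss_diagram D" and p: "p permutes {..<length D}"
  shows "similar D n (permute_list p D) (n \<circ> p)"
proof -
  define D' where "D' = permute_list p D"
  define p' where "p' = inv_into UNIV p"
  define \<rho> where "\<rho> p x = (case x of Base k \<Rightarrow> Base (p k) | In m \<Rightarrow> In m | Out m \<Rightarrow> Out m)" for p x
  have m: "mset (concat D') = mset (concat D)"
    unfolding D'_def mset_concat using p by (simp flip: sum_mset_sum_list)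
  have D'g: "gauss_diagram D'" using D gauss_diagram_cong[OF m] by simp
  have len: "length D' = length D" and nth: "k < length D \<Longrightarrow> D' ! k = D ! p k" for k
    using p by (simp_all add: D'_def permute_list_nth)
  have inv: "p' (p k) = k" "p (p' k) = k" for k using permutes_inverses[OF p] by (auto simp: p'_def)
  have \<rho>i: "\<rho> p (\<rho> p' x) = x" "\<rho> p' (\<rho> p x) = x" for x
    by (cases x; simp add: \<rho>_def inv)+
  have pk: "p k < length D \<longleftrightarrow> k < length D" for k using permutes_in_image[OF p, of k] by simp
  have pts: "\<rho> p x \<in> points D \<longleftrightarrow> x \<in> points D'" for x
    using passages_mset[OF m] by (cases x) (auto simp: \<rho>_def pk len)
  have lab: "u \<circ> \<rho> p \<in> labels D' (n \<circ> p)" if u: "u \<in> labels D n" for u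
  proof -
    have "closed_up (u \<circ> \<rho> p) D' (n \<circ> p)"
      unfolding closed_up_def
    proof (intro allI impI)
      fix k assume "k < length D'"
      then have k: "k < length D" "p k < length D" using len pk by auto
      have "chain u (u (Base (p k))) (D ! p k) (twist (n (p k)) (u (Base (p k))))"
        using u k by (simp add: labels_def closed_up_def)
      moreover have "chain (u \<circ> \<rho> p) a w b = chain u a w b" for a w b
        by (rule chain_cong) (simp add: \<rho>_def)
      ultimately show "chain (u \<circ> \<rho> p) ((u \<circ> \<rho> p) (Base k)) (D' ! k) (twist ((n \<circ> p) k) ((u \<circ> \<rho> p) (Base k)))"
        using k by (simp add: nth \<rho>_def)
    qed
    moreover have "crossed (u \<circ> \<rho> p) (passages D')"
      using u by (simp add: labels_def crossed_def passages_mset[OF m] \<rho>_def)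
    ultimately show ?thesis using u by (simp add: labels_def pts)
  qed
  have lab': "u' \<circ> \<rho> p' \<in> labels D n" if u': "u' \<in> labels D' (n \<circ> p)" for u'
  proof -
    have "closed_up (u' \<circ> \<rho> p') D n"
      unfolding closed_up_def
    proof (intro allI impI)
      fix k assume k: "k < length D"
      define j where "j = p' k"
      have j: "p j = k" "j < length D'" using k pk[of j] by (simp_all add: j_def inv len)
      have "chain u' (u' (Base j)) (D' ! j) (twist (n (p j)) (u' (Base j)))"
        using u' j(2) by (simp add: labels_def closed_up_def)
      moreover have "chain (u' \<circ> \<rho> p') a w b = chain u' a w b" for a w b
        by (rule chain_cong) (simp add: \<rho>_def)
      ultimately show "chain (u' \<circ> \<rho> p') ((u' \<circ> \<rho> p') (Base k)) (D ! k) (twist (n k) ((u' \<circ> \<rho> p') (Base k)))"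
        using j nth[of j] len by (simp add: \<rho>_def flip: j_def)
    qed
    moreover have "crossed (u' \<circ> \<rho> p') (passages D)"
      using u' by (simp add: labels_def crossed_def passages_mset[OF m] \<rho>_def)
    moreover have "\<rho> p' x \<in> points D'" if "x \<in> points D" for x
      using pts[of "\<rho> p' x"] that by (simp add: \<rho>i)
    ultimately show ?thesis using u' by (simp add: labels_def)
  qed
  have "similar D n D' (n \<circ> p)"
  proof (rule similarI[OF D D'g, where Z = "(\<lambda>x. (\<rho> p x, x, 0)) ` points D'"], goal_cases)
    case (2 u)
    then show ?case by (intro bexI[OF _ lab]) (auto simp: matched_def)
  next
    case (3 u')
    then show ?case by (intro bexI[OF _ lab']) (auto simp: matched_def \<rho>i)
  next
    case (5 u v u' x)
    have "\<rho> p' x \<in> points D'" using pts[of "\<rho> p' x"] 5 by (simp add: \<rho>i)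
    then have "u' (\<rho> p' x) = u (\<rho> p (\<rho> p' x))" "u' (\<rho> p' x) = v (\<rho> p (\<rho> p' x))"
      using 5 unfolding matched_def by auto
    then show ?case by (simp add: \<rho>i)
  qed (auto simp: pts matched_def)
  then show ?thesis by (simp add: D'_def)
qed

text \<open>A twist applied to both ends of one passage slides along that strand through the
  crossing, whichever level the passage has.\<close>

lemma crossed_twist:
  assumes "crossed u S"
    and "u' (In m) = twist j (u (In m))" "u' (Out m) = twist j (u (Out m))"
    and o: "\<And>m'. m' \<noteq> m \<Longrightarrow> u' (In m') = u (In m') \<and> u' (Out m') = u (Out m')"
  shows "crossed u' S"
  unfolding crossed_def
proof (intro allI impI)
  fix c e assume "(Over, c, e) \<in> S"
  then have *: "cross_at u c e"
    using assms(1) by (simp add: crossed_def)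
  consider "m = (Over, c, e)" | "m = (Under, c, e)" | "m \<noteq> (Over, c, e)" "m \<noteq> (Under, c, e)" by blast
  then show "cross_at u' c e"
  proof cases
    case 1
    then show ?thesis using cross_twist(1)[OF *, of j] assms(2,3) o[of "(Under, c, e)"] by simp
  next
    case 2
    then show ?thesis using cross_twist(2)[OF *, of j] assms(2,3) o[of "(Over, c, e)"] by simp
  next
    case 3
    then show ?thesis using * o[of "(Over, c, e)"] o[of "(Under, c, e)"] by simp
  qed
qed

text \<open>
  Moving the base point across a passage twists the labels at that passage.
\<close>

lemma similar_rotate_one:
  assumes D: "gauss_diagram D" and k: "k < length D" and w: "D ! k = m # w"
  shows "similar D n (D[k := w @ [m]]) n"
proof -
  define D' where "D' = D[k := w @ [m]]"
  have m: "mset (concat D') = mset (concat D)" unfolding D'_def using k w by (intro mset_concat_update) auto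
  have D'g: "gauss_diagram D'" using D gauss_diagram_cong[OF m] by simp
  have pas: "passages D' = passages D" using passages_mset[OF m] .
  have len: "length D' = length D" by (simp add: D'_def)
  have pts: "points D' = points D" unfolding points_def pas len ..
  have nth: "j < length D \<Longrightarrow> D' ! j = (if j = k then w @ [m] else D ! j)" for j using k by (simp add: D'_def)
  have mp: "m \<in> passages D" using nth_passages[OF k, of m] w by simp
  have mw: "m \<notin> set w" using distinct_concat_nth(1)[OF gauss_diagram_distinct[OF D] k] w by simp
  have mj: "m \<notin> set (D ! j)" if "j < length D" "j \<noteq> k" for j
    using distinct_concat_nth(2)[OF gauss_diagram_distinct[OF D] k that] w by auto
  \<comment> \<open>After the rotation \<open>m\<close> is read at the end of the lap instead of the
    beginning, hence past the twist: both its ends are twisted by \<open>n k\<close>, and the new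
    base label is the old label just after \<open>m\<close>.\<close>
  let ?tw = "twist (n k)"
  let ?tv = "twist (- n k)"
  have lab: "u' \<in> labels D' n" if u: "u \<in> labels D n"
    and u': "u' = u(Base k := u (Out m), In m := ?tw (u (In m)), Out m := ?tw (u (Out m)))" for u u'
  proof -
    have uA: "u x \<in> A" if "x \<in> points D" for x using labels_in[OF u that] .
    have cong: "chain u' a v b = chain u a v b" if "m \<notin> set v" for v a b
      using that u' by (intro chain_cong) auto
    have "chain u' (u' (Base j)) (D' ! j) (twist (n j) (u' (Base j)))" if j: "j < length D" for j
    proof -
      have c: "chain u (u (Base j)) (D ! j) (twist (n j) (u (Base j)))"
        using u j by (simp add: labels_def closed_up_def)
      show ?thesis
      proof (cases "j = k")
        case True
        then have "chain u (u (Out m)) w (?tw (u (In m)))" using c w by simp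
        then show ?thesis using True cong[OF mw] j u' by (simp add: nth chain_append)
      qed (use c j mj cong u' in \<open>simp add: nth\<close>)
    qed
    then have "closed_up u' D' n" by (simp add: closed_up_def len)
    moreover have "crossed u' (passages D')"
      using u unfolding pas by (intro crossed_twist[of u _ u' m "n k"]) (simp_all add: labels_def u')
    ultimately show ?thesis using uA mp by (simp add: labels_def pts u')
  qed
  have lab': "u \<in> labels D n" if u': "u' \<in> labels D' n"
    and u: "u = u'(Base k := ?tv (u' (In m)), In m := ?tv (u' (In m)), Out m := ?tv (u' (Out m)))" for u u'
  proof -
    have uA: "u' x \<in> A" if "x \<in> points D" for x using labels_in[OF u'] that pts by simp
    have cong: "chain u' a v b = chain u a v b" if "m \<notin> set v" for v a b
      using that u by (intro chain_cong) auto
    have "chain u (u (Base j)) (D ! j) (twist (n j) (u (Base j)))" if j: "j < length D" for j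
    proof -
      have c: "chain u' (u' (Base j)) (D' ! j) (twist (n j) (u' (Base j)))"
        using u' j by (simp add: labels_def closed_up_def len)
      show ?thesis
      proof (cases "j = k")
        case True
        then have "chain u' (u' (Base k)) w (u' (In m))" "u' (Out m) = ?tw (u' (Base k))"
          using c j by (auto simp: nth chain_append)
        then show ?thesis using True cong[OF mw] u w uA k mp by simp
      qed (use c j mj cong u in \<open>simp add: nth\<close>)
    qed
    then have "closed_up u D n" by (simp add: closed_up_def)
    moreover have "crossed u (passages D)"
      using u' unfolding pas[symmetric] by (intro crossed_twist[of u' _ u m "- n k"]) (simp_all add: labels_def u)
    ultimately show ?thesis using uA mp by (simp add: labels_def u)
  qed
  have end_m: "u' (Out m) = ?tw (u' (Base k))" if "u' \<in> labels D' n" for u'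
    using that k by (auto simp: labels_def closed_up_def len nth chain_append)
  have start_m: "u (Base k) = u (In m)" if "u \<in> labels D n" for u
    using that k w by (auto simp: labels_def closed_up_def)
  let ?Z = "{(Out m, Base k, 0), (In m, In m, n k), (Out m, Out m, n k)} \<union>
    (\<lambda>x. (x, x, 0)) ` (points D - {Base k, In m, Out m})"
  have "similar D n D' n"
  proof (rule similarI[OF D D'g, where Z = ?Z], goal_cases)
    case 1
    show ?case using k mp by (auto simp: pts)
  next
    case (2 u)
    show ?case by (rule bexI[OF _ lab[OF 2 refl]]) (auto simp: matched_def)
  next
    case (3 u')
    have "u' (In m) \<in> A" "u' (Out m) \<in> A" "u' (Base k) \<in> A" using labels_in[OF 3] mp k by (auto simp: pts)
    then show ?case using end_m[OF 3] by (intro bexI[OF _ lab'[OF 3 refl]]) (auto simp: matched_def)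
  next
    case (4 u u' v' x)
    then show ?case by (cases "x \<in> {Base k, In m, Out m}") (auto simp: matched_def pts)
  next
    case (5 u v u' x)
    have "u (In m) \<in> A" "v (In m) \<in> A" "u (Out m) \<in> A" "v (Out m) \<in> A" using 5(1,2)[THEN labels_in] mp by auto
    moreover have "?tw (u (In m)) = ?tw (v (In m))" "u (Out m) = v (Out m)" using 5 by (auto simp: matched_def)
    ultimately have "u (In m) = v (In m)" "u (Out m) = v (Out m)" using twist_inj by blast+
    moreover have "u x = v x" if "x \<notin> {Base k, In m, Out m}" using 5 that by (simp add: matched_def)
    ultimately show ?case using start_m[OF 5(1)] start_m[OF 5(2)] by (cases "x \<in> {Base k, In m, Out m}") auto
  qed
  then show ?thesis by (simp add: D'_def)
qed

lemma similar_rotate: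
  assumes "gauss_diagram D" "k < length D" "D ! k = v @ w"
  shows "similar D n (D[k := w @ v]) n"
  using assms
proof (induction v arbitrary: D w)
  case Nil
  then show ?case using list_update_id[of D k] similar_refl by simp
next
  case (Cons m v)
  define E where "E = D[k := (v @ w) @ [m]]"
  have E: "similar D n E n" unfolding E_def by (rule similar_rotate_one) (use Cons in auto)
  have g: "gauss_diagram E"
    using Cons.prems gauss_diagram_cong[OF mset_concat_update[of k D "(v @ w) @ [m]"]] by (simp add: E_def)
  have g': "gauss_diagram (D[k := w @ m # v])"
    using Cons.prems gauss_diagram_cong[OF mset_concat_update[of k D "w @ m # v"]] by simp
  have "similar E n (E[k := (w @ [m]) @ v]) n"
    by (rule Cons.IH) (use Cons.prems g in \<open>auto simp: E_def\<close>)
  then have "similar E n (D[k := w @ m # v]) n" by (simp add: E_def)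
  then show ?case using similar_trans[OF Cons.prems(1) g g' E] by simp
qed

end

section \<open>The Reidemeister moves\<close>

lemma has_blockE:
  assumes "has_block D xs"
  obtains k v w where "k < length D" "D ! k = v @ xs @ w"
  using assms unfolding has_block_def sublist_def by (metis in_set_conv_nth)

lemma has_block_passages: "has_block D ms \<Longrightarrow> m \<in> set ms \<Longrightarrow> m \<in> passages D"
  by (elim has_blockE) (auto intro!: nth_passages)

text \<open>Unlike \<open>delete_crossings\<close> this can remove one of the two passages of a
  crossing, so the strands of the second move can be handled one after the other.\<close>

definition remove :: "passage set \<Rightarrow> gauss_code \<Rightarrow> gauss_code"
  where "remove S D = map (filter (\<lambda>m. m \<notin> S)) D"

lemma remove_simps [simp]:
  "length (remove S D) = length D"
  "k < length D \<Longrightarrow> remove S D ! k = filter (\<lambda>m. m \<notin> S) (D ! k)"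
  "remove S (remove T D) = remove (T \<union> S) D"
  by (simp_all add: remove_def)

lemma passages_remove [simp]: "passages (remove S D) = passages D - S"
  by (auto simp: passages_def remove_def)

lemma distinct_remove: "distinct (concat D) \<Longrightarrow> distinct (concat (remove S D))"
  unfolding remove_def by (simp flip: filter_concat)

lemma has_block_remove:
  assumes "has_block D xs" "set xs \<inter> S = {}"
  shows "has_block (remove S D) xs"
proof -
  obtain k v w where k: "k < length D" "D ! k = v @ xs @ w" using assms(1) by (rule has_blockE)
  have "filter (\<lambda>m. m \<notin> S) xs = xs" using assms(2) by (intro filter_True) auto
  then have "remove S D ! k = filter (\<lambda>m. m \<notin> S) v @ xs @ filter (\<lambda>m. m \<notin> S) w" using k by simp
  moreover have "remove S D ! k \<in> set (remove S D)" using k by (intro nth_mem) simp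
  ultimately show ?thesis unfolding has_block_def sublist_def by metis
qed

lemma block_distinct:
  assumes "distinct (concat D)" "k < length D" "D ! k = v @ [a, b] @ w"
  shows "a \<noteq> b" "a \<notin> set v" "a \<notin> set w" "b \<notin> set v" "b \<notin> set w"
    "j < length D \<Longrightarrow> j \<noteq> k \<Longrightarrow> a \<notin> set (D ! j)"
    "j < length D \<Longrightarrow> j \<noteq> k \<Longrightarrow> b \<notin> set (D ! j)"
  using distinct_concat_nth(1)[OF assms(1,2)] distinct_concat_nth(2)[OF assms(1,2), of j] assms(3) by auto

lemma chain_end_in:
  "chain u a w b \<Longrightarrow> a \<in> S \<Longrightarrow> (\<And>m. m \<in> set w \<Longrightarrow> u (Out m) \<in> S) \<Longrightarrow> b \<in> S"
  by (induction w arbitrary: a) auto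

section \<open>Inserting and removing two consecutive passages\<close>

context fibred_birack
begin

text \<open>The strand leaves the block with the label it entered with, so the block can be bypassed
  without disturbing the chain.\<close>

lemma closed_up_remove:
  assumes D: "distinct (concat D)" and b: "has_block D [a, b]"
    and u: "closed_up u D n" "u (In a) = u (Out b)"
  shows "closed_up u (remove {a, b} D) n"
  unfolding closed_up_def
proof (intro allI impI)
  fix j assume j: "j < length (remove {a, b} D)"
  then have c: "chain u (u (Base j)) (D ! j) (twist (n j) (u (Base j)))"
    using u(1) by (simp add: closed_up_def)
  obtain k v w where k: "k < length D" "D ! k = v @ [a, b] @ w" using b by (rule has_blockE)
  note bd = block_distinct[OF D k]
  show "chain u (u (Base j)) (remove {a, b} D ! j) (twist (n j) (u (Base j)))"
  proof (cases "j = k")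
    case True
    have "filter (\<lambda>m. m \<notin> {a, b}) v = v" "filter (\<lambda>m. m \<notin> {a, b}) w = w"
      using bd by (auto intro!: filter_True)
    then have "remove {a, b} D ! j = v @ w" using k True by simp
    then show ?thesis using c True k u(2) by (auto simp: chain_append)
  next
    case False
    have "filter (\<lambda>m. m \<notin> {a, b}) (D ! j) = D ! j"
      using bd(6,7)[of j] j False by (auto intro!: filter_True)
    then show ?thesis using c j by simp
  qed
qed

text \<open>\<open>x\<close> is the running label at the place where the block is inserted. The
  label between \<open>a\<close> and \<open>b\<close> is provisionally \<open>x\<close> as well;
  \<open>closed_up_middle\<close> replaces it once the crossings are solved.\<close>

lemma closed_up_insert:
  assumes D: "distinct (concat D)" and b: "has_block D [a, b]"
    and u: "closed_up u (remove {a, b} D) n" "\<And>x. x \<in> points (remove {a, b} D) \<Longrightarrow> u x \<in> A"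
  shows "\<exists>x\<in>A. \<exists>v. closed_up v D n \<and> v = u(In a := x, Out a := x, In b := x, Out b := x)"
proof -
  obtain k v w where k: "k < length D" "D ! k = v @ [a, b] @ w" using b by (rule has_blockE)
  note bd = block_distinct[OF D k]
  have "filter (\<lambda>m. m \<notin> {a, b}) v = v" "filter (\<lambda>m. m \<notin> {a, b}) w = w"
    using bd by (auto intro!: filter_True)
  then have rk: "remove {a, b} D ! k = v @ w" using k by simp
  have "chain u (u (Base k)) (remove {a, b} D ! k) (twist (n k) (u (Base k)))"
    by (rule closed_up_nth[OF u(1)]) (use k in simp)
  then obtain x where x: "chain u (u (Base k)) v x" "chain u x w (twist (n k) (u (Base k)))"
    unfolding rk by (auto simp: chain_append)
  have "m \<in> passages (remove {a, b} D)" if "m \<in> set v" for m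
    using nth_passages[of k "remove {a, b} D" m] that k(1) rk by simp
  \<comment> \<open>The running label is either the base label or the label after the last passage
    of \<open>v\<close>, and these points remain when the block is removed.\<close>
  then have "x \<in> A" using k(1) by (intro chain_end_in[OF x(1)] u(2)) (simp_all)
  define u' where "u' = u(In a := x, Out a := x, In b := x, Out b := x)"
  have cong: "chain u' c ms d = chain u c ms d" if "a \<notin> set ms" "b \<notin> set ms" for c ms d
    using that by (intro chain_cong) (auto simp: u'_def)
  have "closed_up u' D n"
    unfolding closed_up_def
  proof (intro allI impI)
    fix j assume j: "j < length D"
    show "chain u' (u' (Base j)) (D ! j) (twist (n j) (u' (Base j)))"
    proof (cases "j = k")
      case True
      have ba: "u' (Base k) = u (Base k)" "u' (In a) = x" "u' (Out a) = x" "u' (In b) = x" "u' (Out b) = x"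
        by (simp_all add: u'_def)
      show ?thesis using x bd True k by (auto simp: chain_append cong ba)
    next
      case False
      have "filter (\<lambda>m. m \<notin> {a, b}) (D ! j) = D ! j"
        using bd(6,7)[of j] j False by (auto intro!: filter_True)
      then have "chain u (u (Base j)) (D ! j) (twist (n j) (u (Base j)))"
        using closed_up_nth[OF u(1), of j] j by simp
      then show ?thesis using cong bd(6,7)[of j] j False by (simp add: u'_def)
    qed
  qed
  then show ?thesis using \<open>x \<in> A\<close> u'_def by blast
qed

text \<open>The arc between the two passages is met only there, so as far as closing up is concerned
  its label is free.\<close>

lemma closed_up_middle:
  assumes D: "distinct (concat D)" and b: "has_block D [a, b]" and u: "closed_up u D n"
  shows "closed_up (u(Out a := y, In b := y)) D n"
  unfolding closed_up_def
proof (intro allI impI)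
  fix j assume j: "j < length D"
  obtain k v w where k: "k < length D" "D ! k = v @ [a, b] @ w" using b by (rule has_blockE)
  note bd = block_distinct[OF D k]
  let ?u = "u(Out a := y, In b := y)"
  have cong: "chain ?u c ms d = chain u c ms d" if "a \<notin> set ms" "b \<notin> set ms" for c ms d
    using that by (intro chain_cong) auto
  show "chain ?u (?u (Base j)) (D ! j) (twist (n j) (?u (Base j)))"
  proof (cases "j = k")
    case True
    then show ?thesis using closed_up_nth[OF u j] bd(1) k by (auto simp: chain_append cong[OF bd(2,4)] cong[OF bd(3,5)])
  next
    case False
    then show ?thesis using closed_up_nth[OF u j] cong[of "D ! j"] bd(6,7)[of j] j by simp
  qed
qed

lemma block_middle:
  assumes "has_block D [a, b]" "closed_up u D n"
  shows "u (Out a) = u (In b)"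
proof -
  obtain k v w where k: "k < length D" "D ! k = v @ [a, b] @ w" using assms(1) by (rule has_blockE)
  then show ?thesis using closed_up_nth[OF assms(2) k(1)] by (auto simp: chain_append)
qed

text \<open>The entering label is what the chain has reached before the block, and that part of the
  chain consists of points surviving the removal.\<close>

lemma block_in_unique:
  assumes D: "distinct (concat D)" and b: "has_block D [a, b]"
    and u: "closed_up u D n" "closed_up v D n" "\<And>x. x \<in> points (remove {a, b} D) \<Longrightarrow> u x = v x"
  shows "u (In a) = v (In a)"
proof -
  obtain k vs ws where k: "k < length D" "D ! k = vs @ [a, b] @ ws" using b by (rule has_blockE)
  note bd = block_distinct[OF D k]
  have "m \<in> passages D" if "m \<in> set vs" for m using nth_passages[OF k(1), of m] k that by simp
  then have "u (In m) = v (In m) \<and> u (Out m) = v (Out m)" if "m \<in> set vs" for m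
    using that bd u(3) by (metis DiffI insertE empty_iff passages_remove points_simps(2,3))
  then have "chain u c vs d = chain v c vs d" for c d by (rule chain_cong)
  moreover have "u (Base k) = v (Base k)" using u(3) k(1) by simp
  moreover have "chain u (u (Base k)) vs (u (In a))" "chain v (v (Base k)) vs (v (In a))"
    using u(1,2)[THEN closed_up_nth, OF k(1)] k by (auto simp: chain_append)
  ultimately show ?thesis using chain_unique by metis
qed

section \<open>The first move\<close>

lemma kink_passages:
  assumes "e = 1 \<or> e = -1" "x \<in> A"
  shows "\<exists>y. cross e x y y (twist e x)" "\<exists>y. cross e y x (twist e x) y"
proof -
  have "\<exists>y. cross 1 x y y (twist 1 x)" "\<exists>y. cross 1 y x (twist 1 x) y" if "x \<in> A" for x
    using that kink_loop kink_under_over_ex by (simp_all add: cross_def twist_1)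
  \<comment> \<open>Read backwards, a negative over-under kink on \<open>x\<close> is a positive
    under-over kink on \<open>?z\<close>, and a negative under-over kink is a positive over-under
    one. So \<open>kink ?z = x\<close> turns the positive cases for \<open>?z\<close> into the
    negative cases for \<open>x\<close>.\<close>
  moreover have "\<exists>y. cross (-1) x y y (twist (-1) x)" "\<exists>y. cross (-1) y x (twist (-1) x) y" if "x \<in> A" for x
  proof -
    let ?z = "twist (-1) x"
    have "?z \<in> A" using that by simp
    moreover have "twist 1 ?z = x" using that by (rule twist_cancel(2))
    ultimately have "?z \<in> A" "kink ?z = x" using twist_1[of ?z] by simp_all
    then show "\<exists>y. cross (-1) x y y ?z" "\<exists>y. cross (-1) y x ?z y"
      using kink_under_over_ex[of ?z] kink_loop[of ?z] by (simp_all add: cross_def)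
  qed
  ultimately show "\<exists>y. cross e x y y (twist e x)" "\<exists>y. cross e y x (twist e x) y"
    using assms by auto
qed

lemma kink_passages_unique:
  assumes "e = 1 \<or> e = -1"
  shows "cross e x y y z \<Longrightarrow> z = twist e x" "cross e y x z y \<Longrightarrow> z = twist e x"
    "cross e x y y z \<Longrightarrow> cross e x y' y' z \<Longrightarrow> y = y'" "cross e y x z y \<Longrightarrow> cross e y' x z y' \<Longrightarrow> y = y'"
proof -
  have 1: "x \<in> A" "z \<in> A" if "cross e x y y z \<or> cross e y x z y" using that cross_in by blast+
  have 2: "twist (-1) (kink z) = z" if "z \<in> A" for z using twist_cancel(1)[of z 1] twist_1 that by simp
  show "z = twist e x" if c: "cross e x y y z"
  proof (cases "e = 1")
    case True
    then show ?thesis using c 1 kink_eqI[of x y z] by (simp add: cross_def twist_1)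
  next
    case False
    then have "x = kink z" using c by (intro kink_under_over[of y]) (simp add: cross_def)
    then show ?thesis using False assms 1 2 c by simp
  qed
  show "z = twist e x" if c: "cross e y x z y"
  proof (cases "e = 1")
    case True
    then have "z = kink x" using c by (intro kink_under_over[of y]) (simp add: cross_def)
    then show ?thesis using True 1 c by (simp add: twist_1)
  next
    case False
    then have "kink z = x" using c by (intro kink_eqI[of z y]) (simp add: cross_def)
    then show ?thesis using False assms 1 2 c by auto
  qed
  show "cross e x y y z \<Longrightarrow> cross e x y' y' z \<Longrightarrow> y = y'"
    using cross_unique[of e True x y False z y y z y' y'] by simp
  show "cross e y x z y \<Longrightarrow> cross e y' x z y' \<Longrightarrow> y = y'"
    using cross_unique[of e False z y True x y z y y' y'] by simp
qed

lemma similar_kink: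
  assumes D': "gauss_diagram D'" and k: "k < length D'"
    and w: "D' ! k = a # b # w" and D: "gauss_diagram D" "D = D'[k := w]"
    and ab: "a = (Over, c, e) \<and> b = (Under, c, e) \<or> a = (Under, c, e) \<and> b = (Over, c, e)"
    and n': "n' = n(k := n k + e)"
  shows "similar D n D' n'"
proof -
  note dist = gauss_diagram_distinct[OF D']
  have wb: "D' ! k = [] @ [a, b] @ w" using w by simp
  note bd = block_distinct[OF dist k wb]
  have abp: "a \<in> passages D'" "b \<in> passages D'" using nth_passages[OF k] w by auto
  then have e: "e = 1 \<or> e = -1" using gauss_diagram_partner(2)[OF D', of Over c e] ab by auto
  have len: "length D = length D'" using D by simp
  have nth: "j < length D' \<Longrightarrow> D ! j = (if j = k then w else D' ! j)" for j using D k by simp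
  have pas: "passages D = passages D' - {a, b}"
  proof -
    have "D = remove {a, b} D'"
    proof (rule nth_equalityI)
      fix j assume j: "j < length D"
      have "filter (\<lambda>m. m \<notin> {a, b}) w = w" "j \<noteq> k \<Longrightarrow> filter (\<lambda>m. m \<notin> {a, b}) (D' ! j) = D' ! j"
        using bd j len by (auto intro!: filter_True)
      then show "D ! j = remove {a, b} D' ! j" using j len w nth[of j] by auto
    qed (simp add: len)
    then show ?thesis by simp
  qed
  have kp: "Base k \<in> points D" "Base k \<in> points D'" using k len by simp_all
  have "m \<notin> {a, b}" if "m \<in> set (D ! j)" "j < length D" for m j
    using nth_passages[OF that(2,1)] pas by simp
  then have cong: "chain u' x (D ! j) y = chain u x (D ! j) y"
    if "j < length D" "\<And>m. m \<notin> {a, b} \<Longrightarrow> u' (In m) = u (In m) \<and> u' (Out m) = u (Out m)" for u u' :: "point \<Rightarrow> 'q" and x y j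
    using that by (intro chain_cong) blast
  have crossed: "crossed u' (passages D') \<longleftrightarrow> crossed u (passages D) \<and>
      cross_at u' c e"
    if eq: "\<And>m. m \<notin> {a, b} \<Longrightarrow> u' (In m) = u (In m) \<and> u' (Out m) = u (Out m)" for u u'
  proof -
    have "u' (In (l, c', e')) = u (In (l, c', e')) \<and> u' (Out (l, c', e')) = u (Out (l, c', e'))" if "(c', e') \<noteq> (c, e)" for l c' e'
      using that ab by (intro eq) auto
    moreover have "(Over, c', e') \<in> passages D' \<longleftrightarrow> (c', e') = (c, e) \<or> (Over, c', e') \<in> passages D" for c' e'
      using pas abp ab by auto
    moreover have "(Over, c, e) \<notin> passages D" using pas ab by auto
    ultimately show ?thesis unfolding crossed_def by (metis (no_types, lifting) prod.inject)
  qed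
  let ?cr = "\<lambda>u. cross_at u c e"
  have kink_ex: "\<exists>y. \<forall>u. u (In a) = x \<longrightarrow> u (Out a) = y \<longrightarrow> u (In b) = y \<longrightarrow> u (Out b) = twist e x \<longrightarrow> ?cr u"
    if "x \<in> A" for x
    using kink_passages[OF e that] ab by fastforce
  have kink_out: "u (Out b) = twist e (u (In a))" if "?cr u" "u (Out a) = u (In b)" for u
    using that ab kink_passages_unique(1,2)[OF e] by metis
  have kink_un: "u (In b) = v (In b)"
    if "?cr u" "u (Out a) = u (In b)" "?cr v" "v (Out a) = v (In b)" "u (In a) = v (In a)" "u (Out b) = v (Out b)" for u v
    using that ab kink_passages_unique(3,4)[OF e] by metis
  have start: "u' (In a) = u' (Base k)" "u' (Out a) = u' (In b)" "u' (Out b) = twist e (u' (Base k))" if u': "u' \<in> labels D' n'" for u'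
  proof -
    show 1: "u' (In a) = u' (Base k)" "u' (Out a) = u' (In b)"
      using u' k w by (auto simp: labels_def closed_up_def)
    have "?cr u'" using u' crossed[of u' u'] by (simp add: labels_def)
    then show "u' (Out b) = twist e (u' (Base k))" using kink_out 1 by metis
  qed
  \<comment> \<open>The base point now lies before the kink, which twists by \<open>e\<close>.
    Starting from the label twisted by \<open>- e\<close>, the strand leaves the kink with the old
    base label, and all labels beyond it stay.\<close>
  let ?Z = "insert (Base k, Base k, - e) ((\<lambda>x. (x, x, 0)) ` (points D - {Base k}))"
  show ?thesis
  proof (rule similarI[OF D(1) D', where Z = ?Z], goal_cases)
    case 1
    then show ?case using kp pas len by (auto simp: points_def)
  next
    case (2 u)
    have uA: "u x \<in> A" if "x \<in> points D" for x using labels_in[OF 2 that] .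
    define x where "x = twist (- e) (u (Base k))"
    have x: "x \<in> A" "twist e x = u (Base k)" using uA[OF kp(1)] by (simp_all add: x_def)
    obtain y where y: "\<And>u. u (In a) = x \<Longrightarrow> u (Out a) = y \<Longrightarrow> u (In b) = y \<Longrightarrow> u (Out b) = twist e x \<Longrightarrow> ?cr u"
      using kink_ex[OF x(1)] by blast
    define u' where "u' = u(Base k := x, In a := x, Out a := y, In b := y, Out b := twist e x)"
    have u'ab: "u' (Base k) = x" "u' (In a) = x" "u' (Out a) = y" "u' (In b) = y" "u' (Out b) = twist e x"
      and u'o: "m \<notin> {a, b} \<Longrightarrow> u' (In m) = u (In m) \<and> u' (Out m) = u (Out m)" "j \<noteq> k \<Longrightarrow> u' (Base j) = u (Base j)" for m j
      using bd(1) by (auto simp: u'_def)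
    have cr: "?cr u'" by (rule y) (simp_all add: u'ab)
    then have yA: "y \<in> A" using cross_in[OF cr] ab u'ab by auto
    have "closed_up u' D' n'"
      unfolding closed_up_def
    proof (intro allI impI)
      fix j assume j: "j < length D'"
      then have ch: "chain u' (u (Base j)) (D ! j) (twist (n j) (u (Base j)))"
        using closed_up_nth[of u D n j] 2 len cong[of j u' u] u'o by (simp add: labels_def)
      show "chain u' (u' (Base j)) (D' ! j) (twist (n' j) (u' (Base j)))"
      proof (cases "j = k")
        case True
        have "twist (n' k) x = twist (n k) (u (Base k))" using x by (simp add: n' twist_add flip: x(2))
        then show ?thesis using ch True k w u'ab x by (simp add: nth)
      next
        case False
        then show ?thesis using ch j u'o(2) by (simp add: nth n')
      qed
    qed
    moreover have "crossed u' (passages D')" using 2 cr crossed[of u' u] u'o by (simp add: labels_def)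
    moreover have "u' z \<in> A" if "z \<in> points D'" for z
      using that uA x yA len pas kp by (cases z) (auto simp: u'_def)
    ultimately have "u' \<in> labels D' n'" by (simp add: labels_def)
    moreover have "matched ?Z u u'"
      using pas by (auto simp: matched_def u'_def x_def points_def)
    ultimately show ?case by blast
  next
    case (3 u')
    have uA: "u' x \<in> A" if "x \<in> points D'" for x using labels_in[OF 3 that] .
    define u where "u = u'(Base k := twist e (u' (Base k)))"
    have uo: "u (In m) = u' (In m) \<and> u (Out m) = u' (Out m)" "j \<noteq> k \<Longrightarrow> u (Base j) = u' (Base j)" for m j
      by (auto simp: u_def)
    have "closed_up u D n"
      unfolding closed_up_def
    proof (intro allI impI)
      fix j assume j: "j < length D"
      have ch: "chain u' (u' (Base j)) (D' ! j) (twist (n' j) (u' (Base j)))"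
        using closed_up_nth[of u' D' n' j] 3 len j by (simp add: labels_def)
      have cg: "chain u x (D ! j) y = chain u' x (D ! j) y" for x y by (rule cong[OF j]) (simp add: uo)
      show "chain u (u (Base j)) (D ! j) (twist (n j) (u (Base j)))"
      proof (cases "j = k")
        case True
        have "twist (n' k) (u' (Base k)) = twist (n k) (u (Base k))"
          using uA[OF kp(2)] by (simp add: n' twist_add u_def)
        then show ?thesis using ch True k w start[OF 3] unfolding cg by (simp add: nth u_def)
      next
        case False
        then show ?thesis using ch j len uo(2) unfolding cg by (simp add: nth n')
      qed
    qed
    moreover have "crossed u (passages D)" using 3 crossed[of u' u] uo by (simp add: labels_def)
    moreover have "u z \<in> A" if "z \<in> points D" for z
      using that uA len pas kp by (cases z) (auto simp: u_def)
    ultimately have "u \<in> labels D n" by (simp add: labels_def)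
    moreover have "matched ?Z u u'"
      using uA[OF kp(2)] by (auto simp: matched_def u_def)
    ultimately show ?case by blast
  next
    case (4 u u' v' x)
    have eq: "u' z = v' z" if "z \<in> points D" for z
      using 4(4,5) that by (cases "z = Base k") (auto simp: matched_def)
    note s = start[OF 4(2)] start[OF 4(3)]
    have cr: "?cr u'" "?cr v'" using 4(2,3) crossed[of u' u'] crossed[of v' v'] by (simp_all add: labels_def)
    have a: "u' (In a) = v' (In a)" "u' (Out b) = v' (Out b)" using s eq[OF kp(1)] by auto
    have "u' (In b) = v' (In b)" by (rule kink_un[OF cr(1) s(2) cr(2) s(5) a])
    then have "u' x = v' x" if "x \<in> {In a, In b, Out a, Out b}" using that s a by auto
    moreover have "x \<in> points D" if "x \<notin> {In a, In b, Out a, Out b}" using that 4(6) pas len by (cases x) auto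
    ultimately show ?case using eq by blast
  next
    case (5 u v u' x)
    have "u (Base k) = v (Base k)"
    proof (rule twist_inj)
      show "twist (- e) (u (Base k)) = twist (- e) (v (Base k))" using 5(4,5) by (auto simp: matched_def)
    qed (use 5(1,2) labels_in kp in auto)
    then show ?case using 5 by (cases "x = Base k") (auto simp: matched_def)
  qed
qed

end

lemma gauss_diagram_sign_unique:
  assumes D: "gauss_diagram D" and m: "(l, c, e) \<in> passages D" "(l', c, e') \<in> passages D"
  shows "e = e'"
proof -
  have "(l, c, e') \<in> passages D" using gauss_diagram_partner(1)[OF D m(2)] .
  moreover have "inj_on (\<lambda>(l, c, e). (l, c)) (passages D)"
    using D unfolding gauss_diagram_def passages_def distinct_map by blast
  ultimately show ?thesis using m(1) unfolding inj_on_def by fastforce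
qed

lemma delete_crossings_remove:
  assumes "\<And>m. m \<in> passages D \<Longrightarrow> fst (snd m) \<in> C \<longleftrightarrow> m \<in> S"
  shows "delete_crossings C D = remove S D"
  unfolding delete_crossings_def remove_def
proof (intro map_cong refl filter_cong)
  fix w m assume "w \<in> set D" "m \<in> set w"
  then have "m \<in> passages D" by (auto simp: passages_def)
  then show "(case m of (l, c, e) \<Rightarrow> c \<notin> C) \<longleftrightarrow> m \<notin> S" using assms[of m] by (auto split: prod.splits)
qed

lemma delete_crossings_kink:
  assumes D: "gauss_diagram D" and p: "a \<in> passages D" "b \<in> passages D"
    and ab: "a = (Over, c, e) \<and> b = (Under, c, e) \<or> a = (Under, c, e) \<and> b = (Over, c, e)"
  shows "delete_crossings {c} D = remove {a, b} D"
proof (rule delete_crossings_remove)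
  fix m assume m: "m \<in> passages D"
  obtain l c' e' where m': "m = (l, c', e')" by (cases m) auto
  have "e' = e" if "c' = c"
    using gauss_diagram_sign_unique[OF D, of l c e' Over e] m m' p ab that by auto
  then show "fst (snd m) \<in> {c} \<longleftrightarrow> m \<in> {a, b}" using ab m' by (cases l) auto
qed

lemma delete_crossings_pair:
  assumes D: "gauss_diagram D" and p: "(Over, c, e) \<in> passages D" "(Over, d, - e) \<in> passages D"
  shows "delete_crossings {c, d} D =
    remove {(Over, c, e), (Over, d, - e), (Under, c, e), (Under, d, - e)} D"
proof (rule delete_crossings_remove)
  fix m assume m: "m \<in> passages D"
  obtain l c' e' where m': "m = (l, c', e')" by (cases m) auto
  have "e' = e" if "c' = c"
    using gauss_diagram_sign_unique[OF D, of l c e' Over e] m m' p that by auto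
  moreover have "e' = - e" if "c' = d"
    using gauss_diagram_sign_unique[OF D, of l d e' Over "- e"] m m' p that by auto
  ultimately show "fst (snd m) \<in> {c, d} \<longleftrightarrow>
      m \<in> {(Over, c, e), (Over, d, - e), (Under, c, e), (Under, d, - e)}"
    using m' by (cases l) auto
qed

context fibred_birack
begin

lemma similar_reidemeister1:
  assumes D: "gauss_diagram D" and D': "gauss_diagram D'" and del: "D = delete_crossings {c} D'"
    and k: "k < length D'" "D' ! k = v @ [a, b] @ w"
    and ab: "a = (Over, c, e) \<and> b = (Under, c, e) \<or> a = (Under, c, e) \<and> b = (Over, c, e)"
  shows "similar D n D' (n(k := n k + e))"
proof -
  define n' where "n' = n(k := n k + e)"
  note bd = block_distinct[OF gauss_diagram_distinct[OF D'] k]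
  have abp: "a \<in> passages D'" "b \<in> passages D'" using nth_passages[OF k(1)] k(2) by auto
  have R: "D = remove {a, b} D'" unfolding del by (rule delete_crossings_kink[OF D' abp ab])
  have Dnth: "D = D'[k := v @ w]"
  proof (rule nth_equalityI)
    fix j assume j: "j < length D"
    have "filter (\<lambda>m. m \<notin> {a, b}) w = w" "filter (\<lambda>m. m \<notin> {a, b}) v = v"
      "j \<noteq> k \<Longrightarrow> filter (\<lambda>m. m \<notin> {a, b}) (D' ! j) = D' ! j"
      using bd j R by (auto intro!: filter_True)
    then show "D ! j = D'[k := v @ w] ! j" using j k R by (cases "j = k") auto
  qed (simp add: R)
  \<comment> \<open>Rotating by \<open>v\<close> brings the place of the kink to the base point in
    both diagrams, where \<open>similar_kink\<close> applies.\<close>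
  define E E' where "E = D[k := w @ v]" and "E' = D'[k := ([a, b] @ w) @ v]"
  have E: "gauss_diagram E" using D k gauss_diagram_cong[OF mset_concat_update[of k D "w @ v"]] by (simp add: E_def Dnth)
  have E': "gauss_diagram E'"
    using D' k gauss_diagram_cong[OF mset_concat_update[of k D' "([a, b] @ w) @ v"]] by (simp add: E'_def)
  have 1: "similar D n E n" unfolding E_def by (rule similar_rotate[OF D]) (use k in \<open>simp_all add: Dnth\<close>)
  have 2: "similar E n E' n'"
    by (rule similar_kink[OF E', of k a b "w @ v"]) (use k E ab in \<open>simp_all add: E_def E'_def Dnth n'_def\<close>)
  have 3: "similar D' n' E' n'" unfolding E'_def by (rule similar_rotate[OF D']) (use k in simp_all)
  show ?thesis
    using similar_trans[OF D E' D' similar_trans[OF D E E' 1 2] similar_sym[OF D' E' 3]] by (simp add: n'_def)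
qed

section \<open>The second move\<close>

lemma cross_parallel:
  "x \<in> A \<Longrightarrow> y \<in> A \<Longrightarrow> e = 1 \<or> e = -1 \<Longrightarrow> \<exists>p q. cross e x y p q \<and> cross (- e) p q x y"
  using ex_out[of x y] ex_in[of y x] by (auto simp: cross_def)

text \<open>The two crossings of the bigon have opposite signs, so they are the same instance of
  \<open>X\<close> read in opposite directions. This is why one undoes the other; the antiparallel
  bigon is the same with the sideways axioms.\<close>

lemma cross_parallel_unique:
  "cross e x y p q \<Longrightarrow> cross (- e) p q x' y' \<Longrightarrow> e = 1 \<or> e = -1 \<Longrightarrow> x' = x \<and> y' = y"
  "cross e x y p q \<Longrightarrow> cross e x y p' q' \<Longrightarrow> p = p' \<and> q = q'"
  using un_in[of x y q p x' y'] un_out[of p q y x y' x'] cross_unique[of e True x p True y q _ _ p' q']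
  by (auto simp: cross_def split: if_splits)

lemma cross_antiparallel:
  "x \<in> A \<Longrightarrow> y \<in> A \<Longrightarrow> e = 1 \<or> e = -1 \<Longrightarrow> \<exists>p q. cross e x q p y \<and> cross (- e) p y x q"
  using ex_side[of x y] ex_side'[of y x] by (auto simp: cross_def)

lemma cross_antiparallel_unique:
  "cross e x q p y' \<Longrightarrow> cross (- e) p y x' q \<Longrightarrow> e = 1 \<or> e = -1 \<Longrightarrow> x' = x \<and> y' = y"
  "cross e x q p y \<Longrightarrow> cross e x q' p' y \<Longrightarrow> p = p' \<and> q = q'"
  using un_side'[of x q y' p x' y] un_side[of p y' q x y x'] cross_unique[of e True x p False y q _ _ p' q']
  by (auto simp: cross_def split: if_splits)

lemma similar_reidemeister2:
  assumes D: "gauss_diagram D" and D': "gauss_diagram D'" and cd: "c \<noteq> d"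
    and del: "D = delete_crossings {c, d} D'"
    and b1: "has_block D' [(Over, c, e), (Over, d, - e)]"
    and b2: "has_block D' [(Under, c, e), (Under, d, - e)] \<or> has_block D' [(Under, d, - e), (Under, c, e)]"
  shows "similar D n D' n"
proof -
  define a1 b1' where "a1 = (Over, c, e)" and "b1' = (Over, d, - e)"
  define par where "par \<longleftrightarrow> has_block D' [(Under, c, e), (Under, d, - e)]"
  define a2 where "a2 = (if par then (Under, c, e) else (Under, d, - e))"
  define b2' where "b2' = (if par then (Under, d, - e) else (Under, c, e))"
  note ab = a1_def b1'_def a2_def b2'_def
  have B: "has_block D' [a1, b1']" "has_block D' [a2, b2']"
    using b1 b2 by (auto simp: ab par_def)
  have ne: "a1 \<noteq> b1'" "a2 \<noteq> b2'" "a1 \<noteq> a2" "a1 \<noteq> b2'" "b1' \<noteq> a2" "b1' \<noteq> b2'"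
    using cd by (auto simp: ab)
  have pas: "a1 \<in> passages D'" "b1' \<in> passages D'" "a2 \<in> passages D'" "b2' \<in> passages D'"
    using has_block_passages B by auto
  have e: "e = 1 \<or> e = -1" using gauss_diagram_partner(2)[OF D', of Over c e] pas by (simp add: ab)
  let ?S = "{a1, b1', a2, b2'}"
  have "?S = {(Over, c, e), (Over, d, - e), (Under, c, e), (Under, d, - e)}" by (auto simp: ab)
  then have R: "D = remove ?S D'"
    using delete_crossings_pair[OF D', of c e d] pas unfolding del by (simp add: ab)
  \<comment> \<open>Each of these loses just one of the two strands. They are no Gauss diagrams, but
    closing up needs only distinct passages. Treating the strands in turn also covers blocks that
    lie next to each other in a word.\<close>
  define D1 D2 where "D1 = remove {a1, b1'} D'" and "D2 = remove {a2, b2'} D'"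
  note dist = gauss_diagram_distinct[OF D']
  have dist1: "distinct (concat D1)" and dist2: "distinct (concat D2)"
    using distinct_remove[OF dist] by (simp_all add: D1_def D2_def)
  have B1: "has_block D1 [a2, b2']" and B2: "has_block D2 [a1, b1']"
    using has_block_remove[OF B(2), of "{a1, b1'}"] has_block_remove[OF B(1), of "{a2, b2'}"] ne
    by (auto simp: D1_def D2_def)
  have R1: "remove {a2, b2'} D1 = D" and R2: "remove {a1, b1'} D2 = D"
    unfolding D1_def D2_def R remove_simps(3) by (simp_all add: insert_commute)
  let ?cr = "\<lambda>u. cross_at u c e \<and>
    cross_at u d (- e)"
  have pasD: "passages D = passages D' - ?S" by (simp add: R)
  have len: "length D = length D'" by (simp add: R)
  have ptsD: "x \<in> points D' \<longleftrightarrow> x \<in> points D \<or> x \<in> In ` ?S \<or> x \<in> Out ` ?S" for x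
    using pasD pas len by (cases x) auto
  have crossed: "crossed u' (passages D') \<longleftrightarrow> crossed u (passages D) \<and> ?cr u'"
    if eq: "\<And>m. m \<notin> ?S \<Longrightarrow> u' (In m) = u (In m) \<and> u' (Out m) = u (Out m)" for u u'
  proof -
    have 1: "u' (In (l, c', e')) = u (In (l, c', e')) \<and> u' (Out (l, c', e')) = u (Out (l, c', e'))"
      if "(c', e') \<noteq> (c, e)" "(c', e') \<noteq> (d, - e)" for l c' e'
      using that by (intro eq) (auto simp: ab)
    have 2: "(Over, c', e') \<in> passages D' \<longleftrightarrow> (c', e') = (c, e) \<or> (c', e') = (d, - e) \<or> (Over, c', e') \<in> passages D" for c' e'
      using pasD pas by (auto simp: ab)
    have 3: "(Over, c, e) \<notin> passages D" "(Over, d, - e) \<notin> passages D" using pasD by (auto simp: ab)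
    have 4: "(c', e') \<noteq> (c, e) \<and> (c', e') \<noteq> (d, - e)" if "(Over, c', e') \<in> passages D" for c' e' using that 3 by auto
    show ?thesis
    proof
      assume L: "crossed u' (passages D')"
      have "crossed u (passages D)" unfolding crossed_def
      proof (intro allI impI)
        fix c' e' assume "(Over, c', e') \<in> passages D"
        then show "cross_at u c' e'"
          using L 1[of c' e'] 2[of c' e'] 4[of c' e'] unfolding crossed_def by metis
      qed
      then show "crossed u (passages D) \<and> ?cr u'" using L 2 unfolding crossed_def by blast
    next
      assume L: "crossed u (passages D) \<and> ?cr u'"
      show "crossed u' (passages D')" unfolding crossed_def
      proof (intro allI impI)
        fix c' e' assume "(Over, c', e') \<in> passages D'"
        then consider "(c', e') = (c, e)" | "(c', e') = (d, - e)" | "(Over, c', e') \<in> passages D" using 2[of c' e'] by blast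
        then show "cross_at u' c' e'"
        proof cases
          case 3
          then show ?thesis using L 1[of c' e'] 4[of c' e'] unfolding crossed_def by metis
        qed (use L in auto)
      qed
    qed
  qed
  have cr_ex: "\<exists>p q. \<forall>u. u (In a1) = x \<and> u (Out a1) = p \<and> u (In b1') = p \<and> u (Out b1') = x \<and>
      u (In a2) = y \<and> u (Out a2) = q \<and> u (In b2') = q \<and> u (Out b2') = y \<longrightarrow> ?cr u" if xy: "x \<in> A" "y \<in> A" for x y
  proof (cases par)
    case True
    obtain p q where "cross e x y p q \<and> cross (- e) p q x y" using cross_parallel[OF xy e] by blast
    then show ?thesis using True by (intro exI[of _ p] exI[of _ q]) (auto simp: ab)
  next
    case False
    obtain p q where "cross e x q p y \<and> cross (- e) p y x q" using cross_antiparallel[OF xy e] by blast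
    then show ?thesis using False by (intro exI[of _ p] exI[of _ q]) (auto simp: ab)
  qed
  have cr_out: "u (Out b1') = u (In a1) \<and> u (Out b2') = u (In a2)"
    if c: "?cr u" and m: "u (Out a1) = u (In b1')" "u (Out a2) = u (In b2')" for u
  proof (cases par)
    case True
    then show ?thesis using c m by (intro cross_parallel_unique(1)[where p = "u (In b1')" and q = "u (In b2')", OF _ _ e]) (simp_all add: ab)
  next
    case False
    then show ?thesis
      using c m by (intro cross_antiparallel_unique(1)[where p = "u (In b1')" and q = "u (In b2')", OF _ _ e]) (simp_all add: ab)
  qed
  have cr_un: "u (Out a1) = v (Out a1) \<and> u (Out a2) = v (Out a2)"
    if c: "?cr u" "?cr v" and m: "u (Out a1) = u (In b1')" "u (Out a2) = u (In b2')"
      "v (Out a1) = v (In b1')" "v (Out a2) = v (In b2')"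
      and i: "u (In a1) = v (In a1)" "u (In a2) = v (In a2)" "u (Out b2') = v (Out b2')" for u v
  proof (cases par)
    case True
    then show ?thesis using c m i by (intro cross_parallel_unique(2)[where x = "u (In a1)" and y = "u (In a2)" and e = e]) (simp_all add: ab)
  next
    case False
    then show ?thesis using c m i by (intro cross_antiparallel_unique(2)[where x = "u (In a1)" and y = "u (Out b2')" and e = e]) (simp_all add: ab)
  qed
  have lab: "u' (Out a1) = u' (In b1')" "u' (Out a2) = u' (In b2')" "u' (Out b1') = u' (In a1)" "u' (Out b2') = u' (In a2)"
    "closed_up u' D1 n" "closed_up u' D2 n" "?cr u'" if u': "u' \<in> labels D' n" for u'
  proof -
    have cl: "closed_up u' D' n" using u' by (simp add: labels_def)
    show m: "u' (Out a1) = u' (In b1')" "u' (Out a2) = u' (In b2')" using block_middle[OF B(1) cl] block_middle[OF B(2) cl] by auto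
    show cr: "?cr u'" using u' crossed[of u' u'] by (simp add: labels_def)
    show o: "u' (Out b1') = u' (In a1)" "u' (Out b2') = u' (In a2)" using cr_out[OF cr m] by auto
    show "closed_up u' D1 n" unfolding D1_def by (rule closed_up_remove[OF dist B(1) cl o(1)[symmetric]])
    show "closed_up u' D2 n" unfolding D2_def by (rule closed_up_remove[OF dist B(2) cl o(2)[symmetric]])
  qed
  show ?thesis
  proof (rule similarI[OF D D', where Z = "(\<lambda>x. (x, x, 0)) ` points D"], goal_cases)
    case 1
    then show ?case using ptsD by auto
  next
    case (2 u)
    have uA: "u x \<in> A" if "x \<in> points D" for x using labels_in[OF 2 that] .
    have "closed_up u (remove {a2, b2'} D1) n" using 2 R1 by (simp add: labels_def)
    then obtain y u1 where y: "y \<in> A" "closed_up u1 D1 n" and u1: "u1 = u(In a2 := y, Out a2 := y, In b2' := y, Out b2' := y)"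
      using closed_up_insert[OF dist1 B1, of u n] uA unfolding R1 by blast
    have "u1 z \<in> A" if "z \<in> points D1" for z
      using that uA[of z] y(1) pasD len by (cases z) (auto simp: u1 D1_def)
    then obtain x u2 where x: "x \<in> A" "closed_up u2 D' n" and u2: "u2 = u1(In a1 := x, Out a1 := x, In b1' := x, Out b1' := x)"
      using closed_up_insert[OF dist B(1), of u1 n] y unfolding D1_def by blast
    obtain p q where pq: "\<And>u. u (In a1) = x \<Longrightarrow> u (Out a1) = p \<Longrightarrow> u (In b1') = p \<Longrightarrow> u (Out b1') = x \<Longrightarrow>
      u (In a2) = y \<Longrightarrow> u (Out a2) = q \<Longrightarrow> u (In b2') = q \<Longrightarrow> u (Out b2') = y \<Longrightarrow> ?cr u"
      using cr_ex[OF x(1) y(1)] by blast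
    \<comment> \<open>\<open>u2\<close> runs through both blocks with constant labels
      \<open>x\<close> and \<open>y\<close>; the arcs inside the bigon now receive the labels that
      its crossings demand.\<close>
    define u' where "u' = u2(Out a1 := p, In b1' := p, Out a2 := q, In b2' := q)"
    have cl: "closed_up u' D' n"
      unfolding u'_def by (intro closed_up_middle[OF dist B(2)] closed_up_middle[OF dist B(1)] x(2))
    have v: "u' (In a1) = x" "u' (Out a1) = p" "u' (In b1') = p" "u' (Out b1') = x"
      "u' (In a2) = y" "u' (Out a2) = q" "u' (In b2') = q" "u' (Out b2') = y"
      using ne by (auto simp: u'_def u2 u1)
    have o: "u' z = u z" if "z \<notin> In ` ?S" "z \<notin> Out ` ?S" for z
      using that by (auto simp: u'_def u2 u1)
    have cr: "?cr u'" by (rule pq) (fact v)+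
    then have crA: "p \<in> A" "q \<in> A" using cr[THEN conjunct1, THEN cross_in] v by (auto simp: ab split: if_splits)
    have cr': "crossed u' (passages D')" using crossed[of u' u] o cr 2 by (auto simp: labels_def)
    have "u' z \<in> A" if z: "z \<in> points D'" for z
    proof (cases "z \<in> In ` ?S \<or> z \<in> Out ` ?S")
      case True
      then show ?thesis using v x y crA by auto
    next
      case False
      then show ?thesis using o[of z] uA[of z] ptsD[of z] z by auto
    qed
    then have "u' \<in> labels D' n" using cl cr' unfolding labels_def by blast
    moreover have "matched ((\<lambda>x. (x, x, 0)) ` points D) u u'"
    proof -
      have "u' z = u z" if "z \<in> points D" for z using o[of z] that pasD by (cases z) auto
      then show ?thesis by (simp add: matched_def)
    qed
    ultimately show ?case by blast
  next
    case (3 u')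
    have "closed_up u' (remove {a2, b2'} D1) n"
      by (rule closed_up_remove[OF dist1 B1 lab(5)[OF 3] lab(4)[OF 3, symmetric]])
    then have "closed_up u' D n" unfolding R1 .
    moreover have "crossed u' (passages D)" using 3 crossed[of u' u'] by (simp add: labels_def)
    ultimately have "u' \<in> labels D n" using labels_in[OF 3] ptsD by (auto simp: labels_def)
    then show ?case by (rule bexI[rotated]) (auto simp: matched_def)
  next
    case (4 u u' v' x)
    have eq: "u' z = v' z" if "z \<in> points D" for z
      using 4(4,5) that by (auto simp: matched_def)
    \<comment> \<open>With the other strand removed, everything outside this block belongs to
      \<open>D\<close>, where both colorings are already known to agree.\<close>
    have i1: "u' (In a1) = v' (In a1)"
      using lab(6)[OF 4(2)] lab(6)[OF 4(3)] by (rule block_in_unique[OF dist2 B2]) (simp add: R2 eq)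
    have i2: "u' (In a2) = v' (In a2)"
      using lab(5)[OF 4(2)] lab(5)[OF 4(3)] by (rule block_in_unique[OF dist1 B1]) (simp add: R1 eq)
    note l = lab(1-4)[OF 4(2)] lab(1-4)[OF 4(3)]
    have m: "u' (Out a1) = v' (Out a1) \<and> u' (Out a2) = v' (Out a2)"
      by (rule cr_un[OF lab(7)[OF 4(2)] lab(7)[OF 4(3)] lab(1,2)[OF 4(2)] lab(1,2)[OF 4(3)] i1 i2]) (simp add: l i2)
    show ?case
    proof (cases "x \<in> In ` ?S \<or> x \<in> Out ` ?S")
      case True
      then show ?thesis using l m i1 i2 by auto
    next
      case False
      then show ?thesis using eq[of x] ptsD[of x] 4(6) by auto
    qed
  next
    case (5 u v u' x)
    then show ?case by (auto simp: matched_def)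
  qed
qed

section \<open>The third move\<close>

definition swap_labels :: "passage \<Rightarrow> passage \<Rightarrow> 'q \<Rightarrow> (point \<Rightarrow> 'q) \<Rightarrow> point \<Rightarrow> 'q"
  where "swap_labels a b y u = u(In b := u (In a), Out a := u (Out b), In a := y, Out b := y)"

text \<open>The labels entering and leaving the pair of passages are kept and handed over to the
  other passage. The new label \<open>y\<close> between them is arbitrary here; it is fixed later by
  the triangle.\<close>

lemma closed_up_swap:
  assumes D: "distinct (concat D)" and b: "has_block D [a, b]" and u: "closed_up u D n"
  shows "closed_up (swap_labels a b y u) (map (map (transpose a b)) D) n"
  unfolding closed_up_def
proof (intro allI impI)
  fix j assume "j < length (map (map (transpose a b)) D)"
  then have j: "j < length D" by simp
  obtain k v w where k: "k < length D" "D ! k = v @ [a, b] @ w" using b by (rule has_blockE)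
  note bd = block_distinct[OF D k]
  let ?u = "swap_labels a b y u"
  have id: "map (transpose a b) ms = ms" if "a \<notin> set ms" "b \<notin> set ms" for ms
    using that by (intro map_idI) (auto simp: transpose_def)
  have cong: "chain ?u c ms d = chain u c ms d" if "a \<notin> set ms" "b \<notin> set ms" for c ms d
    using that by (intro chain_cong) (auto simp: swap_labels_def)
  have base: "?u (Base j) = u (Base j)" by (simp add: swap_labels_def)
  show "chain ?u (?u (Base j)) (map (map (transpose a b)) D ! j) (twist (n j) (?u (Base j)))"
  proof (cases "j = k")
    case True
    have "map (map (transpose a b)) D ! j = v @ [b, a] @ w"
      using True k j id[OF bd(2,4)] id[OF bd(3,5)] by simp
    moreover have "?u (In b) = u (In a)" "?u (Out b) = y" "?u (In a) = y" "?u (Out a) = u (Out b)"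
      using bd(1) by (simp_all add: swap_labels_def)
    ultimately show ?thesis using closed_up_nth[OF u j] True k cong[OF bd(2,4)] cong[OF bd(3,5)] base
      by (auto simp: chain_append)
  next
    case False
    then show ?thesis using closed_up_nth[OF u j] cong[of "D ! j"] id[of "D ! j"] bd(6,7)[of j] j base by simp
  qed
qed

lemma has_block_map: "has_block D xs \<Longrightarrow> has_block (map (map f) D) (map f xs)"
  unfolding has_block_def by (auto intro: map_mono_sublist)

lemma sign_flip:
  fixes e f g \<delta> :: int
  assumes "e = 1 \<or> e = -1" "f = 1 \<or> f = -1" "g = 1 \<or> g = -1" "\<delta> = 1 \<or> \<delta> = -1"
  shows "(- \<delta> * e * f * g = 1) = (\<not> \<delta> * e * f * g = 1)" "(- \<delta> * e = 1) = (\<not> \<delta> * e = 1)"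
    "(- \<delta> * f = 1) = (\<not> \<delta> * f = 1)"
  using assms by (elim disjE; simp)+

text \<open>The pairs \<open>x1, x2\<close>, \<open>y1, y2\<close> and \<open>z1, z2\<close> are the
  neighbours on the top, middle and bottom strand in the order met in \<open>D\<close>. In this form
  the inverse move is another instance, with all pairs reversed and \<open>\<delta>\<close> negated,
  so only one direction needs an argument.\<close>

lemma reidemeister3_transfer:
  assumes D: "gauss_diagram D"
    and signs: "e = 1 \<or> e = -1" "f = 1 \<or> f = -1" "g = 1 \<or> g = -1" "\<delta> = 1 \<or> \<delta> = -1"
    and pqv: "distinct [p, q, v]"
    and x: "(x1, x2) = (if \<delta> * e * f * g = 1 then ((Over, p, e), (Over, q, f)) else ((Over, q, f), (Over, p, e)))"
    and y: "(y1, y2) = (if \<delta> * e = 1 then ((Under, p, e), (Over, v, g)) else ((Over, v, g), (Under, p, e)))"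
    and z: "(z1, z2) = (if \<delta> * f = 1 then ((Under, q, f), (Under, v, g)) else ((Under, v, g), (Under, q, f)))"
    and B: "has_block D [x1, x2]" "has_block D [y1, y2]" "has_block D [z1, z2]"
    and D': "D' = map (map (transpose x1 x2 \<circ> transpose y1 y2 \<circ> transpose z1 z2)) D"
    and Z: "Z = {(In x1, In x2, 0), (Out x2, Out x1, 0), (In y1, In y2, 0), (Out y2, Out y1, 0),
      (In z1, In z2, 0), (Out z2, Out z1, 0)} \<union>
      (\<lambda>w. (w, w, 0)) ` (points D - In ` {x1, x2, y1, y2, z1, z2} - Out ` {x1, x2, y1, y2, z1, z2})"
  shows "passages D' = passages D"
    and "gauss_diagram D'"
    and "has_block D' [x2, x1] \<and> has_block D' [y2, y1] \<and> has_block D' [z2, z1]"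
    and "D = map (map (transpose x2 x1 \<circ> transpose y2 y1 \<circ> transpose z2 z1)) D'"
    and "u \<in> labels D n \<Longrightarrow> \<exists>u'\<in>labels D' n. matched Z u u'"
    and "u' \<in> labels D' n \<Longrightarrow> v' \<in> labels D' n \<Longrightarrow> matched Z u u' \<Longrightarrow> matched Z u v' \<Longrightarrow>
      w \<in> points D' \<Longrightarrow> u' w = v' w"
proof -
  let ?S = "{x1, x2, y1, y2, z1, z2}"
  let ?\<tau> = "transpose x1 x2 \<circ> transpose y1 y2 \<circ> transpose z1 z2"
  have "distinct [(Over, p, e), (Over, q, f), (Under, p, e), (Over, v, g), (Under, q, f), (Under, v, g)]"
    using pqv by auto
  then have ne: "distinct [x1, x2, y1, y2, z1, z2]"
    using x y z by (auto split: if_splits)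
  then have ne': "distinct [z2, z1, y2, y1, x2, x1]" by auto
  have SD: "?S \<subseteq> passages D" using B[THEN has_block_passages] by auto
  have \<tau>: "?\<tau> x1 = x2" "?\<tau> x2 = x1" "?\<tau> y1 = y2" "?\<tau> y2 = y1" "?\<tau> z1 = z2" "?\<tau> z2 = z1"
    using ne by (auto simp: transpose_def)
  have \<tau>': "?\<tau> m = m" if "m \<notin> ?S" for m using that by (simp add: transpose_def)
  have "?\<tau> ` passages D = passages D"
  proof -
    have "?\<tau> m \<in> passages D" if "m \<in> passages D" for m
      using that SD \<tau> \<tau>'[of m] by (cases "m \<in> ?S") auto
    moreover have "?\<tau> (?\<tau> m) = m" for m
      using \<tau> \<tau>'[of m] by (cases "m \<in> ?S") (auto simp del: o_apply)
    ultimately show ?thesis by (metis (no_types, lifting) image_eqI image_subsetI subsetI subset_antisym)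
  qed
  then show pas: "passages D' = passages D" by (simp add: D' passages_map)
  have inj: "inj ?\<tau>" by (intro inj_compose) auto
  have "mset (concat D') = mset (concat D)"
  proof (rule set_eq_iff_mset_eq_distinct[THEN iffD1])
    show "distinct (concat D')" using gauss_diagram_distinct[OF D] inj
      by (simp add: D' distinct_map inj_on_subset[OF inj] flip: map_concat)
  qed (use gauss_diagram_distinct[OF D] pas in \<open>simp_all add: passages_def\<close>)
  then show "gauss_diagram D'" using D gauss_diagram_cong by blast
  show "has_block D' [x2, x1] \<and> has_block D' [y2, y1] \<and> has_block D' [z2, z1]"
    using B[THEN has_block_map[of _ _ ?\<tau>]] \<tau> by (simp add: D')
  show "D = map (map (transpose x2 x1 \<circ> transpose y2 y1 \<circ> transpose z2 z1)) D'"
  proof -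
    have "(transpose x2 x1 \<circ> transpose y2 y1 \<circ> transpose z2 z1) (?\<tau> m) = m" for m
      using \<tau> \<tau>'[of m] ne by (cases "m \<in> ?S") (auto simp: transpose_def)
    then show ?thesis by (simp add: D' comp_def)
  qed
  let ?tri = "triangle (\<delta> * e * f * g = 1) (\<delta> * e = 1) (\<delta> * f = 1) e f g"
  let ?tri' = "triangle (- \<delta> * e * f * g = 1) (- \<delta> * e = 1) (- \<delta> * f = 1) e f g"
  note neg = sign_flip[OF signs(1-4)]
  have tri: "cross_at u p e \<and> cross_at u q f \<and> cross_at u v g \<longleftrightarrow>
      ?tri (u (In x1)) T1 (u (Out x2)) (u (In y1)) M1 (u (Out y2)) (u (In z1)) L1 (u (Out z2))"
    if "u (Out x1) = T1" "u (In x2) = T1" "u (Out y1) = M1" "u (In y2) = M1" "u (Out z1) = L1" "u (In z2) = L1"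
    for u T1 M1 L1
    using that x y z unfolding triangle_def by (auto split: if_splits)
  have tri': "cross_at u p e \<and> cross_at u q f \<and> cross_at u v g \<longleftrightarrow>
      ?tri' (u (In x2)) T1 (u (Out x1)) (u (In y2)) M1 (u (Out y1)) (u (In z2)) L1 (u (Out z1))"
    if "u (Out x2) = T1" "u (In x1) = T1" "u (Out y2) = M1" "u (In y1) = M1" "u (Out z2) = L1" "u (In z1) = L1"
    for u T1 M1 L1
    using that x y z unfolding triangle_def neg by (auto split: if_splits)
  have S: "?S = {(Over, p, e), (Over, q, f), (Under, p, e), (Over, v, g), (Under, q, f), (Under, v, g)}"
    using x y z by (auto split: if_splits)
  have crossed: "crossed u' (passages D) \<longleftrightarrow> cross_at u' p e \<and> cross_at u' q f \<and> cross_at u' v g \<and>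
      (\<forall>c e. (Over, c, e) \<in> passages D - ?S \<longrightarrow> cross_at u c e)"
    if eq: "\<And>m. m \<notin> ?S \<Longrightarrow> u' (In m) = u (In m) \<and> u' (Out m) = u (Out m)" for u u'
  proof -
    have "cross_at u' c e' = cross_at u c e'" if "(Over, c, e') \<notin> ?S" for c e'
    proof -
      have "(Under, c, e') \<notin> ?S" using that unfolding S by auto
      then show ?thesis using eq that by simp
    qed
    moreover have "(Over, p, e) \<in> passages D" "(Over, q, f) \<in> passages D" "(Over, v, g) \<in> passages D"
      using SD unfolding S by auto
    moreover have "(c, e') = (p, e) \<or> (c, e') = (q, f) \<or> (c, e') = (v, g)" if "(Over, c, e') \<in> ?S" for c e'
      using that unfolding S by auto
    ultimately show ?thesis unfolding crossed_def by (smt (verit, ccfv_threshold) DiffD1 DiffD2 DiffI prod.inject)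
  qed
  have ptsD: "w \<in> points D' \<longleftrightarrow> w \<in> points D" for w using pas by (cases w) (auto simp: D')
  have middle: "u (Out x1) = u (In x2)" "u (Out y1) = u (In y2)" "u (Out z1) = u (In z2)" if "u \<in> labels D n" for u
    using that B[THEN block_middle, of u n] by (simp_all add: labels_def)
  have middle': "u (Out x2) = u (In x1)" "u (Out y2) = u (In y1)" "u (Out z2) = u (In z1)" if "u \<in> labels D' n" for u
    using that block_middle[of D' x2 x1 u n] block_middle[of D' y2 y1 u n] block_middle[of D' z2 z1 u n]
      \<open>has_block D' [x2, x1] \<and> has_block D' [y2, y1] \<and> has_block D' [z2, z1]\<close>
    by (simp_all add: labels_def)
  show "\<exists>u'\<in>labels D' n. matched Z u u'" if u: "u \<in> labels D n"
  proof -
    have "cross_at u p e \<and> cross_at u q f \<and> cross_at u v g" using u crossed[of u u] by (simp add: labels_def)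
    then obtain T1 M1 L1 where t: "?tri' (u (In x1)) T1 (u (Out x2)) (u (In y1)) M1 (u (Out y2)) (u (In z1)) L1 (u (Out z2))"
      using tri[of u] middle[OF u] triangle_move[OF signs] by metis
    define u' where "u' = swap_labels x1 x2 T1 (swap_labels y1 y2 M1 (swap_labels z1 z2 L1 u))"
    have v: "u' (In x2) = u (In x1)" "u' (Out x2) = T1" "u' (In x1) = T1" "u' (Out x1) = u (Out x2)"
      "u' (In y2) = u (In y1)" "u' (Out y2) = M1" "u' (In y1) = M1" "u' (Out y1) = u (Out y2)"
      "u' (In z2) = u (In z1)" "u' (Out z2) = L1" "u' (In z1) = L1" "u' (Out z1) = u (Out z2)"
      using ne ne' by (simp_all add: u'_def swap_labels_def)
    have o: "u' w = u w" if "w \<notin> In ` ?S" "w \<notin> Out ` ?S" for w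
      using that by (auto simp: u'_def swap_labels_def)
    have cr: "cross_at u' p e \<and> cross_at u' q f \<and> cross_at u' v g"
      using tri'[of u' T1 M1 L1] v t by simp
    have cr': "crossed u' (passages D')"
      using cr u crossed[of u' u] crossed[of u u] o unfolding pas by (simp add: labels_def)
    have "cross_at u' c e' \<Longrightarrow> u' (In (Over, c, e')) \<in> A \<and> u' (In (Under, c, e')) \<in> A \<and> u' (Out (Over, c, e')) \<in> A \<and> u' (Out (Under, c, e')) \<in> A" for c e'
      using cross_in by blast
    then have inS: "u' (In m) \<in> A \<and> u' (Out m) \<in> A" if "m \<in> ?S" for m
      using cr that unfolding S by auto
    have "u' w \<in> A" if "w \<in> points D'" for w
    proof (cases "w \<in> In ` ?S \<or> w \<in> Out ` ?S")
      case True
      then show ?thesis using inS by blast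
    next
      case False
      then show ?thesis using o[of w] labels_in[OF u, of w] ptsD that by auto
    qed
    moreover have "closed_up u' D' n"
    proof -
      \<comment> \<open>\<open>closed_up_swap\<close> exchanges one pair only, so the strands are
        treated in turn. The remaining blocks survive each exchange because the six passages are
        distinct.\<close>
      define D1 where "D1 = map (map (transpose z1 z2)) D"
      define D2 where "D2 = map (map (transpose y1 y2)) D1"
      have D'2: "D' = map (map (transpose x1 x2)) D2" by (simp add: D' D2_def D1_def comp_def)
      note d = gauss_diagram_distinct[OF D]
      have d1: "distinct (concat D1)" using d by (simp add: D1_def distinct_map flip: map_concat)
      have d2: "distinct (concat D2)" using d1 by (simp add: D2_def distinct_map flip: map_concat)
      have B1: "has_block D1 [x1, x2]" "has_block D1 [y1, y2]"
        using B(1,2)[THEN has_block_map[of _ _ "transpose z1 z2"]] ne ne' by (simp_all add: D1_def transpose_def)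
      have B2: "has_block D2 [x1, x2]"
        using B1(1)[THEN has_block_map[of _ _ "transpose y1 y2"]] ne ne' by (simp add: D2_def transpose_def)
      have "closed_up u D n" using u by (simp add: labels_def)
      from closed_up_swap[OF d B(3) this] closed_up_swap[OF d1 B1(2)] closed_up_swap[OF d2 B2]
      show ?thesis unfolding D'2 u'_def by (simp flip: D1_def D2_def)
    qed
    ultimately have "u' \<in> labels D' n" using cr' by (simp add: labels_def)
    moreover have "matched Z u u'" unfolding Z matched_def using v o by auto
    ultimately show ?thesis by blast
  qed
  show "u' w = v' w" if u': "u' \<in> labels D' n" and v': "v' \<in> labels D' n"
    and m: "matched Z u u'" "matched Z u v'" and w: "w \<in> points D'"
  proof -
    have eq: "u' w = v' w" if "w \<in> points D" "w \<notin> In ` ?S" "w \<notin> Out ` ?S" for w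
      using m that unfolding Z matched_def by auto
    have eqS: "u' (In x2) = v' (In x2)" "u' (Out x1) = v' (Out x1)" "u' (In y2) = v' (In y2)"
      "u' (Out y1) = v' (Out y1)" "u' (In z2) = v' (In z2)" "u' (Out z1) = v' (Out z1)"
      using m unfolding Z matched_def by auto
    have "cross_at u' p e \<and> cross_at u' q f \<and> cross_at u' v g" "cross_at v' p e \<and> cross_at v' q f \<and> cross_at v' v g"
      using u' v' crossed[of u' u'] crossed[of v' v'] pas by (simp_all add: labels_def)
    note t = this[THEN tri'[THEN iffD1, rotated -1]]
    have t1: "?tri' (u' (In x2)) (u' (In x1)) (u' (Out x1)) (u' (In y2)) (u' (In y1)) (u' (Out y1)) (u' (In z2)) (u' (In z1)) (u' (Out z1))"
      by (rule t(1)) (simp_all add: middle'[OF u'])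
    have t2: "?tri' (u' (In x2)) (v' (In x1)) (u' (Out x1)) (u' (In y2)) (v' (In y1)) (u' (Out y1)) (u' (In z2)) (v' (In z1)) (u' (Out z1))"
      unfolding eqS by (rule t(2)) (simp_all add: middle'[OF v'])
    have "u' (In x1) = v' (In x1) \<and> u' (In y1) = v' (In y1) \<and> u' (In z1) = v' (In z1)"
      by (rule triangle_unique[OF t1 t2])
    then have "u' w = v' w" if "w \<in> In ` ?S \<or> w \<in> Out ` ?S"
      using that eqS middle'[OF u'] middle'[OF v'] by auto
    then show ?thesis using eq w ptsD by blast
  qed
qed

lemma similar_reidemeister3:
  assumes D: "gauss_diagram D" "gauss_diagram D'" and r: "reidemeister3 D D'"
  shows "similar D n D' n"
proof -
  obtain p q v e f g \<delta> where pqv: "distinct [p, q, v]" and sg: "{e, f, g, \<delta>} \<subseteq> {1, -1}"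
    and B: "has_block D (if \<delta> * e * f * g = 1 then [(Over, p, e), (Over, q, f)] else [(Over, q, f), (Over, p, e)])"
      "has_block D (if \<delta> * e = 1 then [(Under, p, e), (Over, v, g)] else [(Over, v, g), (Under, p, e)])"
      "has_block D (if \<delta> * f = 1 then [(Under, q, f), (Under, v, g)] else [(Under, v, g), (Under, q, f)])"
    and D': "D' = map (map (transpose (Over, p, e) (Over, q, f) \<circ> transpose (Under, p, e) (Over, v, g) \<circ>
      transpose (Under, q, f) (Under, v, g))) D"
    using r unfolding reidemeister3_def Let_def by blast
  have signs: "e = 1 \<or> e = -1" "f = 1 \<or> f = -1" "g = 1 \<or> g = -1" "\<delta> = 1 \<or> \<delta> = -1" "- \<delta> = 1 \<or> - \<delta> = -1"
    using sg by auto
  note neg = sign_flip[OF signs(1-4)]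
  obtain x1 x2 where x: "(x1, x2) = (if \<delta> * e * f * g = 1 then ((Over, p, e), (Over, q, f)) else ((Over, q, f), (Over, p, e)))"
    by metis
  obtain y1 y2 where y: "(y1, y2) = (if \<delta> * e = 1 then ((Under, p, e), (Over, v, g)) else ((Over, v, g), (Under, p, e)))"
    by metis
  obtain z1 z2 where z: "(z1, z2) = (if \<delta> * f = 1 then ((Under, q, f), (Under, v, g)) else ((Under, v, g), (Under, q, f)))"
    by metis
  have B': "has_block D [x1, x2]" "has_block D [y1, y2]" "has_block D [z1, z2]"
    using B x y z by (auto split: if_splits)
  have "transpose (Over, p, e) (Over, q, f) = transpose x1 x2" "transpose (Under, p, e) (Over, v, g) = transpose y1 y2"
    "transpose (Under, q, f) (Under, v, g) = transpose z1 z2"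
    using x y z by (auto split: if_splits simp: transpose_commute)
  then have D'2: "D' = map (map (transpose x1 x2 \<circ> transpose y1 y2 \<circ> transpose z1 z2)) D" by (simp add: D')
  define S0 where "S0 E = points E - In ` {x1, x2, y1, y2, z1, z2} - Out ` {x1, x2, y1, y2, z1, z2}" for E
  define Z0 where "Z0 E = (\<lambda>w. (w, w, 0::int)) ` S0 E" for E
  define Z where "Z = {(In x1, In x2, 0), (Out x2, Out x1, 0), (In y1, In y2, 0), (Out y2, Out y1, 0),
      (In z1, In z2, 0), (Out z2, Out z1, 0)} \<union> Z0 D"
  define Z' where "Z' = {(In x2, In x1, 0), (Out x1, Out x2, 0), (In y2, In y1, 0), (Out y1, Out y2, 0),
      (In z2, In z1, 0), (Out z1, Out z2, 0)} \<union> Z0 D'"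
  note fw = reidemeister3_transfer[OF D(1) signs(1-4) pqv x y z B' D'2 Z_def[unfolded Z0_def S0_def]]
  have x': "(x2, x1) = (if - \<delta> * e * f * g = 1 then ((Over, p, e), (Over, q, f)) else ((Over, q, f), (Over, p, e)))"
    and y': "(y2, y1) = (if - \<delta> * e = 1 then ((Under, p, e), (Over, v, g)) else ((Over, v, g), (Under, p, e)))"
    and z': "(z2, z1) = (if - \<delta> * f = 1 then ((Under, q, f), (Under, v, g)) else ((Under, v, g), (Under, q, f)))"
    using x y z unfolding neg by (auto split: if_splits)
  have Z'2: "Z' = {(In x2, In x1, 0), (Out x1, Out x2, 0), (In y2, In y1, 0), (Out y1, Out y2, 0),
      (In z2, In z1, 0), (Out z1, Out z2, 0)} \<union>
      (\<lambda>w. (w, w, 0)) ` (points D' - In ` {x2, x1, y2, y1, z2, z1} - Out ` {x2, x1, y2, y1, z2, z1})"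
    unfolding Z'_def Z0_def S0_def by (simp add: insert_commute)
  note b = fw(3)[THEN conjunct1] fw(3)[THEN conjunct2, THEN conjunct1] fw(3)[THEN conjunct2, THEN conjunct2]
  \<comment> \<open>Negating \<open>\<delta>\<close> flips all three order conditions, so the
    reversed pairs satisfy the hypotheses of the same lemma for \<open>D'\<close>.\<close>
  note bw = reidemeister3_transfer[OF D(2) signs(1-3,5) pqv x' y' z' b fw(4) Z'2]
  have pas: "passages D' = passages D" by (rule fw(1))
  have pts: "points D' = points D" unfolding points_def pas by (simp add: D')
  have S0: "S0 D' = S0 D" unfolding S0_def pts ..
  \<comment> \<open>All twists in \<open>Z\<close> are zero, so it can be read in either
    direction.\<close>
  have mm: "matched Z u u' \<longleftrightarrow> matched Z' u' u" for u u'
    unfolding Z_def Z'_def Z0_def S0 matched_def by auto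
  have SD: "{x1, x2, y1, y2, z1, z2} \<subseteq> passages D" using B'[THEN has_block_passages] by auto
  show ?thesis
  proof (rule similarI[OF D, where Z = Z], goal_cases)
    case 1
    show ?case unfolding Z_def Z0_def S0_def pts using SD by auto
  next
    case (2 u)
    then show ?case by (rule fw(5))
  next
    case (3 u')
    then show ?case unfolding mm by (rule bw(5))
  next
    case (4 u u' v' x)
    then show ?case using fw(6) by blast
  next
    case (5 u v u' x)
    then show ?case unfolding mm using bw(6) by blast
  qed
qed

end

section \<open>Writhe and isotopy\<close>

definition word_writhe :: "passage list \<Rightarrow> int"
  where "word_writhe w = (\<Sum>(l, c, e)\<leftarrow>w. if l = Over \<and> (Under, c, e) \<in> set w then e else 0)"

lemma writhe_word: "writhe D k = word_writhe (D ! k)"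
  by (simp add: writhe_def word_writhe_def)

lemma word_writhe_mset: "mset w = mset w' \<Longrightarrow> word_writhe w = word_writhe w'"
  unfolding word_writhe_def using mset_eq_setD[of w w']
  by (simp flip: sum_mset_sum_list)

lemma word_writhe_rename:
  assumes "inj h"
  shows "word_writhe (map (\<lambda>(l, c, e). (l, h c, e)) w) = word_writhe w"
proof -
  have "(Under, h c, e) \<in> (\<lambda>(l, c, e). (l, h c, e)) ` set w \<longleftrightarrow> (Under, c, e) \<in> set w" for c e
    using assms by (force simp: inj_def)
  then show ?thesis unfolding word_writhe_def by (simp add: comp_def case_prod_unfold cong: if_cong)
qed

text \<open>\<open>S\<close> contains both passages of a crossing or neither, so a surviving
  over-passage keeps its under-partner and still counts; the writhe splits into the contributions
  outside and inside \<open>S\<close>.\<close>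

lemma word_writhe_remove:
  assumes w: "distinct w" and S: "\<And>c e. (Over, c, e) \<in> S \<longleftrightarrow> (Under, c, e) \<in> S"
  shows "word_writhe w = word_writhe (filter (\<lambda>m. m \<notin> S) w) +
    (\<Sum>(l, c, e)\<in>set w \<inter> S. if l = Over \<and> (Under, c, e) \<in> set w then e else 0)"
proof -
  let ?F = "\<lambda>T (l, c, e). if l = Over \<and> (Under, c, e) \<in> T then e else (0 :: int)"
  have ww: "word_writhe v = sum (?F (set v)) (set v)" if "distinct v" for v
    unfolding word_writhe_def by (rule sum_list_distinct_conv_sum_set[OF that])
  have "sum (?F (set w)) (set w) = sum (?F (set w)) (set w - S) + sum (?F (set w)) (set w \<inter> S)"
    by (subst sum.union_disjoint[symmetric]) (auto intro!: sum.cong)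
  moreover have "sum (?F (set w)) (set w - S) = sum (?F (set w - S)) (set w - S)"
    using S by (intro sum.cong) (auto split: prod.splits)
  moreover have "set (filter (\<lambda>m. m \<notin> S) w) = set w - S" by auto
  ultimately show ?thesis using ww[OF w] ww[of "filter (\<lambda>m. m \<notin> S) w"] w by simp
qed

lemma block_mem_iff:
  assumes D: "distinct (concat D)" and "has_block D [a, b]" "j < length D"
  shows "a \<in> set (D ! j) \<longleftrightarrow> b \<in> set (D ! j)"
proof -
  obtain k v w where k: "k < length D" "D ! k = v @ [a, b] @ w" using assms(2) by (rule has_blockE)
  then show ?thesis using block_distinct(6,7)[OF D k assms(3)] by (cases "j = k") auto
qed

lemma transpose_image_iff: "(a \<in> S \<longleftrightarrow> b \<in> S) \<Longrightarrow> transpose a b ` S = S"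
  by (auto simp: transpose_def image_iff)

text \<open>Neighbouring passages lie on one component, so the two crossings are both self-crossings
  of component \<open>j\<close> or neither is, and their signs cancel.\<close>

lemma writhe_reidemeister2:
  assumes D': "gauss_diagram D'" and cd: "c \<noteq> d" and del: "D = delete_crossings {c, d} D'"
    and b1: "has_block D' [(Over, c, e), (Over, d, - e)]"
    and b2: "has_block D' [(Under, c, e), (Under, d, - e)] \<or> has_block D' [(Under, d, - e), (Under, c, e)]"
    and j: "j < length D'"
  shows "writhe D' j = writhe D j"
proof -
  let ?S = "{(Over, c, e), (Over, d, - e), (Under, c, e), (Under, d, - e)}"
  note dist = gauss_diagram_distinct[OF D']
  have pas: "(Over, c, e) \<in> passages D'" "(Over, d, - e) \<in> passages D'"
    using b1[THEN has_block_passages] by auto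
  have R: "D = remove ?S D'" unfolding del by (rule delete_crossings_pair[OF D' pas])
  have 1: "(Over, c, e) \<in> set (D' ! j) \<longleftrightarrow> (Over, d, - e) \<in> set (D' ! j)" by (rule block_mem_iff[OF dist b1 j])
  have 2: "(Under, c, e) \<in> set (D' ! j) \<longleftrightarrow> (Under, d, - e) \<in> set (D' ! j)"
    using b2 block_mem_iff[OF dist _ j] by blast
  have "(\<Sum>(l, c, e)\<in>set (D' ! j) \<inter> ?S. if l = Over \<and> (Under, c, e) \<in> set (D' ! j) then e else 0) = 0"
  proof -
    have "set (D' ! j) \<inter> ?S = (if (Over, c, e) \<in> set (D' ! j) then {(Over, c, e), (Over, d, - e)} else {}) \<union>
        (if (Under, c, e) \<in> set (D' ! j) then {(Under, c, e), (Under, d, - e)} else {})"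
      using 1 2 by auto
    then show ?thesis using cd 2 by simp
  qed
  then show ?thesis
    using word_writhe_remove[OF distinct_concat_nth(1)[OF dist j], of ?S] j by (auto simp: writhe_word R)
qed

lemma writhe_reidemeister1:
  assumes D': "gauss_diagram D'" and k: "k < length D'" "D' ! k = v @ [a, b] @ w"
    and ab: "a = (Over, c, e) \<and> b = (Under, c, e) \<or> a = (Under, c, e) \<and> b = (Over, c, e)"
    and D: "D = delete_crossings {c} D'" and j: "j < length D'"
  shows "writhe D' j = writhe D j + (if j = k then e else 0)"
proof -
  note dist = gauss_diagram_distinct[OF D']
  note bd = block_distinct[OF dist k]
  have abp: "a \<in> passages D'" "b \<in> passages D'" using nth_passages[OF k(1)] k(2) by auto
  have R: "D = remove {a, b} D'" unfolding D by (rule delete_crossings_kink[OF D' abp ab])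
  have "(\<Sum>(l, c, e)\<in>set (D' ! j) \<inter> {a, b}. if l = Over \<and> (Under, c, e) \<in> set (D' ! j) then e else 0)
      = (if j = k then e else 0)"
  proof (cases "j = k")
    case True
    then have "set (D' ! j) \<inter> {a, b} = {a, b}" using k by auto
    then show ?thesis using True k(2) ab by auto
  next
    case False
    then have "set (D' ! j) \<inter> {a, b} = {}" using bd(6,7)[OF j] by auto
    then show ?thesis using False by simp
  qed
  then show ?thesis
    using word_writhe_remove[OF distinct_concat_nth(1)[OF dist j], of "{a, b}"] ab j by (auto simp: writhe_word R)
qed

text \<open>Each transposition exchanges neighbours, hence passages of one component, so every
  component keeps its set of passages and only their order changes.\<close>

lemma writhe_reidemeister3:
  assumes D: "gauss_diagram D" and r: "reidemeister3 D D'" and j: "j < length D"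
  shows "writhe D' j = writhe D j"
proof -
  note dist = gauss_diagram_distinct[OF D]
  obtain p q v e f g \<delta> where
    B: "has_block D (if \<delta> * e * f * g = 1 then [(Over, p, e), (Over, q, f)] else [(Over, q, f), (Over, p, e)])"
      "has_block D (if \<delta> * e = 1 then [(Under, p, e), (Over, v, g)] else [(Over, v, g), (Under, p, e)])"
      "has_block D (if \<delta> * f = 1 then [(Under, q, f), (Under, v, g)] else [(Under, v, g), (Under, q, f)])"
    and D': "D' = map (map (transpose (Over, p, e) (Over, q, f) \<circ> transpose (Under, p, e) (Over, v, g) \<circ>
      transpose (Under, q, f) (Under, v, g))) D"
    using r unfolding reidemeister3_def Let_def by blast
  let ?t = "transpose (Over, p, e) (Over, q, f)"
  let ?m = "transpose (Under, p, e) (Over, v, g)"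
  let ?b = "transpose (Under, q, f) (Under, v, g)"
  have "transpose a b ` set (D ! j) = set (D ! j)" if "has_block D (if Q then [a, b] else [b, a])" for a b Q
    using that block_mem_iff[OF dist _ j, of a b] block_mem_iff[OF dist _ j, of b a]
    by (intro transpose_image_iff) (auto split: if_splits)
  note img = B[THEN this]
  have "set (D' ! j) = (?t \<circ> ?m \<circ> ?b) ` set (D ! j)" using j by (simp add: D' image_image)
  also have "\<dots> = set (D ! j)" by (simp only: image_comp[symmetric] img)
  finally have "set (D' ! j) = set (D ! j)" .
  moreover have "distinct (D' ! j)"
    using distinct_concat_nth(1)[OF dist j] j by (simp add: D' distinct_map inj_compose inj_on_subset[OF _ subset_UNIV])
  ultimately have "mset (D' ! j) = mset (D ! j)"
    using distinct_concat_nth(1)[OF dist j] set_eq_iff_mset_eq_distinct by blast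
  then show ?thesis unfolding writhe_word by (rule word_writhe_mset)
qed

context fibred_birack
begin

lemma similar_diagram_move:
  assumes "diagram_move D D'"
  shows "length D' = length D \<and> similar D (\<lambda>k. writhe D k - w k) D' (\<lambda>k. writhe D' k - w k)"
proof -
  have D: "gauss_diagram D" "gauss_diagram D'" using assms by (simp_all add: diagram_move_def)
  let ?s = "\<lambda>D. \<lambda>k. writhe D k - w k"
  have same: ?thesis if "length D' = length D" and s: "\<And>n. similar D n D' n" and wr: "\<And>k. k < length D \<Longrightarrow> writhe D' k = writhe D k"
  proof -
    have "similar D' (?s D) D' (?s D')" by (rule similar_twist_cong) (use that in auto)
    then show ?thesis using similar_trans[OF D(1) D(2) D(2) s] that(1) by blast
  qed
  consider (rot) k where "k < length D" "D' = D[k := rotate1 (D ! k)]"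
    | (ren) h where "inj h" "D' = map (map (\<lambda>(l, c, e). (l, h c, e))) D"
    | (r1) "reidemeister1 D D'" | (r2) "reidemeister2 D D'" | (r3) "reidemeister3 D D'"
    using assms unfolding diagram_move_def same_diagram_def by blast
  then show ?thesis
  proof cases
    case rot
    show ?thesis
    proof (rule same)
      show "length D' = length D" using rot by simp
      show "similar D n D' n" for n
      proof (cases "D ! k")
        case Nil
        then show ?thesis using rot similar_refl list_update_id[of D k] by simp
      next
        case (Cons m v)
        then show ?thesis using rot similar_rotate_one[OF D(1)] by simp
      qed
      show "writhe D' j = writhe D j" if "j < length D" for j
        unfolding writhe_word using rot that by (intro word_writhe_mset) (cases "j = k"; cases "D ! k"; simp)
    qed
  next
    case ren
    show ?thesis
    proof (rule same)
      show "length D' = length D" using ren by simp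
      show "similar D n D' n" for n by (rule similar_rename[OF D ren])
      show "writhe D' j = writhe D j" if "j < length D" for j
        using word_writhe_rename[OF ren(1)] that by (simp add: writhe_word ren(2))
    qed
  next
    case r1
    then obtain c e a b where del: "D = delete_crossings {c} D'" and B: "has_block D' [a, b]"
      and ab: "a = (Over, c, e) \<and> b = (Under, c, e) \<or> a = (Under, c, e) \<and> b = (Over, c, e)"
      unfolding reidemeister1_def by blast
    obtain k x y where k: "k < length D'" "D' ! k = x @ [a, b] @ y" using B by (rule has_blockE)
    have len: "length D' = length D" by (simp add: del delete_crossings_def)
    have 1: "similar D (?s D) D' ((?s D)(k := ?s D k + e))"
      by (rule similar_reidemeister1[OF D del k ab])
    have "similar D' ((?s D)(k := ?s D k + e)) D' (?s D')"
      using writhe_reidemeister1[OF D(2) k ab del] len by (intro similar_twist_cong) (auto simp: algebra_simps)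
    then show ?thesis using similar_trans[OF D(1) D(2) D(2) 1] len by blast
  next
    case r2
    then obtain c d e where r: "c \<noteq> d" "D = delete_crossings {c, d} D'"
      "has_block D' [(Over, c, e), (Over, d, - e)]"
      "has_block D' [(Under, c, e), (Under, d, - e)] \<or> has_block D' [(Under, d, - e), (Under, c, e)]"
      unfolding reidemeister2_def by blast
    have len: "length D' = length D" by (simp add: r(2) delete_crossings_def)
    show ?thesis
      by (rule same[OF len similar_reidemeister2[OF D r] writhe_reidemeister2[OF D(2) r]]) (simp add: len)
  next
    case r3
    have len: "length D' = length D" using r3 by (auto simp: reidemeister3_def Let_def)
    show ?thesis
      by (rule same[OF len similar_reidemeister3[OF D r3] writhe_reidemeister3[OF D(1) r3]])
  qed
qed

section \<open>Invariance under isotopy and renumbering of components\<close>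

lemma similar_isotopic:
  assumes "isotopic L D" "gauss_diagram L"
  shows "gauss_diagram D \<and> length D = length L \<and> similar L (\<lambda>k. writhe L k - w k) D (\<lambda>k. writhe D k - w k)"
  using assms(1) unfolding isotopic_def
proof (induction rule: equivclp_induct)
  case base
  show ?case using assms(2) similar_refl by simp
next
  case (step D E)
  then have g: "gauss_diagram D" "gauss_diagram E" by (auto simp: diagram_move_def)
  \<comment> \<open>The equivalence closure also runs moves backwards, which is where symmetry of
    \<open>similar\<close> enters.\<close>
  have "length E = length D \<and> similar D (\<lambda>k. writhe D k - w k) E (\<lambda>k. writhe E k - w k)"
    using step(2) similar_diagram_move similar_sym[OF g(2,1)] by metis
  then show ?case using step(3) similar_trans[OF assms(2) g] g by metis
qed

lemma similar_framed_diagram: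
  assumes L: "gauss_diagram L" and D: "framed_diagram N L w D"
  shows "gauss_diagram D \<and> similar L (\<lambda>k. writhe L k - int (w k)) D (\<lambda>_. 0)"
proof -
  have i: "isotopic L D" and wr: "\<And>k. k < length L \<Longrightarrow> [writhe D k = int (w k)] (mod int N)"
    using D by (auto simp: framed_diagram_def)
  have s: "gauss_diagram D" "length D = length L"
    "similar L (\<lambda>k. writhe L k - int (w k)) D (\<lambda>k. writhe D k - int (w k))"
    using similar_isotopic[OF i L, of "\<lambda>k. int (w k)"] by auto
  have "similar D (\<lambda>k. writhe D k - int (w k)) D (\<lambda>_. 0)"
  proof (rule similar_twist_cong)
    fix k assume "k < length D"
    then show "[writhe D k - int (w k) = 0] (mod int N)" using wr s(2) by (simp add: cong_diff_iff_cong_0)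
  qed
  then show ?thesis using similar_trans[OF L s(1) s(1) s(3)] s(1) by blast
qed

text \<open>The components are unnumbered, so a framing vector has to be permuted together with
  them. The bijection \<open>\<sigma>\<close> of framing vectors depends only on the permutation and
  not on the chosen framed diagrams.\<close>

lemma similar_ambient_isotopic:
  assumes L: "gauss_diagram L" and L': "gauss_diagram L'" and iso: "ambient_isotopic L L'"
  obtains \<sigma> where "bij_betw \<sigma> (framings N L) (framings N L')"
    and "\<And>w D D'. w \<in> framings N L \<Longrightarrow> framed_diagram N L w D \<Longrightarrow> framed_diagram N L' (\<sigma> w) D' \<Longrightarrow>
      gauss_diagram D \<and> gauss_diagram D' \<and> similar D (\<lambda>_. 0) D' (\<lambda>_. 0)"
proof -
  obtain E where E: "mset E = mset L" "isotopic E L'" using iso by (auto simp: ambient_isotopic_def)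
  obtain p where p: "p permutes {..<length L}" "permute_list p L = E" using mset_eq_permutation[OF E(1)] by blast
  have gE: "gauss_diagram E" using L gauss_diagram_cong[of E L] E(1) by (simp add: mset_concat flip: sum_mset_sum_list)
  have lenE: "length E = length L" using E(1) by (rule mset_eq_length)
  have len: "length L' = length L" using similar_isotopic[OF E(2) gE] lenE by auto
  let ?I = "{..<length L}"
  define \<sigma> where "\<sigma> w = (\<lambda>k\<in>?I. w (p k))" for w :: "nat \<Rightarrow> nat"
  have pI: "p k \<in> ?I \<longleftrightarrow> k \<in> ?I" for k using permutes_in_image[OF p(1)] .
  have "bij_betw \<sigma> (framings N L) (framings N L')"
  proof (rule bij_betw_byWitness[where f' = "\<lambda>w. \<lambda>k\<in>?I. w (inv_into UNIV p k)"])
    have qI: "inv_into UNIV p k \<in> ?I \<longleftrightarrow> k \<in> ?I" for k using permutes_in_image[OF permutes_inv[OF p(1)]] .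
    show "\<forall>w\<in>framings N L. (\<lambda>k\<in>?I. \<sigma> w (inv_into UNIV p k)) = w"
      using permutes_inverses[OF p(1)] qI by (auto simp: framings_def \<sigma>_def fun_eq_iff PiE_def extensional_def)
    show "\<forall>w\<in>framings N L'. \<sigma> (\<lambda>k\<in>?I. w (inv_into UNIV p k)) = w"
      using permutes_inverses[OF p(1)] pI by (auto simp: framings_def \<sigma>_def fun_eq_iff len PiE_def extensional_def)
    show "\<sigma> ` framings N L \<subseteq> framings N L'" using pI by (auto simp: framings_def \<sigma>_def len PiE_def Pi_def)
    show "(\<lambda>w. \<lambda>k\<in>?I. w (inv_into UNIV p k)) ` framings N L' \<subseteq> framings N L"
      using qI by (auto simp: framings_def len PiE_def Pi_def)
  qed
  moreover have "gauss_diagram D \<and> gauss_diagram D' \<and> similar D (\<lambda>_. 0) D' (\<lambda>_. 0)"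
    if D: "framed_diagram N L w D" and D': "framed_diagram N L' (\<sigma> w) D'" for w D D'
  proof -
    have d: "gauss_diagram D" "similar L (\<lambda>k. writhe L k - int (w k)) D (\<lambda>_. 0)"
      using similar_framed_diagram[OF L D] by auto
    have d': "gauss_diagram D'" "similar L' (\<lambda>k. writhe L' k - int (\<sigma> w k)) D' (\<lambda>_. 0)"
      using similar_framed_diagram[OF L' D'] by auto
    have 1: "similar L (\<lambda>k. writhe L k - int (w k)) E ((\<lambda>k. writhe L k - int (w k)) \<circ> p)"
      using similar_permute[OF L p(1)] p(2) by simp
    have 2: "similar E ((\<lambda>k. writhe L k - int (w k)) \<circ> p) E (\<lambda>k. writhe E k - int (\<sigma> w k))"
    proof (rule similar_twist_cong)
      fix k assume "k < length E"
      then have k: "k < length L" using lenE by simp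
      then have "E ! k = L ! p k" using p by (auto simp: permute_list_nth)
      then show "[((\<lambda>k. writhe L k - int (w k)) \<circ> p) k = writhe E k - int (\<sigma> w k)] (mod int N)"
        using k by (simp add: writhe_word \<sigma>_def)
    qed
    have 3: "similar E (\<lambda>k. writhe E k - int (\<sigma> w k)) L' (\<lambda>k. writhe L' k - int (\<sigma> w k))"
      using similar_isotopic[OF E(2) gE, of "\<lambda>k. int (\<sigma> w k)"] by blast
    \<comment> \<open>The comparison runs along \<open>D\<close>, \<open>L\<close>,
      \<open>E\<close>, \<open>L'\<close>, \<open>D'\<close>: unframe, permute the components, apply
      the isotopy, frame again. The twists are nonzero only in between.\<close>
    note t = similar_trans[OF d(1) L gE similar_sym[OF L d] 1]
    note t = similar_trans[OF d(1) gE gE t 2]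
    note t = similar_trans[OF d(1) gE L' t 3]
    show ?thesis using similar_trans[OF d(1) L' d'(1) t d'(2)] d d' by blast
  qed
  ultimately show ?thesis using that by blast
qed

end

section \<open>Labelings of semiarcs\<close>

lemma chain_nth:
  "w \<noteq> [] \<Longrightarrow> chain u a w b \<longleftrightarrow> u (In (w ! 0)) = a \<and>
    (\<forall>i<length w. u (Out (w ! i)) = (if Suc i = length w then b else u (In (w ! Suc i))))"
proof (induction w arbitrary: a)
  case (Cons m w)
  show ?case
  proof (cases "w = []")
    case False
    have *: "(\<forall>i<length (m # w). u (Out ((m # w) ! i)) = (if Suc i = length (m # w) then b else u (In ((m # w) ! Suc i))))
      \<longleftrightarrow> u (In (w ! 0)) = u (Out m) \<and> (\<forall>i<length w. u (Out (w ! i)) = (if Suc i = length w then b else u (In (w ! Suc i))))"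
      using False by (simp add: All_less_Suc2) (simp add: eq_commute)
    show ?thesis by (simp only: chain.simps Cons.IH[OF False] * nth_Cons_0)
  qed auto
qed simp

text \<open>Without a twist the label leaving a passage is the one entering its cyclic successor,
  which is what it means to label semiarcs.\<close>

lemma chain_cyclic:
  assumes "w \<noteq> []"
  shows "chain u (u (Base k)) w (u (Base k)) \<longleftrightarrow> u (In (w ! 0)) = u (Base k) \<and>
    (\<forall>i<length w. u (Out (w ! i)) = u (In (w ! (Suc i mod length w))))"
proof -
  have "(if Suc i = length w then u (Base k) else u (In (w ! Suc i))) = u (In (w ! (Suc i mod length w)))"
    if "i < length w" "u (In (w ! 0)) = u (Base k)" for i
    using that by (cases "Suc i = length w") auto
  then show ?thesis unfolding chain_nth[OF assms] by (intro conj_cong refl) simp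
qed

lemma semiarcs_iff:
  "(k, i) \<in> semiarcs D \<longleftrightarrow> k < length D \<and> (if D ! k = [] then i = 0 else i < length (D ! k))"
  by (cases "D ! k") (auto simp: semiarcs_def)

lemma leads_to_passages: "leads_to D p m \<Longrightarrow> m \<in> passages D"
  by (cases p) (auto simp: leads_to_def intro!: nth_passages[of "fst p"])

lemma leads_to_ex: "m \<in> passages D \<Longrightarrow> \<exists>p. leads_to D p m"
  unfolding leads_to_def passages_def by (force simp: in_set_conv_nth)

lemma leads_to_semiarcs:
  assumes "leads_to D p m"
  shows "p \<in> semiarcs D" "next_semiarc D p \<in> semiarcs D"
proof -
  obtain k i where p: "p = (k, i)" "k < length D" "i < length (D ! k)"
    using assms by (auto simp: leads_to_def split: prod.splits)
  then have "Suc i mod length (D ! k) < length (D ! k)" by (intro mod_less_divisor) auto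
  then show "p \<in> semiarcs D" "next_semiarc D p \<in> semiarcs D"
    using p by (auto simp: semiarcs_def next_semiarc_def)
qed

lemma leads_to_unique:
  assumes "distinct (concat D)" "leads_to D p m" "leads_to D q m"
  shows "p = q"
proof -
  obtain k i where p: "p = (k, i)" "k < length D" "i < length (D ! k)" "D ! k ! i = m"
    using assms(2) by (auto simp: leads_to_def split: prod.splits)
  obtain j l where q: "q = (j, l)" "j < length D" "l < length (D ! j)" "D ! j ! l = m"
    using assms(3) by (auto simp: leads_to_def split: prod.splits)
  have "m \<in> set (D ! k)" "m \<in> set (D ! j)" using nth_mem[OF p(3)] nth_mem[OF q(3)] p(4) q(4) by simp_all
  then have "j = k" using distinct_concat_nth(2)[OF assms(1) p(2) q(2)] by blast
  then show ?thesis using p q distinct_concat_nth(1)[OF assms(1) p(2)] nth_eq_iff_index_eq[of "D ! k" i l] by auto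
qed

lemma crossings_semiarcs:
  "(p, q, p', q') \<in> crossings D \<Longrightarrow> {p, q, p', q'} \<subseteq> semiarcs D"
  unfolding crossings_def using leads_to_semiarcs by auto

definition arc_label :: "gauss_code \<Rightarrow> (point \<Rightarrow> 'q) \<Rightarrow> semiarc \<Rightarrow> 'q"
  where "arc_label D u = (\<lambda>(k, i). if D ! k = [] then u (Base k) else u (In (D ! k ! i)))"

context fibred_birack
begin

definition arc_labelings :: "gauss_code \<Rightarrow> (semiarc \<Rightarrow> 'q) set"
  where "arc_labelings D = {v \<in> semiarcs D \<rightarrow>\<^sub>E A. \<forall>(p, q, p', q')\<in>crossings D. X (v p) (v q) (v p') (v q')}"

lemma arc_labelingsI:
  assumes "\<And>p. p \<in> semiarcs D \<Longrightarrow> v p \<in> A"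
    and "\<And>p q p' q'. (p, q, p', q') \<in> crossings D \<Longrightarrow> X (v p) (v q) (v p') (v q')"
  shows "restrict v (semiarcs D) \<in> arc_labelings D"
  unfolding arc_labelings_def using assms crossings_semiarcs[of _ _ _ _ D] by fastforce

lemma arc_labelingsD:
  assumes "v \<in> arc_labelings D"
  shows "p \<in> semiarcs D \<Longrightarrow> v p \<in> A" "(p, q, p', q') \<in> crossings D \<Longrightarrow> X (v p) (v q) (v p') (v q')"
  using assms unfolding arc_labelings_def by auto

lemma fibred_set_arc_labelings: "fibred_set (semiarcs D) (arc_labelings D)"
  unfolding fibred_set_def
proof (intro conjI ballI impI)
  show "arc_labelings D \<subseteq> extensional (semiarcs D)" by (auto simp: arc_labelings_def PiE_def)
next
  fix h u v assume h: "h \<in> H" and u: "u \<in> arc_labelings D" "v \<in> arc_labelings D"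
    and e: "\<forall>x\<in>semiarcs D. zz (u x) = zz (v x)"
  show "(\<lambda>x\<in>semiarcs D. h (u x) (v x)) \<in> arc_labelings D"
  proof (rule arc_labelingsI)
    fix p assume "p \<in> semiarcs D"
    then show "h (u p) (v p) \<in> A" using H_in[OF h] arc_labelingsD(1)[OF u(1)] arc_labelingsD(1)[OF u(2)] e by blast
  next
    fix p q p' q' assume c: "(p, q, p', q') \<in> crossings D"
    then have "{p, q, p', q'} \<subseteq> semiarcs D" by (rule crossings_semiarcs)
    then show "X (h (u p) (v p)) (h (u q) (v q)) (h (u p') (v p')) (h (u q') (v q'))"
      using arc_labelingsD(2)[OF u(1) c] arc_labelingsD(2)[OF u(2) c] e by (intro H_X[OF h]) auto
  qed
qed

lemma crossed_iff_crossings: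
  assumes D: "gauss_diagram D"
    and v: "\<And>p m. leads_to D p m \<Longrightarrow> u (In m) = v p \<and> u (Out m) = v (next_semiarc D p)"
  shows "crossed u (passages D) \<longleftrightarrow> (\<forall>(p, q, p', q')\<in>crossings D. X (v p) (v q) (v p') (v q'))"
proof
  assume c: "crossed u (passages D)"
  show "\<forall>(p, q, p', q')\<in>crossings D. X (v p) (v q) (v p') (v q')"
  proof clarify
    fix p q p' q' assume "(p, q, p', q') \<in> crossings D"
    then obtain x y c e where l: "leads_to D x (Over, c, e)" "leads_to D y (Under, c, e)"
      and e: "e = 1 \<and> (p, q, p', q') = (x, y, next_semiarc D y, next_semiarc D x) \<or>
        e = -1 \<and> (p, q, p', q') = (next_semiarc D x, next_semiarc D y, y, x)"
      unfolding crossings_def by blast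
    have "cross_at u c e"
      using c leads_to_passages[OF l(1)] unfolding crossed_def by blast
    then have "cross e (v x) (v y) (v (next_semiarc D x)) (v (next_semiarc D y))"
      using v[OF l(1)] v[OF l(2)] by simp
    then show "X (v p) (v q) (v p') (v q')" using e by (auto simp: cross_def)
  qed
next
  assume X: "\<forall>(p, q, p', q')\<in>crossings D. X (v p) (v q) (v p') (v q')"
  show "crossed u (passages D)"
    unfolding crossed_def
  proof (intro allI impI)
    fix c e assume o: "(Over, c, e) \<in> passages D"
    then obtain x y where l: "leads_to D x (Over, c, e)" "leads_to D y (Under, c, e)"
      using gauss_diagram_partner(1)[OF D o] leads_to_ex by metis
    have "e = 1 \<or> e = -1" by (rule gauss_diagram_partner(2)[OF D o])
    then show "cross_at u c e"
    proof
      assume e: "e = 1"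
      then have "(x, y, next_semiarc D y, next_semiarc D x) \<in> crossings D" using l unfolding crossings_def by blast
      then show ?thesis using X e v[OF l(1)] v[OF l(2)] by (auto simp: cross_def)
    next
      assume e: "e = -1"
      then have "(next_semiarc D x, next_semiarc D y, y, x) \<in> crossings D" using l unfolding crossings_def by blast
      then show ?thesis using X e v[OF l(1)] v[OF l(2)] by (auto simp: cross_def)
    qed
  qed
qed

lemma labels_arcs:
  assumes D: "gauss_diagram D" and u: "u \<in> labels D (\<lambda>_. 0)"
  shows "k < length D \<Longrightarrow> u (Base k) = arc_label D u (k, 0)"
    and "leads_to D p m \<Longrightarrow> u (In m) = arc_label D u p \<and> u (Out m) = arc_label D u (next_semiarc D p)"
proof -
  have ch: "chain u (u (Base k)) (D ! k) (u (Base k))" if "k < length D" for k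
    using u that by (simp add: labels_def closed_up_def)
  show "u (Base k) = arc_label D u (k, 0)" if "k < length D"
    using ch[OF that] chain_cyclic[of "D ! k" u k] by (auto simp: arc_label_def)
  show "u (In m) = arc_label D u p \<and> u (Out m) = arc_label D u (next_semiarc D p)" if l: "leads_to D p m"
  proof -
    obtain k i where p: "p = (k, i)" "k < length D" "i < length (D ! k)" "D ! k ! i = m"
      using l by (auto simp: leads_to_def split: prod.splits)
    then have "D ! k \<noteq> []" by auto
    then show ?thesis using ch[OF p(2)] chain_cyclic[of "D ! k" u k] p by (auto simp: arc_label_def next_semiarc_def)
  qed
qed

text \<open>In an untwisted coloring all labels are determined by those entering the passages,
  together with the base labels of components without crossings. Reading these off commutes with any
  pointwise operation.\<close>

lemma equivariant_bij_arc_label: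
  assumes D: "gauss_diagram D"
  shows "equivariant_bij (points D) (ext_labels D (\<lambda>_. 0)) (semiarcs D) (arc_labelings D)
    (\<lambda>u. restrict (arc_label D u) (semiarcs D))"
proof (rule equivariant_bijI)
  have el: "u \<in> labels D (\<lambda>_. 0)" if "u \<in> ext_labels D (\<lambda>_. 0)" for u using that by (simp add: ext_labels_def)
  have pt: "(D ! k = [] \<longrightarrow> Base k \<in> points D) \<and> (D ! k \<noteq> [] \<longrightarrow> In (D ! k ! i) \<in> points D)" if "(k, i) \<in> semiarcs D" for k i
  proof -
    have ki: "k < length D" "D ! k \<noteq> [] \<Longrightarrow> i < length (D ! k)" using that by (auto simp: semiarcs_iff)
    then show ?thesis using nth_passages[OF ki(1), of "D ! k ! i"] by auto
  qed
  show "restrict (arc_label D (\<lambda>x\<in>points D. h (u x) (v x))) (semiarcs D) p =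
      h (restrict (arc_label D u) (semiarcs D) p) (restrict (arc_label D v) (semiarcs D) p)"
    if "p \<in> semiarcs D" for h u v p
    using that pt[of "fst p" "snd p"] by (auto simp: arc_label_def split: prod.splits)
  show "bij_betw (\<lambda>u. restrict (arc_label D u) (semiarcs D)) (ext_labels D (\<lambda>_. 0)) (arc_labelings D)"
  proof (rule bij_betw_imageI)
    show "inj_on (\<lambda>u. restrict (arc_label D u) (semiarcs D)) (ext_labels D (\<lambda>_. 0))"
    proof (rule inj_onI)
      fix u v assume uv: "u \<in> ext_labels D (\<lambda>_. 0)" "v \<in> ext_labels D (\<lambda>_. 0)"
        and "restrict (arc_label D u) (semiarcs D) = restrict (arc_label D v) (semiarcs D)"
      then have e: "arc_label D u p = arc_label D v p" if "p \<in> semiarcs D" for p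
        using that restrict_eqD by metis
      show "u = v"
      proof (rule ext_labels_eqI[OF uv])
        fix x assume x: "x \<in> points D"
        note lu = labels_arcs[OF D el[OF uv(1)]] and lv = labels_arcs[OF D el[OF uv(2)]]
        show "u x = v x"
        proof (cases x)
          case (Base k)
          then have "k < length D" "(k, 0) \<in> semiarcs D" using x by (auto simp: semiarcs_def)
          then show ?thesis using lu(1) lv(1) e Base by simp
        next
          case (In m)
          then obtain p where p: "leads_to D p m" using x leads_to_ex[of m D] by auto
          show ?thesis using lu(2)[OF p] lv(2)[OF p] e[OF leads_to_semiarcs(1)[OF p]] In by simp
        next
          case (Out m)
          then obtain p where p: "leads_to D p m" using x leads_to_ex[of m D] by auto
          show ?thesis using lu(2)[OF p] lv(2)[OF p] e[OF leads_to_semiarcs(2)[OF p]] Out by simp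
        qed
      qed
    qed
    show "(\<lambda>u. restrict (arc_label D u) (semiarcs D)) ` ext_labels D (\<lambda>_. 0) = arc_labelings D"
    proof (intro subset_antisym image_subsetI subsetI)
      fix u assume "u \<in> ext_labels D (\<lambda>_. 0)"
      then have u: "u \<in> labels D (\<lambda>_. 0)" by (rule el)
      show "restrict (arc_label D u) (semiarcs D) \<in> arc_labelings D"
      proof (rule arc_labelingsI)
        fix p assume "p \<in> semiarcs D"
        then show "arc_label D u p \<in> A"
          using pt[of "fst p" "snd p"] labels_in[OF u] by (auto simp: arc_label_def split: prod.splits)
      next
        fix p q p' q' assume "(p, q, p', q') \<in> crossings D"
        then show "X (arc_label D u p) (arc_label D u q) (arc_label D u p') (arc_label D u q')"
          using crossed_iff_crossings[OF D, of u "arc_label D u"] labels_arcs(2)[OF D u] u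
          by (auto simp: labels_def)
      qed
    next
      fix v assume v: "v \<in> arc_labelings D"
      \<comment> \<open>Recovers the semiarc leading to a passage; it is unique because no passage
        occurs twice.\<close>
      define pos where "pos m = (SOME p. leads_to D p m)" for m
      have pos: "pos m = p" if "leads_to D p m" for p m
        using leads_to_unique[OF gauss_diagram_distinct[OF D] someI[of "\<lambda>p. leads_to D p m", OF that] that]
        unfolding pos_def .
      define u where "u x = (case x of Base k \<Rightarrow> v (k, 0) | In m \<Rightarrow> v (pos m) | Out m \<Rightarrow> v (next_semiarc D (pos m)))" for x
      have uv: "u (In m) = v p \<and> u (Out m) = v (next_semiarc D p)" if "leads_to D p m" for p m
        using pos[OF that] by (simp add: u_def)
      have uB: "u (Base k) = v (k, 0)" for k by (simp add: u_def)
      have "closed_up u D (\<lambda>_. 0)"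
        unfolding closed_up_def
      proof (intro allI impI)
        fix k assume k: "k < length D"
        show "chain u (u (Base k)) (D ! k) (twist 0 (u (Base k)))"
        proof (cases "D ! k = []")
          case False
          have l: "leads_to D (k, i) (D ! k ! i)" if "i < length (D ! k)" for i
            using that k by (simp add: leads_to_def)
          have "u (Out (D ! k ! i)) = u (In (D ! k ! (Suc i mod length (D ! k))))" if i: "i < length (D ! k)" for i
          proof -
            have "Suc i mod length (D ! k) < length (D ! k)" using i by (intro mod_less_divisor) auto
            then show ?thesis using uv[OF l[OF i]] uv[OF l[of "Suc i mod length (D ! k)"]] by (simp add: next_semiarc_def)
          qed
          moreover have "u (In (D ! k ! 0)) = u (Base k)" using uv[OF l[of 0]] uB False by simp
          ultimately show ?thesis using chain_cyclic[OF False, of u k] by simp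
        qed simp
      qed
      moreover have "crossed u (passages D)"
        using crossed_iff_crossings[OF D, of u v] uv v by (auto simp: arc_labelings_def)
      moreover have "u x \<in> A" if x: "x \<in> points D" for x
      proof (cases x)
        case (Base k)
        then have "(k, 0) \<in> semiarcs D" using x by (auto simp: semiarcs_def)
        then show ?thesis using arc_labelingsD(1)[OF v] Base uB by simp
      next
        case (In m)
        then obtain p where p: "leads_to D p m" using x leads_to_ex[of m D] by auto
        show ?thesis using uv[OF p] leads_to_semiarcs(1)[OF p] In arc_labelingsD(1)[OF v] by simp
      next
        case (Out m)
        then obtain p where p: "leads_to D p m" using x leads_to_ex[of m D] by auto
        show ?thesis using uv[OF p] leads_to_semiarcs(2)[OF p] Out arc_labelingsD(1)[OF v] by simp
      qed
      ultimately have "u \<in> labels D (\<lambda>_. 0)" by (simp add: labels_def)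
      then have ul: "restrict u (points D) \<in> ext_labels D (\<lambda>_. 0)" using D by (simp add: ext_labels_def labels_restrict)
      have "restrict (arc_label D (restrict u (points D))) (semiarcs D) = v"
      proof (rule extensionalityI[of _ "semiarcs D"])
        show "v \<in> extensional (semiarcs D)" using v by (simp add: arc_labelings_def PiE_def)
        fix p assume p: "p \<in> semiarcs D"
        obtain k i where ki: "p = (k, i)" by (cases p)
        have k: "k < length D" "D ! k = [] \<Longrightarrow> i = 0" "D ! k \<noteq> [] \<Longrightarrow> i < length (D ! k)" using p ki by (auto simp: semiarcs_iff)
        have "D ! k \<noteq> [] \<Longrightarrow> leads_to D p (D ! k ! i)" using k ki by (simp add: leads_to_def)
        then show "restrict (arc_label D (restrict u (points D))) (semiarcs D) p = v p"
          using p pt[of k i] ki k uv[of p "D ! k ! i"] uB by (auto simp: arc_label_def)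
      qed simp
      then show "v \<in> (\<lambda>u. restrict (arc_label D u) (semiarcs D)) ` ext_labels D (\<lambda>_. 0)" using ul by blast
    qed
  qed
qed

lemma similar_arc_labelings:
  assumes D: "gauss_diagram D" "gauss_diagram D'" and s: "similar D (\<lambda>_. 0) D' (\<lambda>_. 0)"
  shows "\<exists>\<Psi>. equivariant_bij (semiarcs D) (arc_labelings D) (semiarcs D') (arc_labelings D') \<Psi>"
proof -
  obtain \<Phi> where \<Phi>: "equivariant_bij (points D) (ext_labels D (\<lambda>_. 0)) (points D') (ext_labels D' (\<lambda>_. 0)) \<Phi>"
    using s unfolding similar_def by blast
  note f = fibred_set_ext_labels[OF D(1)] fibred_set_ext_labels[OF D(2)] fibred_set_arc_labelings
  have "equivariant_bij (semiarcs D) (arc_labelings D) (points D) (ext_labels D (\<lambda>_. 0))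
      (inv_into (ext_labels D (\<lambda>_. 0)) (\<lambda>u. restrict (arc_label D u) (semiarcs D)))"
    by (rule equivariant_bij_inv[OF f(1,3) equivariant_bij_arc_label[OF D(1)]])
  from equivariant_bij_comp[OF f(3,2) equivariant_bij_comp[OF f(3,1) this \<Phi>] equivariant_bij_arc_label[OF D(2)]]
  show ?thesis by blast
qed

end

section \<open>Labels with beads\<close>

locale finite_birack =
  fixes B :: "'x::finite \<times> 'x \<Rightarrow> 'x \<times> 'x"
  assumes birack: "birack B"
begin

abbreviation up :: "'x \<Rightarrow> 'x \<Rightarrow> 'x" where "up \<equiv> birack_up B"
abbreviation down :: "'x \<Rightarrow> 'x \<Rightarrow> 'x" where "down \<equiv> birack_down B"

lemma B_eq: "B (x, y) = (up x y, down x y)"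
  by (simp add: birack_up_def birack_down_def)

lemma sideways_B: "bij (sideways B)" "sideways B (up x y, x) = (down x y, y)"
proof -
  have "\<exists>!S. is_sideways B S" using birack by (simp add: birack_def)
  then have "is_sideways B (sideways B)" unfolding sideways_def by (rule theI')
  then show "bij (sideways B)" "sideways B (up x y, x) = (down x y, y)"
    unfolding is_sideways_def by simp_all
qed

text \<open>
  The sideways map only constrains \<open>S\<close> on the pairs \<open>(up x y, x)\<close>, but these are all pairs: the
  map \<open>(x, y) \<mapsto> (up x y, x)\<close> is injective since \<open>S\<close> recovers \<open>y\<close>, and \<open>X\<close> is finite.
\<close>

lemma bij_up: "bij (\<lambda>(x, y). (up x y, x))"
proof -
  have inj: "inj (\<lambda>(x, y). (up x y, x))"
  proof (rule injI)
    fix p q :: "'x \<times> 'x" assume e: "(case p of (x, y) \<Rightarrow> (up x y, x)) = (case q of (x, y) \<Rightarrow> (up x y, x))"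
    obtain x y x' y' where p: "p = (x, y)" "q = (x', y')" by (cases p, cases q) blast
    have "(up x y, x) = (up x' y', x')" using e unfolding p prod.case .
    then have "(down x y, y) = (down x' y', y')" by (metis sideways_B(2))
    then show "p = q" using e unfolding p prod.case prod.inject by blast
  qed
  show ?thesis by (rule bijI[OF inj finite_UNIV_inj_surj[OF finite inj]])
qed

lemma bij_down: "bij (\<lambda>(x, y). (down x y, y))"
proof -
  have "(\<lambda>(x, y). (down x y, y)) = sideways B \<circ> (\<lambda>(x, y). (up x y, x))"
    by (auto simp: sideways_B(2))
  then show ?thesis using bij_comp[OF bij_up sideways_B(1)] by simp
qed

lemma up_ex1: "\<exists>!y. up x y = z"
proof -
  obtain x' y where "(z, x) = (up x' y, x')" using bij_up[THEN bij_is_surj, THEN surjD, of "(z, x)"] by auto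
  moreover have "y = y'" if "up x y = up x y'" for y y'
    using bij_up[THEN bij_is_inj, THEN injD, of "(x, y)" "(x, y')"] that by simp
  ultimately show ?thesis by auto
qed

lemma down_ex1: "\<exists>!x. down x y = w"
proof -
  obtain x y' where "(w, y) = (down x y', y')" using bij_down[THEN bij_is_surj, THEN surjD, of "(w, y)"] by auto
  moreover have "x = x'" if "down x y = down x' y" for x x'
    using bij_down[THEN bij_is_inj, THEN injD, of "(x, y)" "(x', y)"] that by simp
  ultimately show ?thesis by auto
qed

lemma B_ex1: "\<exists>!p. up (fst p) (snd p) = z \<and> down (fst p) (snd p) = w"
proof -
  have "bij B" using birack by (simp add: birack_def)
  then have "\<exists>!p. B p = (z, w)" using bij_pointE by metis
  then show ?thesis using B_eq by (metis prod.collapse prod.inject)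
qed

lemma up_inj: "up x y = up x y' \<Longrightarrow> y = y'"
  using up_ex1 by blast

lemma down_inj: "down x y = down x' y \<Longrightarrow> x = x'"
  using down_ex1 by blast

lemma B_inj: "up x y = up x' y' \<Longrightarrow> down x y = down x' y' \<Longrightarrow> x = x' \<and> y = y'"
  using B_ex1[of "up x y" "down x y"] by (metis fst_conv snd_conv)

section \<open>The kink maps and the rank of the label birack\<close>

lemma inv_sideways: "inv_into UNIV (sideways B) (down x y, y) = (up x y, x)"
  using sideways_B by (metis bij_inv_eq_iff)

text \<open>The inverse sideways map sends \<open>(y, y)\<close> to \<open>(up x y, x)\<close> for
  the unique \<open>x\<close> with \<open>down x y = y\<close>. So \<open>kink_alpha B x\<close> is
  the label of the loop of the kink on \<open>x\<close>, and \<open>kink_pi B x\<close> the label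
  with which the strand leaves it.\<close>

lemma kink_alpha_iff: "kink_alpha B x = y \<longleftrightarrow> down x y = y"
proof -
  let ?f = "snd \<circ> inv_into UNIV (sideways B) \<circ> diag"
  have b: "bij ?f" using birack by (simp add: birack_def)
  have "?f y = x \<longleftrightarrow> down x y = y"
  proof -
    obtain x' where x': "down x' y = y" using down_ex1 by blast
    then have "?f y = x'" using inv_sideways[of x' y] by (simp add: diag_def)
    then show ?thesis using x' down_ex1[of y y] by auto
  qed
  then show ?thesis unfolding kink_alpha_def using b by (metis bij_inv_eq_iff)
qed

lemma down_kink_alpha: "down x (kink_alpha B x) = kink_alpha B x"
  using kink_alpha_iff by blast

lemma kink_pi_eq: "kink_pi B x = up x (kink_alpha B x)"
  using inv_sideways[of x "kink_alpha B x"] by (simp add: kink_pi_def diag_def down_kink_alpha)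

lemma bij_kink_pi: "bij (kink_pi B)"
proof -
  have b: "bij (fst \<circ> inv_into UNIV (sideways B) \<circ> diag)" "bij (snd \<circ> inv_into UNIV (sideways B) \<circ> diag)"
    using birack by (simp_all add: birack_def)
  have "bij (kink_alpha B)" unfolding kink_alpha_def by (rule bij_imp_bij_inv[OF b(2)])
  then show ?thesis unfolding kink_pi_def by (rule bij_comp[OF _ b(1)])
qed

text \<open>The kink map is a permutation of a finite set, hence of finite order; without this the
  \<open>LEAST\<close> in the definition would say nothing.\<close>

lemma birack_rank: "0 < birack_rank B" "(kink_pi B ^^ birack_rank B) x = x"
proof -
  have "permutation (kink_pi B)" using bij_kink_pi by (simp add: permutation)
  then obtain n where "kink_pi B ^^ n = id" "0 < n" using permutation_is_nilpotent by blast
  then have "\<exists>N. 0 < N \<and> (\<forall>x. (kink_pi B ^^ N) x = x)" by (intro exI[of _ n]) auto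
  then have "0 < birack_rank B \<and> (\<forall>x. (kink_pi B ^^ birack_rank B) x = x)"
    unfolding birack_rank_def by (rule LeastI_ex)
  then show "0 < birack_rank B" "(kink_pi B ^^ birack_rank B) x = x" by auto
qed

lemma yang_baxter_labels:
  "up (up x y) (up (down x y) z) = up x (up y z)"
  "down (up x y) (up (down x y) z) = up (down x (up y z)) (down y z)"
  "down (down x y) z = down (down x (up y z)) (down y z)"
proof -
  have "act_left B (act_right B (act_left B (x, y, z))) = act_right B (act_left B (act_right B (x, y, z)))"
    using birack unfolding birack_def by (metis o_apply)
  then show "up (up x y) (up (down x y) z) = up x (up y z)"
    "down (up x y) (up (down x y) z) = up (down x (up y z)) (down y z)"
    "down (down x y) z = down (down x (up y z)) (down y z)"
    by (simp_all add: act_left_def act_right_def B_eq)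
qed

end

locale finite_birack_module = finite_birack B + Module.module K R
  for B :: "'x::finite \<times> 'x \<Rightarrow> 'x \<times> 'x" and K :: "('k, 'a) ring_scheme" and R :: "('k, 'm, 'b) module_scheme" +
  fixes t s r :: "'x \<Rightarrow> 'x \<Rightarrow> 'm \<Rightarrow> 'm"
  assumes birack_module: "birack_module B K R t s r"
begin

abbreviation plus (infixl "\<boxplus>" 65) where "a \<boxplus> b \<equiv> a \<oplus>\<^bsub>R\<^esub> b"
abbreviation M where "M \<equiv> carrier R"

lemma endo: "module_endo K R (t x y)" "module_endo K R (s x y)" "module_endo K R (r x y)"
  and auto_bij: "bij_betw (t x y) M M" "bij_betw (r x y) M M"
  using birack_module unfolding birack_module_def module_auto_def by blast+

lemma endoD:
  assumes "module_endo K R h"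
  shows "a \<in> M \<Longrightarrow> h a \<in> M" "a \<in> M \<Longrightarrow> b \<in> M \<Longrightarrow> h (a \<boxplus> b) = h a \<boxplus> h b"
    "k \<in> carrier K \<Longrightarrow> a \<in> M \<Longrightarrow> h (k \<odot>\<^bsub>R\<^esub> a) = k \<odot>\<^bsub>R\<^esub> h a" "h \<zero>\<^bsub>R\<^esub> = \<zero>\<^bsub>R\<^esub>"
proof -
  show in_M: "a \<in> M \<Longrightarrow> h a \<in> M" for a using assms by (auto simp: module_endo_def)
  show "a \<in> M \<Longrightarrow> b \<in> M \<Longrightarrow> h (a \<boxplus> b) = h a \<boxplus> h b" using assms by (simp add: module_endo_def)
  show sm: "k \<in> carrier K \<Longrightarrow> a \<in> M \<Longrightarrow> h (k \<odot>\<^bsub>R\<^esub> a) = k \<odot>\<^bsub>R\<^esub> h a" for k a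
    using assms by (simp add: module_endo_def)
  show "h \<zero>\<^bsub>R\<^esub> = \<zero>\<^bsub>R\<^esub>"
    using sm[OF R.zero_closed M.zero_closed] smult_l_null[OF M.zero_closed] smult_l_null[OF in_M[OF M.zero_closed]] by simp
qed

lemmas endo_closed [simp] = endo[THEN endoD(1)]
lemmas endo_add = endo[THEN endoD(2)]
lemmas endo_smult = endo[THEN endoD(3)]
lemmas endo_zero [simp] = endo[THEN endoD(4)]

lemma bead_relations:
  assumes "a \<in> M"
  shows "r (down x y) z (r x y a) = r (down x (up y z)) (down y z) (r x (up y z) a)"
    "t (down x (up y z)) (down y z) (r y z a) = r (up x y) (up (down x y) z) (t x y a)"
    "s (down x (up y z)) (down y z) (r x (up y z) a) = r (up x y) (up (down x y) z) (s x y a)"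
    "t x (up y z) (t y z a) = t (up x y) (up (down x y) z) (t (down x y) z a)"
    "t x (up y z) (s y z a) = s (up x y) (up (down x y) z) (t x y a)"
    "s x (up y z) a = t (up x y) (up (down x y) z) (s (down x y) z (r x y a)) \<boxplus>
      s (up x y) (up (down x y) z) (s x y a)"
  using birack_module assms unfolding birack_module_def Let_def by blast+

text \<open>The bead leaving an over-under kink: the loop carries \<open>r\<close> of the entering
  bead, and the under-passage forms \<open>t\<close> of it plus \<open>s\<close> of the entering
  bead. These are the factors of the last relation of the birack algebra.\<close>

definition kink_bead :: "'x \<Rightarrow> 'm \<Rightarrow> 'm"
  where "kink_bead x a = t x (kink_alpha B x) (r x (kink_alpha B x) a) \<boxplus> s x (kink_alpha B x) a"

lemma kink_bead_product:
  "a \<in> M \<Longrightarrow> fold (\<lambda>k. kink_bead ((kink_pi B ^^ k) x)) [0..<birack_rank B] a = a"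
  using birack_module unfolding birack_module_def Let_def kink_bead_def by blast

definition labeled_kink :: "'x \<times> 'm \<Rightarrow> 'x \<times> 'm"
  where "labeled_kink p = (kink_pi B (fst p), kink_bead (fst p) (snd p))"

lemma labeled_kink_funpow:
  "(labeled_kink ^^ n) (x, a) = ((kink_pi B ^^ n) x, fold (\<lambda>k. kink_bead ((kink_pi B ^^ k) x)) [0..<n] a)"
  by (induction n) (simp_all add: labeled_kink_def)

text \<open>On labels this is the definition of the rank; on beads it is the last relation of the
  birack algebra.\<close>

lemma labeled_kink_period: "p \<in> UNIV \<times> M \<Longrightarrow> (labeled_kink ^^ birack_rank B) p = p"
  by (cases p) (simp add: labeled_kink_funpow kink_bead_product birack_rank(2))

lemma labeled_kink_in: "p \<in> UNIV \<times> M \<Longrightarrow> labeled_kink p \<in> UNIV \<times> M"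
  by (auto simp: labeled_kink_def kink_bead_def)

text \<open>\<open>R\<close> may be infinite, so surjectivity does not come from counting but from
  the period: the iterate one short of the rank is an inverse. The same iterate gives injectivity
  below.\<close>

lemma labeled_kink_pred: "p \<in> UNIV \<times> M \<Longrightarrow> \<exists>q\<in>UNIV \<times> M. labeled_kink q = p"
proof -
  assume p: "p \<in> UNIV \<times> M"
  obtain n where n: "birack_rank B = Suc n" using birack_rank(1) gr0_implies_Suc by blast
  have "(labeled_kink ^^ k) p \<in> UNIV \<times> M" for k
    by (induction k) (use p labeled_kink_in in auto)
  then show ?thesis using labeled_kink_period[OF p] unfolding n by (intro bexI[of _ "(labeled_kink ^^ n) p"]) simp_all
qed

lemma labeled_kink_inj:
  assumes "p \<in> UNIV \<times> M" "q \<in> UNIV \<times> M" "labeled_kink p = labeled_kink q"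
  shows "p = q"
proof -
  obtain n where n: "birack_rank B = Suc n" using birack_rank(1) gr0_implies_Suc by blast
  have "p = (labeled_kink ^^ n) (labeled_kink p)" using labeled_kink_period[OF assms(1)] by (simp add: n funpow_swap1)
  also have "\<dots> = q" using labeled_kink_period[OF assms(2)] assms(3) by (simp add: n funpow_swap1)
  finally show ?thesis .
qed

text \<open>
  Labels and beads together are colorings by \<open>X \<times> R\<close>: the relations of the birack algebra say
  that this is a birack again.
\<close>

definition bead_crossing :: "'x \<times> 'm \<Rightarrow> 'x \<times> 'm \<Rightarrow> 'x \<times> 'm \<Rightarrow> 'x \<times> 'm \<Rightarrow> bool"
  where "bead_crossing p q p' q' \<longleftrightarrow> snd p \<in> M \<and> snd q \<in> M \<and>
    p' = (up (fst p) (fst q), s (fst p) (fst q) (snd p) \<boxplus> t (fst p) (fst q) (snd q)) \<and>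
    q' = (down (fst p) (fst q), r (fst p) (fst q) (snd p))"

lemma bead_crossing_iff:
  "bead_crossing (x, a) (y, b) (z, c) (w, d) \<longleftrightarrow> a \<in> M \<and> b \<in> M \<and> z = up x y \<and> w = down x y \<and>
    c = s x y a \<boxplus> t x y b \<and> d = r x y a"
  by (auto simp: bead_crossing_def)

lemma bead_crossing_kink:
  assumes "a \<in> M"
  shows "bead_crossing (x, a) (y, b) (z, c) (y, b) \<longleftrightarrow>
    y = kink_alpha B x \<and> b = r x y a \<and> (z, c) = labeled_kink (x, a)"
proof -
  have "s x y a \<boxplus> t x y (r x y a) = t x y (r x y a) \<boxplus> s x y a" for y
    using assms by (intro M.a_comm) simp_all
  then show ?thesis
    using assms kink_alpha_iff[of x y]
    by (auto simp: bead_crossing_iff labeled_kink_def kink_bead_def kink_pi_eq)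
qed

lemma labeled_kink_crossing:
  assumes "a \<in> M"
  shows "bead_crossing (x, a) (kink_alpha B x, r x (kink_alpha B x) a) (labeled_kink (x, a))
    (kink_alpha B x, r x (kink_alpha B x) a)"
  using bead_crossing_kink[OF assms, of x _ _ "fst (labeled_kink (x, a))" "snd (labeled_kink (x, a))"] by simp

lemma t_pred: "a \<in> M \<Longrightarrow> \<exists>b\<in>M. t x y b = a" and r_pred: "a \<in> M \<Longrightarrow> \<exists>b\<in>M. r x y b = a"
  using auto_bij[of x y] unfolding bij_betw_def by (metis imageE)+

lemma t_inj: "a \<in> M \<Longrightarrow> b \<in> M \<Longrightarrow> t x y a = t x y b \<Longrightarrow> a = b"
  and r_inj: "a \<in> M \<Longrightarrow> b \<in> M \<Longrightarrow> r x y a = r x y b \<Longrightarrow> a = b"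
  using auto_bij[of x y] unfolding bij_betw_def inj_on_def by blast+

lemma bead_under:
  assumes "a \<in> M" "c \<in> M"
  shows "\<exists>b\<in>M. c = s x y a \<boxplus> t x y b"
proof -
  obtain b where b: "b \<in> M" "t x y b = c \<ominus>\<^bsub>R\<^esub> s x y a" using t_pred[of "c \<ominus>\<^bsub>R\<^esub> s x y a" x y] assms by auto
  have "s x y a \<boxplus> (c \<ominus>\<^bsub>R\<^esub> s x y a) = c"
    using assms by (simp add: a_minus_def M.a_lcomm M.r_neg)
  then show ?thesis using b by (intro bexI[of _ b]) simp_all
qed

sublocale labeled: birack_rel "UNIV \<times> M" bead_crossing
proof (unfold_locales, goal_cases)
  case (1 p q p' q')
  then show ?case by (auto simp: bead_crossing_def mem_Times_iff)
next
  case (2 p q)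
  then show ?case by (auto simp: bead_crossing_def)
next
  case (3 p' q')
  obtain z c w d where p: "p' = (z, c)" "q' = (w, d)" "c \<in> M" "d \<in> M" using 3 by auto
  obtain x y where xy: "up x y = z" "down x y = w" using B_ex1[of z w] by auto
  obtain a where a: "a \<in> M" "r x y a = d" using r_pred p by blast
  obtain b where "b \<in> M" "c = s x y a \<boxplus> t x y b" using bead_under a p by blast
  then have "bead_crossing (x, a) (y, b) p' q'" using a p xy by (simp add: bead_crossing_iff)
  then show ?case by blast
next
  case (4 p p')
  obtain x a z c where p: "p = (x, a)" "p' = (z, c)" "a \<in> M" "c \<in> M" using 4 by auto
  obtain y where y: "up x y = z" using up_ex1 by blast
  obtain b where "b \<in> M" "c = s x y a \<boxplus> t x y b" using bead_under p by blast
  then have "bead_crossing p (y, b) p' (down x y, r x y a)" using p y by (simp add: bead_crossing_iff)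
  then show ?case by blast
next
  case (5 q q')
  obtain y b w d where p: "q = (y, b)" "q' = (w, d)" "b \<in> M" "d \<in> M" using 5 by auto
  obtain x where x: "down x y = w" using down_ex1 by blast
  obtain a where "a \<in> M" "r x y a = d" using r_pred p by blast
  then have "bead_crossing (x, a) q (up x y, s x y a \<boxplus> t x y b) q'" using p x by (simp add: bead_crossing_iff)
  then show ?case by blast
next
  case (6 p q p' q' p2 q2)
  then show ?case by (simp add: bead_crossing_def)
next
  case (7 p q p' q' p2 q2)
  obtain x a y b x2 a2 y2 b2 where p: "p = (x, a)" "q = (y, b)" "p2 = (x2, a2)" "q2 = (y2, b2)"
    by (metis surj_pair)
  have M: "a \<in> M" "b \<in> M" "a2 \<in> M" "b2 \<in> M" using 7 unfolding p by (simp_all add: bead_crossing_def)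
  have "up x y = up x2 y2" "down x y = down x2 y2" using 7 unfolding p by (simp_all add: bead_crossing_def)
  then have xy: "x2 = x" "y2 = y" using B_inj by metis+
  have "r x y a = r x y a2" using 7 unfolding p xy by (simp add: bead_crossing_def)
  then have a: "a2 = a" using r_inj M by metis
  have "s x y a \<boxplus> t x y b = s x y a \<boxplus> t x y b2" using 7 unfolding p xy a by (simp add: bead_crossing_def)
  then have "t x y b = t x y b2" using M by simp
  then have "b2 = b" using t_inj M by metis
  then show ?case by (simp add: p xy a)
next
  case (8 p q p' q' q2 q2')
  obtain x a y b y2 b2 where p: "p = (x, a)" "q = (y, b)" "q2 = (y2, b2)" by (metis surj_pair)
  have M: "a \<in> M" "b \<in> M" "b2 \<in> M" using 8 unfolding p by (simp_all add: bead_crossing_def)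
  have "up x y = up x y2" using 8 unfolding p by (simp add: bead_crossing_def)
  then have y: "y2 = y" using up_inj by metis
  have "s x y a \<boxplus> t x y b = s x y a \<boxplus> t x y b2" using 8 unfolding p y by (simp add: bead_crossing_def)
  then have "t x y b = t x y b2" using M by simp
  then have "b2 = b" using t_inj M by metis
  then show ?case using 8 unfolding p y by (simp add: bead_crossing_def)
next
  case (9 p q p' q' p2 p2')
  obtain x a y b x2 a2 where p: "p = (x, a)" "q = (y, b)" "p2 = (x2, a2)" by (metis surj_pair)
  have M: "a \<in> M" "b \<in> M" "a2 \<in> M" using 9 unfolding p by (simp_all add: bead_crossing_def)
  have "down x y = down x2 y" using 9 unfolding p by (simp add: bead_crossing_def)
  then have x: "x2 = x" using down_inj by metis
  have "r x y a = r x y a2" using 9 unfolding p x by (simp add: bead_crossing_def)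
  then have "a2 = a" using r_inj M by metis
  then show ?case using 9 unfolding p x by (simp add: bead_crossing_def)
next
  case (10 p q y1 x1 v z1 x2 z2 y2 c d c' x' d' x'')
  obtain x a y b z e where p: "p = (x, a)" "q = (y, b)" "v = (z, e)" by (metis surj_pair)
  note X = 10[unfolded bead_crossing_def]
  have M: "a \<in> M" "b \<in> M" "e \<in> M" using X(1,2) unfolding p by simp_all
  have 1: "y1 = (up x y, s x y a \<boxplus> t x y b)" "x1 = (down x y, r x y a)"
    using X(1) unfolding p by simp_all
  have 2: "z1 = (up (down x y) z, s (down x y) z (r x y a) \<boxplus> t (down x y) z e)"
    "x2 = (down (down x y) z, r (down x y) z (r x y a))"
    using X(2) unfolding p 1 by simp_all
  have 3: "c = (up y z, s y z b \<boxplus> t y z e)" "d = (down y z, r y z b)"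
    using X(4) unfolding p by simp_all
  have 4: "c' = (up x (up y z), s x (up y z) a \<boxplus> t x (up y z) (s y z b \<boxplus> t y z e))"
    "x' = (down x (up y z), r x (up y z) a)"
    using X(5) unfolding p 3 by simp_all
  let ?u = "up x y" and ?v = "up (down x y) z"
  \<comment> \<open>Yang-Baxter for beads compares coefficients: \<open>bead_relations(4)\<close> to
    \<open>bead_relations(6)\<close> match the beads leaving the bottom strand,
    \<open>bead_relations(2)\<close> and \<open>bead_relations(3)\<close> those of the middle
    strand, \<open>bead_relations(1)\<close> those of the top strand.\<close>
  have "t x (up y z) (s y z b \<boxplus> t y z e) = s ?u ?v (t x y b) \<boxplus> t ?u ?v (t (down x y) z e)"
    using M bead_relations(4)[of e x y z] bead_relations(5)[of b x y z] by (simp add: endo_add)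
  moreover have "s ?u ?v (s x y a \<boxplus> t x y b) \<boxplus> t ?u ?v (s (down x y) z (r x y a) \<boxplus> t (down x y) z e) =
      s x (up y z) a \<boxplus> (s ?u ?v (t x y b) \<boxplus> t ?u ?v (t (down x y) z e))"
    using M unfolding bead_relations(6)[OF M(1), of x y z] by (simp add: endo_add M.a_ac)
  moreover have "z2 = (up ?u ?v, s ?u ?v (s x y a \<boxplus> t x y b) \<boxplus> t ?u ?v (s (down x y) z (r x y a) \<boxplus> t (down x y) z e))"
    "y2 = (down ?u ?v, r ?u ?v (s x y a \<boxplus> t x y b))"
    using X(3) unfolding 1 2 fst_conv snd_conv by blast+
  ultimately have "c' = z2" unfolding 4 by (simp only: yang_baxter_labels(1)[of x y z])
  moreover have "r ?u ?v (s x y a \<boxplus> t x y b) =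
      s (down x (up y z)) (down y z) (r x (up y z) a) \<boxplus> t (down x (up y z)) (down y z) (r y z b)"
    using M bead_relations(2)[of b x y z] bead_relations(3)[of a x y z] by (simp add: endo_add)
  moreover have "d' = (up (down x (up y z)) (down y z),
      s (down x (up y z)) (down y z) (r x (up y z) a) \<boxplus> t (down x (up y z)) (down y z) (r y z b))"
    "x'' = (down (down x (up y z)) (down y z), r (down x (up y z)) (down y z) (r x (up y z) a))"
    using X(6) unfolding 3 4 fst_conv snd_conv by blast+
  ultimately show ?case
    using \<open>y2 = _\<close> 2(2) by (simp only: yang_baxter_labels(2,3)[of x y z] bead_relations(1)[OF M(1), of x y z])
next
  case (11 p)
  then show ?case using labeled_kink_crossing by (cases p) blast
next
  case (12 p')
  obtain p where p: "p \<in> UNIV \<times> M" "labeled_kink p = p'" using labeled_kink_pred[OF 12] by blast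
  then show ?case using labeled_kink_crossing by (cases p) blast
next
  case (13 p q p' q2 p2)
  obtain x a y b z c y2 b2 z2 c2 where p: "p = (x, a)" "q = (y, b)" "p' = (z, c)" "q2 = (y2, b2)" "p2 = (z2, c2)"
    by (metis surj_pair)
  then have "a \<in> M" using 13 by (auto simp: bead_crossing_def)
  then show ?case using 13 unfolding p by (simp add: bead_crossing_kink)
next
  case (14 p q p' p2 q2)
  obtain x a y b z c y2 b2 x2 a2 where p: "p = (x, a)" "q = (y, b)" "p' = (z, c)" "q2 = (y2, b2)" "p2 = (x2, a2)"
    by (metis surj_pair)
  then have M: "a \<in> M" "a2 \<in> M" using 14 by (auto simp: bead_crossing_def)
  have "(z, c) = labeled_kink (x, a)" "(z, c) = labeled_kink (x2, a2)"
    using 14 bead_crossing_kink M unfolding p by blast+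
  then show ?case using M labeled_kink_inj[of p p2] unfolding p by simp
qed

lemma labeled_kink_eq: "p \<in> UNIV \<times> M \<Longrightarrow> labeled.kink p = labeled_kink p"
  using labeled.kink_eqI[OF labeled_kink_crossing] by (cases p) simp

definition zero_bead :: "'x \<times> 'm \<Rightarrow> 'x \<times> 'm"
  where "zero_bead p = (fst p, \<zero>\<^bsub>R\<^esub>)"

definition add_beads :: "'x \<times> 'm \<Rightarrow> 'x \<times> 'm \<Rightarrow> 'x \<times> 'm"
  where "add_beads p q = (fst p, snd p \<boxplus> snd q)"

text \<open>Written with two bead arguments so that scalars and addition belong to one family of
  binary operations.\<close>

definition smult_bead :: "'k \<Rightarrow> 'x \<times> 'm \<Rightarrow> 'x \<times> 'm \<Rightarrow> 'x \<times> 'm"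
  where "smult_bead k p q = (fst p, k \<odot>\<^bsub>R\<^esub> snd p)"

text \<open>For fixed labels the crossing equations are \<open>K\<close>-linear in the beads, so the
  fibrewise operations preserve crossings.\<close>

sublocale labeled: fibred_birack "UNIV \<times> M" bead_crossing "birack_rank B" zero_bead
  "{\<lambda>p q. zero_bead p, add_beads} \<union> smult_bead ` carrier K"
proof (unfold_locales, goal_cases)
  case 1
  show ?case by (rule birack_rank(1))
next
  case (2 p)
  have "(labeled.kink ^^ n) p = (labeled_kink ^^ n) p \<and> (labeled_kink ^^ n) p \<in> UNIV \<times> M" for n
  proof (induction n)
    case (Suc n)
    then show ?case using labeled_kink_in labeled_kink_eq by simp
  qed (use 2 in simp)
  then show ?case using labeled_kink_period[OF 2] by simp
next
  case 3
  show ?case by simp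
next
  case (4 h p q p' q' p2 q2 p2' q2')
  then have fst: "fst p2 = fst p" "fst q2 = fst q" by (simp_all add: zero_bead_def)
  have M: "snd p \<in> M" "snd q \<in> M" "snd p2 \<in> M" "snd q2 \<in> M" using 4 by (simp_all add: bead_crossing_def)
  consider "h = (\<lambda>p q. zero_bead p)" | "h = add_beads" | k where "k \<in> carrier K" "h = smult_bead k" using 4(1) by blast
  then show ?case
  proof cases
    case 1
    show ?thesis using 4(2) unfolding 1 by (simp add: bead_crossing_def zero_bead_def)
  next
    case 2
    show ?thesis using 4(2,3) M fst unfolding 2
      by (simp add: bead_crossing_def add_beads_def endo_add M.a_ac)
  next
    case 3
    show ?thesis using 4(2,3) M fst 3
      by (simp add: bead_crossing_def smult_bead_def endo_smult smult_r_distr)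
  qed
qed

end

section \<open>Bead modules\<close>

lemma module_isomorphic_sym:
  assumes "Module.module K M" "module_isomorphic K M M'"
  shows "module_isomorphic K M' M"
proof -
  interpret Module.module K M by fact
  obtain h where h: "bij_betw h (carrier M) (carrier M')"
    "\<And>a b. a \<in> carrier M \<Longrightarrow> b \<in> carrier M \<Longrightarrow> h (a \<oplus>\<^bsub>M\<^esub> b) = h a \<oplus>\<^bsub>M'\<^esub> h b"
    "\<And>k a. k \<in> carrier K \<Longrightarrow> a \<in> carrier M \<Longrightarrow> h (k \<odot>\<^bsub>M\<^esub> a) = k \<odot>\<^bsub>M'\<^esub> h a"
    using assms(2) unfolding module_isomorphic_def by blast
  define g where "g = inv_into (carrier M) h"
  have g: "bij_betw g (carrier M') (carrier M)" unfolding g_def by (rule bij_betw_inv_into[OF h(1)])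
  have gM: "g a \<in> carrier M" "h (g a) = a" if "a \<in> carrier M'" for a
    using bij_betwE[OF g] bij_betw_inv_into_right[OF h(1)] that unfolding g_def by auto
  have g_eq: "g a = b" if "b \<in> carrier M" "h b = a" for a b
    using bij_betw_inv_into_left[OF h(1)] that unfolding g_def by auto
  have "g (a \<oplus>\<^bsub>M'\<^esub> b) = g a \<oplus>\<^bsub>M\<^esub> g b" if "a \<in> carrier M'" "b \<in> carrier M'" for a b
    using that gM by (intro g_eq) (simp_all add: h(2))
  moreover have "g (k \<odot>\<^bsub>M'\<^esub> a) = k \<odot>\<^bsub>M\<^esub> g a" if "k \<in> carrier K" "a \<in> carrier M'" for k a
    using that gM by (intro g_eq) (simp_all add: h(3))
  ultimately show ?thesis unfolding module_isomorphic_def using g by blast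
qed

lemma module_isomorphic_trans:
  assumes "module_isomorphic K M M'" "module_isomorphic K M' M''"
  shows "module_isomorphic K M M''"
proof -
  obtain h where h: "bij_betw h (carrier M) (carrier M')"
    "\<forall>a\<in>carrier M. \<forall>b\<in>carrier M. h (a \<oplus>\<^bsub>M\<^esub> b) = h a \<oplus>\<^bsub>M'\<^esub> h b"
    "\<forall>k\<in>carrier K. \<forall>a\<in>carrier M. h (k \<odot>\<^bsub>M\<^esub> a) = k \<odot>\<^bsub>M'\<^esub> h a"
    using assms(1) unfolding module_isomorphic_def by blast
  obtain g where g: "bij_betw g (carrier M') (carrier M'')"
    "\<forall>a\<in>carrier M'. \<forall>b\<in>carrier M'. g (a \<oplus>\<^bsub>M'\<^esub> b) = g a \<oplus>\<^bsub>M''\<^esub> g b"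
    "\<forall>k\<in>carrier K. \<forall>a\<in>carrier M'. g (k \<odot>\<^bsub>M'\<^esub> a) = k \<odot>\<^bsub>M''\<^esub> g a"
    using assms(2) unfolding module_isomorphic_def by blast
  have "h a \<in> carrier M'" if "a \<in> carrier M" for a using bij_betwE[OF h(1)] that by blast
  then show ?thesis
    unfolding module_isomorphic_def using h g bij_betw_trans[OF h(1) g(1)]
    by (intro exI[of _ "g \<circ> h"]) simp
qed

lemma iso_class_eq:
  assumes "Module.module K M" "module_isomorphic K M M'"
  shows "iso_class K M = iso_class K M'"
  unfolding iso_class_def
  using module_isomorphic_trans[OF assms(2)] module_isomorphic_trans[OF module_isomorphic_sym[OF assms]] by blast

text \<open>An isomorphism carries a finite independent set to one of the same size. Comparing
  suprema this way gives an inequality, and its use for the inverse isomorphism gives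
  equality.\<close>

lemma module_rank_le:
  fixes M :: "('k, 'm, 'b) module_scheme"
  assumes M: "Module.module K M" and M': "Module.module K M'" and iso: "module_isomorphic K M M'"
  shows "module_rank K M \<le> module_rank K M'"
proof -
  interpret M: Module.module K M by fact
  interpret M': Module.module K M' by fact
  obtain h where b: "bij_betw h (carrier M) (carrier M')"
    and add: "\<And>a b. a \<in> carrier M \<Longrightarrow> b \<in> carrier M \<Longrightarrow> h (a \<oplus>\<^bsub>M\<^esub> b) = h a \<oplus>\<^bsub>M'\<^esub> h b"
    and smult: "\<And>k a. k \<in> carrier K \<Longrightarrow> a \<in> carrier M \<Longrightarrow> h (k \<odot>\<^bsub>M\<^esub> a) = k \<odot>\<^bsub>M'\<^esub> h a"
    using iso unfolding module_isomorphic_def by blast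
  have hM: "h a \<in> carrier M'" if "a \<in> carrier M" for a using bij_betwE[OF b] that by blast
  have inj: "a = b" if "a \<in> carrier M" "b \<in> carrier M" "h a = h b" for a b
    using bij_betw_imp_inj_on[OF b] that unfolding inj_on_def by blast
  have zero: "h \<zero>\<^bsub>M\<^esub> = \<zero>\<^bsub>M'\<^esub>"
    using smult[OF M.R.zero_closed M.M.zero_closed] M.smult_l_null[OF M.M.zero_closed]
      M'.smult_l_null[OF hM[OF M.M.zero_closed]] by simp
  have sum: "h (\<Oplus>\<^bsub>M\<^esub>a\<in>S. f a) = (\<Oplus>\<^bsub>M'\<^esub>a\<in>S. h (f a))" if "finite S" "f \<in> S \<rightarrow> carrier M" for S :: "'m set" and f
    using that
  proof (induction S)
    case empty
    then show ?case by (simp add: zero)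
  next
    case (insert x S)
    then have "f \<in> S \<rightarrow> carrier M" "f x \<in> carrier M" by auto
    moreover from this have "(\<lambda>a. h (f a)) \<in> S \<rightarrow> carrier M'" using hM by auto
    ultimately show ?case using insert by (simp add: M.M.finsum_insert M'.M.finsum_insert add hM)
  qed
  have ind: "lin_independent K M' (h ` S) \<and> card (h ` S) = card S" if "lin_independent K M S" for S
  proof -
    have S: "finite S" "S \<subseteq> carrier M"
      and 0: "\<And>c. c \<in> S \<rightarrow> carrier K \<Longrightarrow> (\<Oplus>\<^bsub>M\<^esub>a\<in>S. c a \<odot>\<^bsub>M\<^esub> a) = \<zero>\<^bsub>M\<^esub> \<Longrightarrow> \<forall>a\<in>S. c a = \<zero>\<^bsub>K\<^esub>"
      using that unfolding lin_independent_def by blast+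
    have injS: "inj_on h S" using inj S by (auto intro!: inj_onI)
    have "\<forall>a\<in>h ` S. c a = \<zero>\<^bsub>K\<^esub>"
      if c: "c \<in> h ` S \<rightarrow> carrier K" and z: "(\<Oplus>\<^bsub>M'\<^esub>a\<in>h ` S. c a \<odot>\<^bsub>M'\<^esub> a) = \<zero>\<^bsub>M'\<^esub>" for c
    proof -
      have cS: "(\<lambda>a. c (h a)) \<in> S \<rightarrow> carrier K" using c by auto
      have cK: "c (h a) \<in> carrier K" if "a \<in> S" for a using c that by auto
      then have cM: "(\<lambda>a. c (h a) \<odot>\<^bsub>M\<^esub> a) \<in> S \<rightarrow> carrier M" using S by auto
      have "(\<lambda>a. c a \<odot>\<^bsub>M'\<^esub> a) \<in> h ` S \<rightarrow> carrier M'" using c S hM by auto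
      then have "(\<Oplus>\<^bsub>M'\<^esub>a\<in>h ` S. c a \<odot>\<^bsub>M'\<^esub> a) = (\<Oplus>\<^bsub>M'\<^esub>a\<in>S. c (h a) \<odot>\<^bsub>M'\<^esub> h a)"
        by (rule M'.M.finsum_reindex[OF _ injS])
      also have "\<dots> = (\<Oplus>\<^bsub>M'\<^esub>a\<in>S. h (c (h a) \<odot>\<^bsub>M\<^esub> a))"
        using S by (intro M'.M.finsum_cong') (auto simp: smult cK hM subsetD)
      also have "\<dots> = h (\<Oplus>\<^bsub>M\<^esub>a\<in>S. c (h a) \<odot>\<^bsub>M\<^esub> a)" by (rule sum[OF S(1) cM, symmetric])
      finally have "h (\<Oplus>\<^bsub>M\<^esub>a\<in>S. c (h a) \<odot>\<^bsub>M\<^esub> a) = h \<zero>\<^bsub>M\<^esub>" using z zero by simp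
      then have "(\<Oplus>\<^bsub>M\<^esub>a\<in>S. c (h a) \<odot>\<^bsub>M\<^esub> a) = \<zero>\<^bsub>M\<^esub>"
        using M.M.finsum_closed[OF cM] by (intro inj) simp_all
      then show ?thesis using 0[OF cS] by blast
    qed
    moreover have "finite (h ` S)" "h ` S \<subseteq> carrier M'" using S hM by auto
    ultimately show ?thesis using card_image[OF injS] unfolding lin_independent_def by blast
  qed
  show ?thesis
    unfolding module_rank_def
  proof (rule SUP_mono)
    fix S assume "S \<in> {S. lin_independent K M S}"
    then show "\<exists>S'\<in>{S. lin_independent K M' S}. enat (card S) \<le> enat (card S')"
      using ind[of S] by (intro bexI[of _ "h ` S"]) auto
  qed
qed

section \<open>Bead modules as fibres of the set of colorings\<close>

context finite_birack_module
begin

abbreviation arcs where "arcs \<equiv> labeled.arc_labelings"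
abbreviation beads where "beads \<equiv> bead_labelings R t s r"
abbreviation bmodule where "bmodule \<equiv> bead_module R t s r"
abbreviation no_beads :: "gauss_code \<Rightarrow> semiarc \<Rightarrow> 'm" where "no_beads D \<equiv> \<lambda>p\<in>semiarcs D. \<zero>\<^bsub>R\<^esub>"

definition labeling_of :: "gauss_code \<Rightarrow> (semiarc \<Rightarrow> 'x \<times> 'm) \<Rightarrow> semiarc \<Rightarrow> 'x"
  where "labeling_of D v = (\<lambda>p\<in>semiarcs D. fst (v p))"

definition beads_of :: "gauss_code \<Rightarrow> (semiarc \<Rightarrow> 'x \<times> 'm) \<Rightarrow> semiarc \<Rightarrow> 'm"
  where "beads_of D v = (\<lambda>p\<in>semiarcs D. snd (v p))"

definition labeled_beads :: "gauss_code \<Rightarrow> (semiarc \<Rightarrow> 'x) \<Rightarrow> (semiarc \<Rightarrow> 'm) \<Rightarrow> semiarc \<Rightarrow> 'x \<times> 'm"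
  where "labeled_beads D f g = (\<lambda>p\<in>semiarcs D. (f p, g p))"

lemma beads_eqI: "g \<in> beads D f \<Longrightarrow> g' \<in> beads D f \<Longrightarrow> (\<And>p. p \<in> semiarcs D \<Longrightarrow> g p = g' p) \<Longrightarrow> g = g'"
  unfolding bead_labelings_def by (blast intro: PiE_ext)

lemma labeled_beads_in:
  assumes f: "f \<in> labelings B D" and g: "g \<in> beads D f"
  shows "labeled_beads D f g \<in> arcs D"
  unfolding labeled_beads_def
proof (rule labeled.arc_labelingsI)
  show gM: "(f p, g p) \<in> UNIV \<times> M" if "p \<in> semiarcs D" for p
    using g that by (auto simp: bead_labelings_def)
  fix p q p' q' assume c: "(p, q, p', q') \<in> crossings D"
  then have "{p, q, p', q'} \<subseteq> semiarcs D" by (rule crossings_semiarcs)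
  moreover have "f p' = up (f p) (f q) \<and> f q' = down (f p) (f q)" using f c unfolding labelings_def by blast
  moreover have "g p' = s (f p) (f q) (g p) \<boxplus> t (f p) (f q) (g q) \<and> g q' = r (f p) (f q) (g p)"
    using g c unfolding bead_labelings_def by blast
  ultimately show "bead_crossing (f p, g p) (f q, g q) (f p', g p') (f q', g q')"
    using gM by (simp add: bead_crossing_iff)
qed

lemma labeling_of_in:
  assumes v: "v \<in> arcs D"
  shows "labeling_of D v \<in> labelings B D" "beads_of D v \<in> beads D (labeling_of D v)"
proof -
  note a = labeled.arc_labelingsD[OF v]
  have c: "{p, q, p', q'} \<subseteq> semiarcs D" "v p' = (up (fst (v p)) (fst (v q)), s (fst (v p)) (fst (v q)) (snd (v p)) \<boxplus> t (fst (v p)) (fst (v q)) (snd (v q)))"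
    "v q' = (down (fst (v p)) (fst (v q)), r (fst (v p)) (fst (v q)) (snd (v p)))"
    if "(p, q, p', q') \<in> crossings D" for p q p' q'
    using crossings_semiarcs[OF that] a(2)[OF that] by (simp_all add: bead_crossing_def)
  show "labeling_of D v \<in> labelings B D"
    unfolding labelings_def
  proof (intro CollectI conjI)
    show "labeling_of D v \<in> semiarcs D \<rightarrow>\<^sub>E UNIV" by (simp add: labeling_of_def)
    show "\<forall>(p, q, p', q')\<in>crossings D. labeling_of D v p' = up (labeling_of D v p) (labeling_of D v q) \<and>
        labeling_of D v q' = down (labeling_of D v p) (labeling_of D v q)"
    proof clarify
      fix p q p' q' assume "(p, q, p', q') \<in> crossings D"
      from c[OF this] show "labeling_of D v p' = up (labeling_of D v p) (labeling_of D v q) \<and>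
          labeling_of D v q' = down (labeling_of D v p) (labeling_of D v q)" by (simp add: labeling_of_def)
    qed
  qed
  show "beads_of D v \<in> beads D (labeling_of D v)"
    unfolding bead_labelings_def
  proof (intro CollectI conjI)
    have "snd (v p) \<in> M" if "p \<in> semiarcs D" for p using a(1)[OF that] by (simp add: mem_Times_iff)
    then show "beads_of D v \<in> semiarcs D \<rightarrow>\<^sub>E M" by (simp add: beads_of_def)
    show "\<forall>(p, q, p', q')\<in>crossings D.
        beads_of D v p' = s (labeling_of D v p) (labeling_of D v q) (beads_of D v p) \<boxplus> t (labeling_of D v p) (labeling_of D v q) (beads_of D v q) \<and>
        beads_of D v q' = r (labeling_of D v p) (labeling_of D v q) (beads_of D v p)"
    proof clarify
      fix p q p' q' assume "(p, q, p', q') \<in> crossings D"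
      from c[OF this] show "beads_of D v p' = s (labeling_of D v p) (labeling_of D v q) (beads_of D v p) \<boxplus> t (labeling_of D v p) (labeling_of D v q) (beads_of D v q) \<and>
          beads_of D v q' = r (labeling_of D v p) (labeling_of D v q) (beads_of D v p)"
        by (simp add: labeling_of_def beads_of_def)
    qed
  qed
qed

lemma labeled_beads_of: "v \<in> arcs D \<Longrightarrow> labeled_beads D (labeling_of D v) (beads_of D v) = v"
  unfolding labeled_beads_def labeling_of_def beads_of_def labeled.arc_labelings_def
  by (auto simp: PiE_def extensional_def)

lemma of_labeled_beads:
  assumes "f \<in> labelings B D" "g \<in> beads D f"
  shows "labeling_of D (labeled_beads D f g) = f" "beads_of D (labeled_beads D f g) = g"
  using assms unfolding labeled_beads_def labeling_of_def beads_of_def labelings_def bead_labelings_def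
  by (auto simp: PiE_def extensional_def)

lemma labeling_of_labeled_beads: "f \<in> labelings B D \<Longrightarrow> labeling_of D (labeled_beads D f g) = f"
  unfolding labeled_beads_def labeling_of_def labelings_def by (auto simp: PiE_def extensional_def)

lemma zero_beads:
  assumes "f \<in> labelings B D"
  shows "no_beads D \<in> beads D f"
  unfolding bead_labelings_def
proof (intro CollectI conjI)
  show "no_beads D \<in> semiarcs D \<rightarrow>\<^sub>E M" by simp
  show "\<forall>(p, q, p', q')\<in>crossings D.
      no_beads D p' = s (f p) (f q) (no_beads D p) \<boxplus> t (f p) (f q) (no_beads D q) \<and>
      no_beads D q' = r (f p) (f q) (no_beads D p)"
  proof clarify
    fix p q p' q' assume "(p, q, p', q') \<in> crossings D"
    then have "{p, q, p', q'} \<subseteq> semiarcs D" by (rule crossings_semiarcs)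
    then show "no_beads D p' = s (f p) (f q) (no_beads D p) \<boxplus> t (f p) (f q) (no_beads D q) \<and>
      no_beads D q' = r (f p) (f q) (no_beads D p)" by simp
  qed
qed

lemma labeled_beads_add:
  "labeled_beads D f (\<lambda>p\<in>semiarcs D. g p \<boxplus> g' p) =
    (\<lambda>p\<in>semiarcs D. add_beads (labeled_beads D f g p) (labeled_beads D f g' p))"
  by (auto simp: labeled_beads_def add_beads_def)

lemma labeled_beads_smult:
  "labeled_beads D f (\<lambda>p\<in>semiarcs D. k \<odot>\<^bsub>R\<^esub> g p) =
    (\<lambda>p\<in>semiarcs D. smult_bead k (labeled_beads D f g p) (labeled_beads D f g p))"
  by (auto simp: labeled_beads_def smult_bead_def)

lemma zero_labeled_beads:
  "(\<lambda>p\<in>semiarcs D. zero_bead (v p)) = labeled_beads D (labeling_of D v) (no_beads D)"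
  by (auto simp: labeled_beads_def labeling_of_def zero_bead_def)

lemma same_fibre: "\<forall>p\<in>semiarcs D. zero_bead (labeled_beads D f g p) = zero_bead (labeled_beads D f g' p)"
  by (simp add: labeled_beads_def zero_bead_def)

text \<open>The crossing equations are not checked again: the sum is the bead part of the fibrewise
  sum of two colorings over \<open>f\<close>.\<close>

lemma beads_add:
  assumes f: "f \<in> labelings B D" and g: "g \<in> beads D f" "g' \<in> beads D f"
  shows "(\<lambda>p\<in>semiarcs D. g p \<boxplus> g' p) \<in> beads D f"
proof -
  have "labeled_beads D f (\<lambda>p\<in>semiarcs D. g p \<boxplus> g' p) \<in> arcs D"
    unfolding labeled_beads_add
    by (rule labeled.fibred_set_H[OF labeled.fibred_set_arc_labelings _ labeled_beads_in[OF f g(1)] labeled_beads_in[OF f g(2)] same_fibre]) simp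
  from labeling_of_in(2)[OF this] show ?thesis
    unfolding labeling_of_labeled_beads[OF f] by (simp add: labeled_beads_def beads_of_def cong: restrict_cong)
qed

lemma beads_smult:
  assumes f: "f \<in> labelings B D" and g: "g \<in> beads D f" and k: "k \<in> carrier K"
  shows "(\<lambda>p\<in>semiarcs D. k \<odot>\<^bsub>R\<^esub> g p) \<in> beads D f"
proof -
  have "labeled_beads D f (\<lambda>p\<in>semiarcs D. k \<odot>\<^bsub>R\<^esub> g p) \<in> arcs D"
    unfolding labeled_beads_smult
    by (rule labeled.fibred_set_H[OF labeled.fibred_set_arc_labelings _ labeled_beads_in[OF f g] labeled_beads_in[OF f g] same_fibre]) (simp add: k)
  from labeling_of_in(2)[OF this] show ?thesis
    unfolding labeling_of_labeled_beads[OF f] by (simp add: labeled_beads_def beads_of_def cong: restrict_cong)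
qed

lemma bmodule_simps:
  "carrier (bmodule D f) = beads D f"
  "zero (bmodule D f) = no_beads D"
  "add (bmodule D f) = (\<lambda>g h. \<lambda>p\<in>semiarcs D. g p \<boxplus> h p)"
  "smult (bmodule D f) = (\<lambda>k g. \<lambda>p\<in>semiarcs D. k \<odot>\<^bsub>R\<^esub> g p)"
  by (simp_all add: bead_module_def)

lemma bead_in: "g \<in> beads D f \<Longrightarrow> p \<in> semiarcs D \<Longrightarrow> g p \<in> M"
  unfolding bead_labelings_def by blast

lemma module_bmodule:
  assumes f: "f \<in> labelings B D"
  shows "Module.module K (bmodule D f)"
proof (rule moduleI)
  note c = beads_add[OF f] beads_smult[OF f] zero_beads[OF f]
  show "cring K" by (rule R.is_cring)
  show "abelian_group (bmodule D f)"
  proof (rule abelian_groupI, unfold bmodule_simps)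
    fix g g' g'' assume g: "g \<in> beads D f" "g' \<in> beads D f" "g'' \<in> beads D f"
    show "(\<lambda>p\<in>semiarcs D. g p \<boxplus> g' p) \<in> beads D f" by (rule c(1)[OF g(1,2)])
    show "(\<lambda>p\<in>semiarcs D. (\<lambda>p\<in>semiarcs D. g p \<boxplus> g' p) p \<boxplus> g'' p) =
        (\<lambda>p\<in>semiarcs D. g p \<boxplus> (\<lambda>p\<in>semiarcs D. g' p \<boxplus> g'' p) p)"
      by (rule restrict_ext) (simp add: g[THEN bead_in] M.a_assoc)
    show "(\<lambda>p\<in>semiarcs D. g p \<boxplus> g' p) = (\<lambda>p\<in>semiarcs D. g' p \<boxplus> g p)"
      by (rule restrict_ext) (simp add: g[THEN bead_in] M.a_comm)
  next
    fix g assume g: "g \<in> beads D f"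
    show "(\<lambda>p\<in>semiarcs D. no_beads D p \<boxplus> g p) = g"
      by (rule beads_eqI[OF c(1)[OF c(3) g] g]) (simp add: bead_in[OF g])
    show "\<exists>g'\<in>beads D f. (\<lambda>p\<in>semiarcs D. g' p \<boxplus> g p) = no_beads D"
    proof (intro bexI restrict_ext)
      \<comment> \<open>Taking the opposite as the multiple by minus one reduces its membership to
        closure under scalars.\<close>
      show "(\<lambda>p\<in>semiarcs D. (\<ominus>\<^bsub>K\<^esub> \<one>\<^bsub>K\<^esub>) \<odot>\<^bsub>R\<^esub> g p) \<in> beads D f" using g by (intro c(2)) simp_all
      fix p assume "p \<in> semiarcs D"
      then show "(\<lambda>p\<in>semiarcs D. (\<ominus>\<^bsub>K\<^esub> \<one>\<^bsub>K\<^esub>) \<odot>\<^bsub>R\<^esub> g p) p \<boxplus> g p = \<zero>\<^bsub>R\<^esub>"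
        using bead_in[OF g] by (simp add: smult_l_minus M.l_neg)
    qed
  qed (rule c(3))
next
  fix k l g g' assume k: "k \<in> carrier K" "l \<in> carrier K" and "g \<in> carrier (bmodule D f)" "g' \<in> carrier (bmodule D f)"
  then have g: "g \<in> beads D f" "g' \<in> beads D f" by (simp_all only: bmodule_simps)
  show "k \<odot>\<^bsub>bmodule D f\<^esub> g \<in> carrier (bmodule D f)"
    unfolding bmodule_simps by (rule beads_smult[OF f g(1) k(1)])
  show "(k \<oplus>\<^bsub>K\<^esub> l) \<odot>\<^bsub>bmodule D f\<^esub> g = k \<odot>\<^bsub>bmodule D f\<^esub> g \<oplus>\<^bsub>bmodule D f\<^esub> l \<odot>\<^bsub>bmodule D f\<^esub> g"
    unfolding bmodule_simps by (rule restrict_ext) (simp add: g[THEN bead_in] k smult_l_distr)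
  show "k \<odot>\<^bsub>bmodule D f\<^esub> (g \<oplus>\<^bsub>bmodule D f\<^esub> g') = k \<odot>\<^bsub>bmodule D f\<^esub> g \<oplus>\<^bsub>bmodule D f\<^esub> k \<odot>\<^bsub>bmodule D f\<^esub> g'"
    unfolding bmodule_simps by (rule restrict_ext) (simp add: g[THEN bead_in] k smult_r_distr)
  show "(k \<otimes>\<^bsub>K\<^esub> l) \<odot>\<^bsub>bmodule D f\<^esub> g = k \<odot>\<^bsub>bmodule D f\<^esub> (l \<odot>\<^bsub>bmodule D f\<^esub> g)"
    unfolding bmodule_simps by (rule restrict_ext) (simp add: g[THEN bead_in] k smult_assoc1)
next
  fix g assume "g \<in> carrier (bmodule D f)"
  then have g: "g \<in> beads D f" by (simp only: bmodule_simps)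
  show "\<one>\<^bsub>K\<^esub> \<odot>\<^bsub>bmodule D f\<^esub> g = g"
    unfolding bmodule_simps by (rule beads_eqI[OF beads_smult[OF f g R.one_closed] g]) (simp add: bead_in[OF g])
qed

text \<open>\<open>\<Psi>\<close> commutes with the projection to zero beads, so the labels of
  \<open>\<Psi> v\<close> depend only on the labels of \<open>v\<close>.\<close>

lemma equivariant_labeling:
  assumes \<Psi>: "labeled.equivariant_bij (semiarcs D) (arcs D) (semiarcs D') (arcs D') \<Psi>" and v: "v \<in> arcs D"
  shows "labeling_of D' (\<Psi> v) = labeling_of D' (\<Psi> (labeled_beads D (labeling_of D v) (no_beads D)))"
proof -
  note E = labeled.equivariant_bijD[OF labeled.fibred_set_arc_labelings labeled.fibred_set_arc_labelings \<Psi>]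
  have "\<Psi> (labeled_beads D (labeling_of D v) (no_beads D)) = (\<lambda>p\<in>semiarcs D'. zero_bead (\<Psi> v p))"
    unfolding zero_labeled_beads[symmetric] by (rule E(3)[OF v])
  then show ?thesis by (auto simp: labeling_of_def zero_bead_def)
qed

text \<open>A labeling is lifted to the coloring with zero beads, moved by \<open>\<Psi>\<close>,
  and its labels are read off. The inverse of \<open>\<Psi>\<close> gives the inverse map in the
  same way, and over a fixed \<open>f\<close> the map \<open>\<Psi>\<close> restricts to a linear
  bijection of the bead modules.\<close>

lemma labelings_bij:
  assumes \<Psi>: "labeled.equivariant_bij (semiarcs D) (arcs D) (semiarcs D') (arcs D') \<Psi>"
  obtains \<beta> where "bij_betw \<beta> (labelings B D) (labelings B D')"
    and "\<And>f. f \<in> labelings B D \<Longrightarrow> module_isomorphic K (bmodule D f) (bmodule D' (\<beta> f))"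
proof -
  note fib = labeled.fibred_set_arc_labelings
  note E = labeled.equivariant_bijD[OF fib fib \<Psi>]
  define \<Psi>' where "\<Psi>' = inv_into (arcs D) \<Psi>"
  have \<Psi>': "labeled.equivariant_bij (semiarcs D') (arcs D') (semiarcs D) (arcs D) \<Psi>'"
    unfolding \<Psi>'_def by (rule labeled.equivariant_bij_inv[OF fib fib \<Psi>])
  note E' = labeled.equivariant_bijD[OF fib fib \<Psi>']
  have inv: "v \<in> arcs D \<Longrightarrow> \<Psi>' (\<Psi> v) = v" "w \<in> arcs D' \<Longrightarrow> \<Psi> (\<Psi>' w) = w" for v w
    unfolding \<Psi>'_def using bij_betw_inv_into_left[OF E(1)] bij_betw_inv_into_right[OF E(1)] by auto
  let ?z = "\<lambda>D f. labeled_beads D f (no_beads D)"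
  define \<beta> where "\<beta> f = labeling_of D' (\<Psi> (?z D f))" for f
  define \<beta>' where "\<beta>' f = labeling_of D (\<Psi>' (?z D' f))" for f
  have \<beta>: "labeling_of D' (\<Psi> v) = \<beta> (labeling_of D v)" if "v \<in> arcs D" for v
    unfolding \<beta>_def by (rule equivariant_labeling[OF \<Psi> that])
  have \<beta>': "labeling_of D (\<Psi>' w) = \<beta>' (labeling_of D' w)" if "w \<in> arcs D'" for w
    unfolding \<beta>'_def by (rule equivariant_labeling[OF \<Psi>' that])
  have zin: "?z D f \<in> arcs D" if "f \<in> labelings B D" for D f by (rule labeled_beads_in[OF that zero_beads[OF that]])
  have \<beta>_in: "\<beta> f \<in> labelings B D'" if "f \<in> labelings B D" for f
    unfolding \<beta>_def by (rule labeling_of_in(1)[OF E(2)[OF zin[OF that]]])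
  have \<beta>'_in: "\<beta>' f \<in> labelings B D" if "f \<in> labelings B D'" for f
    unfolding \<beta>'_def by (rule labeling_of_in(1)[OF E'(2)[OF zin[OF that]]])
  have \<beta>'\<beta>: "\<beta>' (\<beta> f) = f" if f: "f \<in> labelings B D" for f
    using \<beta>'[OF E(2)[OF zin[OF f]]] inv(1)[OF zin[OF f]] of_labeled_beads(1)[OF f zero_beads[OF f]]
    unfolding \<beta>_def by simp
  have \<beta>\<beta>': "\<beta> (\<beta>' f) = f" if f: "f \<in> labelings B D'" for f
    using \<beta>[OF E'(2)[OF zin[OF f]]] inv(2)[OF zin[OF f]] of_labeled_beads(1)[OF f zero_beads[OF f]]
    unfolding \<beta>'_def by simp
  have bij: "bij_betw \<beta> (labelings B D) (labelings B D')"
    by (rule bij_betw_byWitness[where f' = \<beta>']) (use \<beta>_in \<beta>'_in \<beta>'\<beta> \<beta>\<beta>' in auto)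
  have iso: "module_isomorphic K (bmodule D f) (bmodule D' (\<beta> f))" if f: "f \<in> labelings B D" for f
  proof -
    define h where "h g = beads_of D' (\<Psi> (labeled_beads D f g))" for g
    define h' where "h' g = beads_of D (\<Psi>' (labeled_beads D' (\<beta> f) g))" for g
    have h: "\<Psi> (labeled_beads D f g) = labeled_beads D' (\<beta> f) (h g)" "h g \<in> beads D' (\<beta> f)" if g: "g \<in> beads D f" for g
    proof -
      note i = labeled_beads_in[OF f g]
      have l: "labeling_of D' (\<Psi> (labeled_beads D f g)) = \<beta> f" using \<beta>[OF i] of_labeled_beads(1)[OF f g] by simp
      show "\<Psi> (labeled_beads D f g) = labeled_beads D' (\<beta> f) (h g)"
        using labeled_beads_of[OF E(2)[OF i]] unfolding l h_def by simp
      show "h g \<in> beads D' (\<beta> f)" using labeling_of_in(2)[OF E(2)[OF i]] unfolding l h_def .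
    qed
    note \<beta>f = \<beta>_in[OF f]
    have h': "\<Psi>' (labeled_beads D' (\<beta> f) g) = labeled_beads D f (h' g)" "h' g \<in> beads D f" if g: "g \<in> beads D' (\<beta> f)" for g
    proof -
      note i = labeled_beads_in[OF \<beta>f g]
      have l: "labeling_of D (\<Psi>' (labeled_beads D' (\<beta> f) g)) = f"
        using \<beta>'[OF i] of_labeled_beads(1)[OF \<beta>f g] \<beta>'\<beta>[OF f] by simp
      show "\<Psi>' (labeled_beads D' (\<beta> f) g) = labeled_beads D f (h' g)"
        using labeled_beads_of[OF E'(2)[OF i]] unfolding l h'_def by simp
      show "h' g \<in> beads D f" using labeling_of_in(2)[OF E'(2)[OF i]] unfolding l h'_def .
    qed
    have h'h: "h' (h g) = g" if g: "g \<in> beads D f" for g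
      using inv(1)[OF labeled_beads_in[OF f g]] of_labeled_beads(2)[OF f g] unfolding h(1)[OF g] h'_def by simp
    have hh': "h (h' g) = g" if g: "g \<in> beads D' (\<beta> f)" for g
      using inv(2)[OF labeled_beads_in[OF \<beta>f g]] of_labeled_beads(2)[OF \<beta>f g] unfolding h'(1)[OF g] h_def by simp
    have "bij_betw h (beads D f) (beads D' (\<beta> f))"
      by (rule bij_betw_byWitness[where f' = h']) (use h(2) h'(2) h'h hh' in auto)
    moreover have "h (\<lambda>p\<in>semiarcs D. g p \<boxplus> g' p) = (\<lambda>p\<in>semiarcs D'. h g p \<boxplus> h g' p)"
      if g: "g \<in> beads D f" "g' \<in> beads D f" for g g'
    proof -
      have "\<Psi> (labeled_beads D f (\<lambda>p\<in>semiarcs D. g p \<boxplus> g' p)) =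
          (\<lambda>p\<in>semiarcs D'. add_beads (\<Psi> (labeled_beads D f g) p) (\<Psi> (labeled_beads D f g') p))"
        unfolding labeled_beads_add
        by (rule E(5)[OF _ labeled_beads_in[OF f g(1)] labeled_beads_in[OF f g(2)] same_fibre]) simp
      then show ?thesis by (auto simp: h_def beads_of_def add_beads_def)
    qed
    moreover have "h (\<lambda>p\<in>semiarcs D. k \<odot>\<^bsub>R\<^esub> g p) = (\<lambda>p\<in>semiarcs D'. k \<odot>\<^bsub>R\<^esub> h g p)"
      if k: "k \<in> carrier K" and g: "g \<in> beads D f" for k g
    proof -
      have "\<Psi> (labeled_beads D f (\<lambda>p\<in>semiarcs D. k \<odot>\<^bsub>R\<^esub> g p)) =
          (\<lambda>p\<in>semiarcs D'. smult_bead k (\<Psi> (labeled_beads D f g) p) (\<Psi> (labeled_beads D f g) p))"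
        unfolding labeled_beads_smult
        by (rule E(5)[OF _ labeled_beads_in[OF f g] labeled_beads_in[OF f g] same_fibre]) (simp add: k)
      then show ?thesis by (auto simp: h_def beads_of_def smult_bead_def)
    qed
    ultimately show ?thesis unfolding module_isomorphic_def bmodule_simps by blast
  qed
  show ?thesis using that bij iso by blast
qed

text \<open>Finiteness of \<open>R\<close> decides between cardinality and rank and does not depend
  on the diagram, so both sides take the same branch, and each quantity is an isomorphism
  invariant.\<close>

lemma bead_exponent_cong:
  assumes f: "f \<in> labelings B D" "f' \<in> labelings B D'"
    and iso: "module_isomorphic K (bmodule D f) (bmodule D' f')"
  shows "bead_exponent K R t s r D f = bead_exponent K R t s r D' f'"
proof -
  note m = module_bmodule[OF f(1)] module_bmodule[OF f(2)]
  have "card (beads D f) = card (beads D' f')"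
    using iso bij_betw_same_card unfolding module_isomorphic_def bmodule_simps by blast
  moreover have "module_rank K (bmodule D f) = module_rank K (bmodule D' f')"
    by (intro antisym module_rank_le m iso module_isomorphic_sym[OF m(1) iso])
  ultimately show ?thesis by (simp add: bead_exponent_def)
qed

text \<open>The summand \<open>G\<close> is left open, subject only to invariance under isomorphism
  of bead modules, so that a single reindexing, by \<open>\<sigma>\<close> over framings and by
  \<open>\<beta>\<close> over labelings, serves both the polynomial and the multiset.\<close>

lemma sum_framings_eq:
  fixes G :: "gauss_code \<Rightarrow> (semiarc \<Rightarrow> 'x) \<Rightarrow> 'c::comm_monoid_add"
  assumes L: "gauss_diagram L" "gauss_diagram L'" and iso: "ambient_isotopic L L'"
    and F: "\<And>w. w \<in> framings (birack_rank B) L \<Longrightarrow> framed_diagram (birack_rank B) L w (F w)"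
    and F': "\<And>w. w \<in> framings (birack_rank B) L' \<Longrightarrow> framed_diagram (birack_rank B) L' w (F' w)"
    and G: "\<And>D D' f f'. f \<in> labelings B D \<Longrightarrow> f' \<in> labelings B D' \<Longrightarrow>
      module_isomorphic K (bmodule D f) (bmodule D' f') \<Longrightarrow> G D f = G D' f'"
  shows "(\<Sum>w\<in>framings (birack_rank B) L. \<Sum>f\<in>labelings B (F w). G (F w) f) =
    (\<Sum>w\<in>framings (birack_rank B) L'. \<Sum>f\<in>labelings B (F' w). G (F' w) f)"
proof -
  let ?W = "framings (birack_rank B)"
  let ?S = "\<lambda>D. \<Sum>f\<in>labelings B D. G D f"
  obtain \<sigma> where \<sigma>: "bij_betw \<sigma> (?W L) (?W L')"
    and sim: "\<And>w D D'. w \<in> ?W L \<Longrightarrow> framed_diagram (birack_rank B) L w D \<Longrightarrow>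
      framed_diagram (birack_rank B) L' (\<sigma> w) D' \<Longrightarrow>
      gauss_diagram D \<and> gauss_diagram D' \<and> labeled.similar D (\<lambda>_. 0) D' (\<lambda>_. 0)"
    using labeled.similar_ambient_isotopic[OF L iso] by blast
  have "?S (F w) = ?S (F' (\<sigma> w))" if w: "w \<in> ?W L" for w
  proof -
    have "\<sigma> w \<in> ?W L'" using bij_betwE[OF \<sigma>] w by blast
    then have "gauss_diagram (F w) \<and> gauss_diagram (F' (\<sigma> w)) \<and> labeled.similar (F w) (\<lambda>_. 0) (F' (\<sigma> w)) (\<lambda>_. 0)"
      using sim[OF w F[OF w] F'] by blast
    then obtain \<Psi> where "labeled.equivariant_bij (semiarcs (F w)) (arcs (F w)) (semiarcs (F' (\<sigma> w))) (arcs (F' (\<sigma> w))) \<Psi>"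
      using labeled.similar_arc_labelings by blast
    then obtain \<beta> where \<beta>: "bij_betw \<beta> (labelings B (F w)) (labelings B (F' (\<sigma> w)))"
      and i: "\<And>f. f \<in> labelings B (F w) \<Longrightarrow> module_isomorphic K (bmodule (F w) f) (bmodule (F' (\<sigma> w)) (\<beta> f))"
      using labelings_bij by blast
    have "?S (F w) = (\<Sum>f\<in>labelings B (F w). G (F' (\<sigma> w)) (\<beta> f))"
      using bij_betwE[OF \<beta>] i by (intro sum.cong refl G) auto
    also have "\<dots> = ?S (F' (\<sigma> w))" by (rule sum.reindex_bij_betw[OF \<beta>])
    finally show ?thesis .
  qed
  then have "(\<Sum>w\<in>?W L. ?S (F w)) = (\<Sum>w\<in>?W L. ?S (F' (\<sigma> w)))" by (rule sum.cong[OF refl])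
  also have "\<dots> = (\<Sum>w\<in>?W L'. ?S (F' w))" by (rule sum.reindex_bij_betw[OF \<sigma>])
  finally show ?thesis .
qed

end

theorem proposition2:
  fixes B :: "'x::finite \<times> 'x \<Rightarrow> 'x \<times> 'x"
    and K :: "('k, 'a) ring_scheme"
    and R :: "('k, 'm, 'b) module_scheme"
    and t s r :: "'x \<Rightarrow> 'x \<Rightarrow> 'm \<Rightarrow> 'm"
    and L L' :: gauss_code
    and F F' :: "(nat \<Rightarrow> nat) \<Rightarrow> gauss_code"
  assumes "birack B"
    and "birack_module B K R t s r"
    and "gauss_diagram L" and "gauss_diagram L'"
    and "ambient_isotopic L L'"
    and "\<And>w. w \<in> framings (birack_rank B) L \<Longrightarrow> framed_diagram (birack_rank B) L w (F w)"
    and "\<And>w. w \<in> framings (birack_rank B) L' \<Longrightarrow> framed_diagram (birack_rank B) L' w (F' w)"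
  shows "enhanced_polynomial B K R t s r L F = enhanced_polynomial B K R t s r L' F' \<and>
    enhanced_multiset B K R t s r L F = enhanced_multiset B K R t s r L' F'"
proof -
  have "Module.module K R" using assms(2) by (simp add: birack_module_def)
  then interpret finite_birack_module B K R t s r
    using assms(1,2) by (intro finite_birack_module.intro finite_birack.intro finite_birack_module_axioms.intro)
  show ?thesis
    unfolding enhanced_polynomial_def enhanced_multiset_def
  proof (intro conjI sum_framings_eq[OF assms(3-7)])
    fix D D' f f' assume f: "f \<in> labelings B D" "f' \<in> labelings B D'"
      and iso: "module_isomorphic K (bmodule D f) (bmodule D' f')"
    show "Poly_Mapping.single (bead_exponent K R t s r D f) (1 :: nat) = Poly_Mapping.single (bead_exponent K R t s r D' f') 1"
      by (simp only: bead_exponent_cong[OF f iso])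
    show "{#iso_class K (bmodule D f)#} = {#iso_class K (bmodule D' f')#}"
      by (simp only: iso_class_eq[OF module_bmodule[OF f(1)] iso])
  qed
qed

end
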